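(* Consider a coalescing skip-free process on the state space $S$ with every point initially occupied, and run it for time $T>0$. Let $a_1<b_1\le a_2<b_2\le\cdots\le a_n<b_n$ be points of $S$. Then $$\mathbb{P}\big(\text{no wall in any } (a_i,b_i),\ i=1,\dots,n\big)=\operatorname{Pf}(A),$$ where $A$ is the $2n\times 2n$ antisymmetric matrix indexed by the $2n$ endpoints $a_1,b_1,a_2,b_2,\dots,a_n,b_n$ (numbered $1,2,\dots,2n$ in this order), whose entry $A_{kl}$ for $k<l$ is the probability that two independent copies of the underlying process, started at the $k$-th and the $l$-th endpoint and run for time $T$, cross or meet.
   Context: Skip-free process: a (strong) Markov process describing the motion of one particle on a linearly ordered state space $S$, such that particles cannot change order without first meeting (occupying the same position at the same time). On $S=\mathbb{Z}$ this means nearest-neighbor transitions (discrete or continuous time); on $S=\mathbb{R}$ it means continuous paths (such as Brownian motion). Transition probabilities may be inhomogeneous in both space and time. Coalescing system with every point initially occupied (maximal entrance law): one particle starts from each point of $S$ at time $0$; particles move as independent copies of the underlying process until they meet; when two particles meet they merge and continue as one. Basins and walls at time $T$: the surviving particles at time $T$ partition $S$ into basins of attraction; the basin of a survivor $y$ is the contiguous set of initial positions whose particle has coalesced with $y$ by time $T$. A wall is a boundary between two adjacent basins: an element of $\mathbb{Z}+\tfrac12$ if $S=\mathbb{Z}$, and a real number if $S=\mathbb{R}$. Two independent copies "cross or meet" if at some time in $[0,T]$ their ordering is reversed or they occupy the same position; if they start at the same point this probability is $1$. $\operatorname{Pf}$ denotes the Pfaffian.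
   Formalization: For S=ℝ the formula for open intervals (a_i,b_i) assumes that almost surely no wall sits exactly at an endpoint, as it can fail otherwise; with no such assumption it is proved for the event that each [a_i,b_i] lies within one basin. *)

theory Defs
  imports "HOL-Probability.Probability" "HOL-Combinatorics.Permutations"
begin

section \<open>Skip-free paths\<close>

text \<open>
  The state space \<open>S\<close> and the time set \<open>I\<close> are both subsets of the reals, the admissible pairs being
  \<open>(S, I) = (\<int>, \<nat>)\<close>, \<open>(\<int>, {0..})\<close> and \<open>(UNIV, {0..})\<close>. Paths are functions on \<open>I\<close>, extended by
  \<open>undefined\<close>: continuous if \<open>S\<close> is the real line, with steps in \<open>{-1, 0, 1}\<close> if time is discrete,
  and right-continuous with left limits and jumps of size at most 1 for a jump process on \<open>\<int>\<close>
  (a convergent integer-valued path is eventually constant, so these are piecewise constant and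
  do not explode).
\<close>

definition skip_free_paths :: "real set \<Rightarrow> real set \<Rightarrow> (real \<Rightarrow> real) set" where
  "skip_free_paths S I = {w \<in> I \<rightarrow>\<^sub>E S.
     if S = UNIV then continuous_on I w
     else if I = \<nat> then \<forall>t\<in>I. \<bar>w (t + 1) - w t\<bar> \<le> 1
     else (\<forall>t\<ge>0. continuous (at_right t) w) \<and>
          (\<forall>t>0. \<exists>l. (w \<longlongrightarrow> l) (at_left t) \<and> \<bar>w t - l\<bar> \<le> 1)}"

definition path_space :: "real set \<Rightarrow> real set \<Rightarrow> (real \<Rightarrow> real) measure" where
  "path_space S I = restrict_space (\<Pi>\<^sub>M t\<in>I. borel) (skip_free_paths S I)"

definition path_filtration :: "real set \<Rightarrow> real set \<Rightarrow> real \<Rightarrow> (real \<Rightarrow> real) measure" where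
  "path_filtration S I t = vimage_algebra (skip_free_paths S I)
     (\<lambda>w. restrict w (I \<inter> {..t})) (\<Pi>\<^sub>M u\<in>I \<inter> {..t}. borel)"

definition path_shift :: "real set \<Rightarrow> real \<Rightarrow> (real \<Rightarrow> real) \<Rightarrow> real \<Rightarrow> real" where
  "path_shift I s w = (\<lambda>t\<in>I. w (s + t))"

lemma space_path_space: "space (path_space S I) = skip_free_paths S I"
  by (auto simp: path_space_def space_restrict_space space_PiM skip_free_paths_def)

lemma filtration_path_filtration: "filtration (skip_free_paths S I) (path_filtration S I)"
proof
  show "space (path_filtration S I t) = skip_free_paths S I" for t
    by (simp add: path_filtration_def)
next
  fix s t :: real assume st: "s \<le> t"
  have "(\<lambda>w. restrict (restrict w (I \<inter> {..t})) (I \<inter> {..s}))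
      \<in> path_filtration S I t \<rightarrow>\<^sub>M (\<Pi>\<^sub>M u\<in>I \<inter> {..s}. borel)"
    unfolding path_filtration_def
    by (rule measurable_compose[OF measurable_vimage_algebra1 measurable_restrict_subset])
       (use st in \<open>auto simp: space_PiM\<close>)
  moreover have "restrict (restrict w (I \<inter> {..t})) (I \<inter> {..s}) = restrict w (I \<inter> {..s})" for w :: "real \<Rightarrow> real"
    using st by (auto simp: restrict_def fun_eq_iff)
  ultimately have "(\<lambda>w. restrict w (I \<inter> {..s}))
      \<in> path_filtration S I t \<rightarrow>\<^sub>M (\<Pi>\<^sub>M u\<in>I \<inter> {..s}. borel)"
    by simp
  then show "sets (path_filtration S I s) \<subseteq> sets (path_filtration S I t)"
    unfolding path_filtration_def[of S I s]
    by (intro sets_vimage_algebra2[THEN ord_eq_le_trans])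
       (auto simp: space_PiM path_filtration_def[of S I t] dest: measurable_sets)
qed

section \<open>Skip-free processes\<close>

text \<open>
  \<open>P s x\<close> is the law of \<open>u \<mapsto> X (s + u)\<close> for the particle that is at position \<open>x\<close> at time \<open>s\<close>, so
  the process may be inhomogeneous in space and time. In discrete time \<open>strong_markov\<close> is equivalent
  to the Markov property.

  The assumption \<open>no_swap\<close> is automatic for continuous paths. For nearest-neighbour motion on \<open>\<int>\<close> it is
  not: two copies could exchange the positions \<open>z\<close> and \<open>z + 1\<close> by jumping at the same instant.
\<close>

locale skip_free_process =
  fixes S I :: "real set" and P :: "real \<Rightarrow> real \<Rightarrow> (real \<Rightarrow> real) measure"
  assumes state_time: "S = \<int> \<and> I = \<nat> \<or> S = \<int> \<and> I = {0..} \<or> S = UNIV \<and> I = {0..}"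
    and kernel: "(\<lambda>(s, x). P s x) \<in> restrict_space borel (I \<times> S) \<rightarrow>\<^sub>M prob_algebra (path_space S I)"
    and start: "\<And>s x. s \<in> I \<Longrightarrow> x \<in> S \<Longrightarrow> AE w in P s x. w 0 = x"
    and strong_markov:
      "\<And>s x \<tau> A B. s \<in> I \<Longrightarrow> x \<in> S \<Longrightarrow>
        stopping_time (path_filtration S I) \<tau> \<Longrightarrow> \<tau> \<in> skip_free_paths S I \<rightarrow> I \<Longrightarrow>
        A \<in> sets (filtration.pre_sigma (skip_free_paths S I) (path_filtration S I) \<tau>) \<Longrightarrow>
        B \<in> sets (path_space S I) \<Longrightarrow>
        emeasure (P s x) {w \<in> A. path_shift I (\<tau> w) w \<in> B} =
          (\<integral>\<^sup>+w\<in>A. emeasure (P (s + \<tau> w) (w (\<tau> w))) B \<partial>P s x)"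
    and no_swap:
      "\<And>s x y. s \<in> I \<Longrightarrow> x \<in> S \<Longrightarrow> y \<in> S \<Longrightarrow> x < y \<Longrightarrow>
        AE (v, w) in P s x \<Otimes>\<^sub>M P s y. \<forall>t\<in>I. w t < v t \<longrightarrow> (\<exists>u\<in>I. u \<le> t \<and> v u = w u)"

definition cross_or_meet :: "real set \<Rightarrow> real \<Rightarrow> (real \<Rightarrow> real) \<Rightarrow> (real \<Rightarrow> real) \<Rightarrow> bool" where
  "cross_or_meet I T v w \<longleftrightarrow> (\<exists>t\<in>I. t \<le> T \<and>
     (v t = w t \<or> v 0 < w 0 \<and> w t < v t \<or> w 0 < v 0 \<and> v t < w t))"

definition cross_or_meet_prob ::
  "real set \<Rightarrow> (real \<Rightarrow> real \<Rightarrow> (real \<Rightarrow> real) measure) \<Rightarrow> real \<Rightarrow> real \<Rightarrow> real \<Rightarrow> real" where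
  "cross_or_meet_prob I P T x y =
     measure (P 0 x \<Otimes>\<^sub>M P 0 y) {(v, w) \<in> space (P 0 x \<Otimes>\<^sub>M P 0 y). cross_or_meet I T v w}"

section \<open>Coalescing systems\<close>

text \<open>
  \<open>follow I n \<xi> w\<close> moves along \<open>w\<close> until \<open>w\<close> first meets one of \<open>\<xi> 0, \<dots>, \<xi> (n - 1)\<close>, and along the path
  it has met from then on. For skip-free paths the infimum is attained, and if several of the \<open>\<xi> j\<close>
  are met simultaneously they have already merged with each other.
\<close>

definition follow ::
  "real set \<Rightarrow> nat \<Rightarrow> (nat \<Rightarrow> real \<Rightarrow> real) \<Rightarrow> (real \<Rightarrow> real) \<Rightarrow> real \<Rightarrow> real" where
  "follow I n \<xi> w =
     (let H = {s \<in> I. \<exists>j<n. \<xi> j s = w s}; \<sigma> = Inf H in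
      (\<lambda>t\<in>I. if H \<noteq> {} \<and> \<sigma> \<le> t then \<xi> (LEAST j. j < n \<and> \<xi> j \<sigma> = w \<sigma>) t else w t))"

text \<open>Particles are added one at a time, the merged particle following the path of smallest index.\<close>

primrec coalesce :: "real set \<Rightarrow> nat \<Rightarrow> (nat \<Rightarrow> real \<Rightarrow> real) \<Rightarrow> nat \<Rightarrow> real \<Rightarrow> real" where
  "coalesce I 0 w = (\<lambda>_. undefined)"
| "coalesce I (Suc n) w = (coalesce I n w)(n := follow I n (coalesce I n w) (w n))"

text \<open>
  \<open>X x t\<close> is the position at time \<open>t\<close> of the particle started from \<open>x\<close> at time \<open>0\<close>. The law of the
  system is prescribed through any finite number of its particles. For \<open>S = UNIV\<close> this does not
  control all particles simultaneously, hence \<open>start_at\<close> and \<open>merge\<close> are required for every outcome. The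
  requirement could equally be almost sure: on a measurable null set one may replace \<open>X x t\<close> by \<open>x\<close>.
\<close>

locale coalescing_system = skip_free_process S I P + prob_space M
  for S I :: "real set" and P :: "real \<Rightarrow> real \<Rightarrow> (real \<Rightarrow> real) measure" and M :: "'w measure" +
  fixes X :: "real \<Rightarrow> real \<Rightarrow> 'w \<Rightarrow> real"
  assumes paths: "\<And>x. x \<in> S \<Longrightarrow> (\<lambda>\<omega>. \<lambda>t\<in>I. X x t \<omega>) \<in> M \<rightarrow>\<^sub>M path_space S I"
    and start_at: "\<And>x \<omega>. x \<in> S \<Longrightarrow> \<omega> \<in> space M \<Longrightarrow> X x 0 \<omega> = x"
    and merge: "\<And>x y s t \<omega>. x \<in> S \<Longrightarrow> y \<in> S \<Longrightarrow> s \<in> I \<Longrightarrow> t \<in> I \<Longrightarrow> s \<le> t \<Longrightarrow> \<omega> \<in> space M \<Longrightarrow>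
        X x s \<omega> = X y s \<omega> \<Longrightarrow> X x t \<omega> = X y t \<omega>"
    and law: "\<And>m x. (\<And>i. i < m \<Longrightarrow> x i \<in> S) \<Longrightarrow>
        distr M (\<Pi>\<^sub>M i\<in>{..<m}. path_space S I) (\<lambda>\<omega>. \<lambda>i\<in>{..<m}. \<lambda>t\<in>I. X (x i) t \<omega>) =
        distr (\<Pi>\<^sub>M i\<in>{..<m}. P 0 (x i)) (\<Pi>\<^sub>M i\<in>{..<m}. path_space S I) (coalesce I m)"

section \<open>Basins and walls\<close>

definition survivors :: "real set \<Rightarrow> (real \<Rightarrow> real \<Rightarrow> 'w \<Rightarrow> real) \<Rightarrow> real \<Rightarrow> 'w \<Rightarrow> real set" where
  "survivors S X T \<omega> = {X x T \<omega> | x. x \<in> S}"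

definition basin :: "real set \<Rightarrow> (real \<Rightarrow> real \<Rightarrow> 'w \<Rightarrow> real) \<Rightarrow> real \<Rightarrow> 'w \<Rightarrow> real \<Rightarrow> real set" where
  "basin S X T \<omega> y = {x \<in> S. X x T \<omega> = y}"

definition basins :: "real set \<Rightarrow> (real \<Rightarrow> real \<Rightarrow> 'w \<Rightarrow> real) \<Rightarrow> real \<Rightarrow> 'w \<Rightarrow> real set set" where
  "basins S X T \<omega> = basin S X T \<omega> ` survivors S X T \<omega>"

text \<open>
  On the real line the walls are the boundary points of the basins. If the basins are locally finite,
  these are the common endpoints of consecutive basins; the definition by frontiers also covers
  degenerate cases such as a motionless process, where each basin is a single point.
\<close>

definition walls :: "real set \<Rightarrow> (real \<Rightarrow> real \<Rightarrow> 'w \<Rightarrow> real) \<Rightarrow> real \<Rightarrow> 'w \<Rightarrow> real set" where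
  "walls S X T \<omega> =
     (if S = \<int>
      then {z + 1/2 | z. z \<in> \<int> \<and>
             (\<exists>B\<in>basins S X T \<omega>. \<exists>B'\<in>basins S X T \<omega>. B \<noteq> B' \<and> z \<in> B \<and> z + 1 \<in> B')}
      else (\<Union>B\<in>basins S X T \<omega>. frontier B))"

section \<open>Pfaffian\<close>

text \<open>Rows and columns are numbered from \<open>0\<close> to \<open>2 * n - 1\<close>.\<close>

definition pfaffian :: "nat \<Rightarrow> (nat \<Rightarrow> nat \<Rightarrow> real) \<Rightarrow> real" where
  "pfaffian n A =
     (\<Sum>p | p permutes {..<2 * n}. of_int (sign p) * (\<Prod>i<n. A (p (2 * i)) (p (2 * i + 1))))
     / (2 ^ n * fact n)"

end

theory Submission
  imports Defs
begin

text \<open>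
  The particles started at the endpoints \<open>a 0 < b 0 \<le> a 1 < b 1 \<le> \<dots>\<close> have the law of the system that
  \<^const>\<open>coalesce\<close> builds from independent copies \<open>w 0, \<dots>, w (2 n - 1)\<close> of the process. As the coalescing
  flow is almost surely monotone, no boundary between basins separates \<open>a i\<close> from \<open>b i\<close> exactly if
  these two particles have merged by time \<open>T\<close>; on the line a wall in \<open>{a i<..<b i}\<close> is such a
  boundary, and conversely if no wall sits at an endpoint. So the Pfaffian has to be the probability
  that the particles \<open>2 i\<close> and \<open>2 i + 1\<close> have merged for every \<open>i < n\<close>.

  Consider the random antisymmetric matrix whose entry at \<open>k < l\<close> is the indicator that \<open>w k\<close> and
  \<open>w l\<close> meet up to time \<open>T\<close>. Each term in the expansion of its Pfaffian is a product over disjoint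
  pairs of independent copies, and copies that start in order cannot cross without meeting; hence
  the expectation of the Pfaffian is \<open>Pf A\<close> (\<open>expectation_meet_pfaffian\<close>).

  Next, let the copies coalesce, one collision at a time, and keep for every index \<open>i\<close> the label
  \<open>c i\<close>, the leader of its cluster, whose copy moves the cluster. The entry at \<open>k < l\<close> becomes the
  indicator that \<open>w (c k)\<close> and \<open>w (c l)\<close> meet. The point is that a merger does not change the
  expected Pfaffian (\<open>expectation_merge\<close>). Let the leaders \<open>q < k\<close> of two neighbouring clusters of
  sizes \<open>r\<close> and \<open>s\<close> collide at a time before which no two leaders have met. By the strong Markov
  property the law of the copies is unchanged if \<open>w q\<close> and \<open>w k\<close> exchange their futures at this time
  (\<open>distr_swap_futures\<close>). In the matrix this exchanges the labels \<open>q\<close> and \<open>k\<close>. Now there is a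
  deterministic identity for the Pfaffians with labels \<open>q\<close> or \<open>k\<close> on the two clusters, valid because
  \<open>q\<close> and \<open>k\<close> meet (\<open>label_pfaffian_two_blocks\<close>): writing \<open>[u v]\<close> for the label \<open>u\<close> on the first
  cluster and \<open>v\<close> on the second, \<open>[q k] + [k q] = [q q] + [k k]\<close>. On the left both terms have the
  same expectation, and so have both on the right. Therefore \<open>[q k]\<close> has the same expectation as
  \<open>[q q]\<close>, the Pfaffian after the merger.

  When no collision is left up to time \<open>T\<close>, distinct labels do not meet. Then the Pfaffian is \<open>1\<close> if
  \<open>c (2 i) = c (2 i + 1)\<close> for all \<open>i\<close>, and \<open>0\<close> otherwise, for then some cluster boundary leaves an
  odd number of indices on its left (\<open>label_pfaffian_separated\<close>). This is the indicator of the event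
  that the pairs have merged, and induction on the number of leaders finishes the proof
  (\<open>expectation_eq_prob\<close>).
\<close>

section \<open>Pfaffians of labelled relations\<close>

lemma pfaffian_cong:
  assumes "\<And>k l. k < 2 * n \<Longrightarrow> l < 2 * n \<Longrightarrow> k \<noteq> l \<Longrightarrow> A k l = B k l"
  shows "pfaffian n A = pfaffian n B"
proof -
  have "A (p (2 * i)) (p (2 * i + 1)) = B (p (2 * i)) (p (2 * i + 1))"
    if p: "p permutes {..<2 * n}" and i: "i < n" for p i
  proof (rule assms)
    show "p (2 * i) < 2 * n" "p (2 * i + 1) < 2 * n"
      using permutes_in_image[OF p] i by auto
    show "p (2 * i) \<noteq> p (2 * i + 1)"
      using permutes_inj[OF p] by (simp add: inj_eq)
  qed
  then show ?thesis
    unfolding pfaffian_def by (intro arg_cong2[where f="(/)"] sum.cong arg_cong2[where f="(*)"] prod.cong refl) auto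
qed

text \<open>
  Exchanging two indices changes the sign of a Pfaffian, and the Pfaffian is affine in the entry at
  the pair \<open>{x, y}\<close>. Here \<open>A'\<close> is \<open>A\<close> with \<open>x\<close> and \<open>y\<close> exchanged, except that the entry at \<open>{x, y}\<close>
  keeps its sign. So the terms without this entry cancel in \<open>pfaffian n A + pfaffian n A'\<close>; they
  vanish in \<open>pfaffian n C\<close>, as \<open>C\<close> is invariant under the exchange; and the other terms do not see
  the rows \<open>x\<close> and \<open>y\<close> elsewhere, where \<open>A\<close> and \<open>C\<close> differ.
\<close>

lemma pfaffian_add_transposed:
  fixes A A' C :: "nat \<Rightarrow> nat \<Rightarrow> real" and x y :: nat
  defines "t \<equiv> Transposition.transpose x y"
  assumes xy: "x < 2 * n" "y < 2 * n" "x \<noteq> y"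
    and A': "\<And>k l. k \<noteq> l \<Longrightarrow> {k, l} \<noteq> {x, y} \<Longrightarrow> A' k l = A (t k) (t l)"
    and C: "\<And>k l. k \<noteq> l \<Longrightarrow> {k, l} \<noteq> {x, y} \<Longrightarrow> C k l = C (t k) (t l)"
    and agree: "\<And>k l. k \<notin> {x, y} \<Longrightarrow> l \<notin> {x, y} \<Longrightarrow> A k l = C k l"
    and pair: "A x y = C x y" "A y x = C y x" "A' x y = C x y" "A' y x = C y x"
  shows "pfaffian n A + pfaffian n A' = 2 * pfaffian n C"
proof -
  let ?P = "{p. p permutes {..<2 * n}}"
  define f where "f B p = of_int (sign p) * (\<Prod>i<n. B (p (2 * i)) (p (2 * i + 1)))"
    for B :: "nat \<Rightarrow> nat \<Rightarrow> real" and p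
  define g where "g p = f A p + f A' p - 2 * f C p" for p
  have t: "t permutes {..<2 * n}"
    using xy by (auto simp: t_def intro!: permutes_swap_id)
  have tt[simp]: "t (t k) = k" for k
    by (simp add: t_def)
  have t_pair: "{t k, t l} = {x, y} \<longleftrightarrow> {k, l} = {x, y}" for k l
    by (auto simp: t_def Transposition.transpose_def doubleton_eq_iff)
  have "g (t \<circ> p) = - g p" if p: "p \<in> ?P" for p
  proof -
    have inj: "inj p" using p by (auto intro: permutes_inj)
    have neq: "p (2 * i) \<noteq> p (2 * i + 1)" for i
      using inj by (simp add: inj_eq)
    have perm: "permutation p" "permutation t"
      using p t by (auto simp: permutation_permutes)
    have sgn: "sign (t \<circ> p) = - sign p"
      using perm xy by (simp add: sign_compose t_def sign_swap_id)
    show ?thesis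
    proof (cases "\<exists>i<n. {p (2 * i), p (2 * i + 1)} = {x, y}")
      case True
      \<comment> \<open>If \<open>p\<close> matches \<open>x\<close> with \<open>y\<close>, all other factors avoid \<open>x\<close> and \<open>y\<close>.\<close>
      then obtain i where i: "i < n" "{p (2 * i), p (2 * i + 1)} = {x, y}" by auto
      have off: "p (2 * j) \<notin> {x, y} \<and> p (2 * j + 1) \<notin> {x, y}" if "j \<noteq> i" for j
      proof -
        have "2 * j \<noteq> 2 * i" "2 * j \<noteq> 2 * i + 1" "2 * j + 1 \<noteq> 2 * i" "2 * j + 1 \<noteq> 2 * i + 1"
          using that by presburger+
        then show ?thesis unfolding i(2)[symmetric] using inj by (simp add: inj_eq)
      qed
      have g0: "g q = 0" if q: "q = p \<or> q = t \<circ> p" for q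
      proof -
        have offq: "q (2 * j) \<notin> {x, y} \<and> q (2 * j + 1) \<notin> {x, y}" if "j \<noteq> i" for j
          using off[OF that] q by (auto simp: t_def Transposition.transpose_def)
        have iq: "{q (2 * i), q (2 * i + 1)} = {x, y}"
          using q i(2) by (elim disjE) (simp_all only: o_apply t_pair)
        have *: "B (q (2 * j)) (q (2 * j + 1)) = C (q (2 * j)) (q (2 * j + 1))"
          if B: "B = A \<or> B = A'" for B j
        proof (cases "j = i")
          case True
          then show ?thesis using iq pair B by (auto simp: doubleton_eq_iff)
        next
          case False
          from offq[OF this] have o: "q (2 * j) \<notin> {x, y}" "q (2 * j + 1) \<notin> {x, y}" by auto
          have ne: "q (2 * j) \<noteq> q (2 * j + 1)" using q neq[of j] by (metis o_apply tt)
          have "A' (q (2 * j)) (q (2 * j + 1)) = A (t (q (2 * j))) (t (q (2 * j + 1)))"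
            by (rule A') (use o ne in auto)
          also have "\<dots> = A (q (2 * j)) (q (2 * j + 1))"
            using o by (simp add: t_def)
          finally show ?thesis using agree[OF o] B by auto
        qed
        have "f A q = f C q" "f A' q = f C q"
          unfolding f_def using *[of A] *[of A'] by simp_all
        then show ?thesis by (simp add: g_def)
      qed
      show ?thesis using g0[of p] g0[of "t \<circ> p"] by simp
    next
      case False
      then have nm: "{p (2 * i), p (2 * i + 1)} \<noteq> {x, y}" if "i < n" for i
        using that by auto
      \<comment> \<open>Otherwise composition with \<open>t\<close> exchanges the terms of \<open>A\<close> and \<open>A'\<close> up to sign.\<close>
      have "f A (t \<circ> p) = - f A' p"
        unfolding f_def sgn using A'[OF neq nm] by simp
      moreover have "f A' (t \<circ> p) = - f A p"
      proof -
        have "A' (t (p (2 * i))) (t (p (2 * i + 1))) = A (p (2 * i)) (p (2 * i + 1))" if "i < n" for i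
          using A'[of "t (p (2 * i))" "t (p (2 * i + 1))"] nm[OF that] neq[of i] t_pair by (metis tt)
        then show ?thesis unfolding f_def sgn by simp
      qed
      moreover have "f C (t \<circ> p) = - f C p"
        unfolding f_def sgn using C[OF neq nm, symmetric] by simp
      ultimately show ?thesis by (simp add: g_def)
    qed
  qed
  then have "(\<Sum>p\<in>?P. g p) = - (\<Sum>p\<in>?P. g p)"
    by (subst setum_permutations_compose_left[OF t]) (simp add: sum_negf)
  then have "(\<Sum>p\<in>?P. g p) = 0" by simp
  then have "(\<Sum>p\<in>?P. f A p) + (\<Sum>p\<in>?P. f A' p) = 2 * (\<Sum>p\<in>?P. f C p)"
    by (simp add: g_def sum.distrib sum_subtractf sum_distrib_left)
  then show ?thesis
    unfolding pfaffian_def f_def by (simp add: add_divide_distrib[symmetric])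
qed

text \<open>
  The factor \<open>sgn (l - k)\<close> makes the matrix antisymmetric whenever \<open>R\<close> is symmetric.
\<close>

definition label_pfaffian :: "nat \<Rightarrow> (nat \<Rightarrow> nat \<Rightarrow> bool) \<Rightarrow> (nat \<Rightarrow> nat) \<Rightarrow> real" where
  "label_pfaffian n R c = pfaffian n (\<lambda>k l. sgn (real l - real k) * of_bool (R (c k) (c l)))"

text \<open>
  Exchanging neighbours preserves the order of all other pairs of indices; this is why only
  neighbouring indices are relabelled below.
\<close>

lemma sgn_transpose_adjacent:
  assumes "k \<noteq> l" "{k, l} \<noteq> {x, Suc x}"
  shows "sgn (real (Transposition.transpose x (Suc x) l) - real (Transposition.transpose x (Suc x) k)) =
    sgn (real l - real k)"
  using assms by (auto simp: Transposition.transpose_def sgn_if)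

lemma label_pfaffian_transpose:
  fixes c c' d :: "nat \<Rightarrow> nat" and x :: nat
  defines "t \<equiv> Transposition.transpose x (Suc x)"
  assumes x: "Suc x < 2 * n"
    and c': "\<And>k. c' k = c (t k)" and d: "d (Suc x) = d x" "\<And>k. k \<noteq> x \<Longrightarrow> k \<noteq> Suc x \<Longrightarrow> d k = c k"
    and R: "R (c x) (c (Suc x))" "R (c (Suc x)) (c x)" "R (d x) (d x)"
  shows "label_pfaffian n R c + label_pfaffian n R c' = 2 * label_pfaffian n R d"
  unfolding label_pfaffian_def
proof (rule pfaffian_add_transposed[of x n "Suc x", folded t_def])
  have t: "t x = Suc x" "t (Suc x) = x" by (simp_all add: t_def)
  have dt: "d (t k) = d k" for k using d(1) by (auto simp: t_def Transposition.transpose_def)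
  show "sgn (real l - real k) * of_bool (R (c' k) (c' l)) =
      sgn (real (t l) - real (t k)) * of_bool (R (c (t k)) (c (t l)))"
    "sgn (real l - real k) * of_bool (R (d k) (d l)) =
      sgn (real (t l) - real (t k)) * of_bool (R (d (t k)) (d (t l)))"
    if "k \<noteq> l" "{k, l} \<noteq> {x, Suc x}" for k l
    using sgn_transpose_adjacent[OF that] by (simp_all add: c' dt flip: t_def)
qed (use x R d in \<open>simp_all add: c' t_def\<close>)

lemma label_pfaffian_adjacent:
  assumes x: "x + 1 < 2 * n" and R: "\<And>u. R u u" "R u v" "R v u"
  shows "label_pfaffian n R (c(x := u, x + 1 := v)) + label_pfaffian n R (c(x := v, x + 1 := u)) =
    2 * label_pfaffian n R (c(x := u, x + 1 := u))"
  by (rule label_pfaffian_transpose[of x]) (use x R in \<open>auto simp: Transposition.transpose_def\<close>)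

text \<open>
  Exchanging two equal labels leaves the labelling as it is, so with \<open>c' = c\<close> the transposition
  identity compares one common label with any other.
\<close>

lemma label_pfaffian_relabel_pair:
  assumes x: "x + 1 < 2 * n" and R: "\<And>u. R u u"
  shows "label_pfaffian n R (c(x := u, x + 1 := u)) = label_pfaffian n R (c(x := v, x + 1 := v))"
proof -
  have "label_pfaffian n R (c(x := u, x + 1 := u)) + label_pfaffian n R (c(x := u, x + 1 := u)) =
      2 * label_pfaffian n R (c(x := v, x + 1 := v))"
    by (rule label_pfaffian_transpose[of x]) (use x R in \<open>auto simp: Transposition.transpose_def\<close>)
  then show ?thesis by simp
qed

definition two_blocks :: "nat \<Rightarrow> nat \<Rightarrow> nat \<Rightarrow> 'a \<Rightarrow> 'a \<Rightarrow> (nat \<Rightarrow> 'a) \<Rightarrow> nat \<Rightarrow> 'a" where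
  "two_blocks j p q u v c i =
     (if j \<le> i \<and> i < j + p then u else if j + p \<le> i \<and> i < j + p + q then v else c i)"

text \<open>
  Two neighbours with the same label may be given any other common label, independently of \<open>u\<close> and
  \<open>v\<close>. This removes indices from the two blocks in pairs, until a block is empty and the identity is
  trivial, or both are single indices and \<open>label_pfaffian_adjacent\<close> applies.
\<close>

lemma label_pfaffian_two_blocks:
  assumes "j + p + q \<le> 2 * n" and R: "\<And>u. R u u" "R u v" "R v u"
  shows "label_pfaffian n R (two_blocks j p q u v c) + label_pfaffian n R (two_blocks j p q v u c) =
    label_pfaffian n R (two_blocks j p q u u c) + label_pfaffian n R (two_blocks j p q v v c)"
  using assms(1)
proof (induction "p + q" arbitrary: j p q c rule: less_induct)
  case less
  consider "p \<ge> 2" | "q \<ge> 2" | "p = 0" | "q = 0" | "p = 1" "q = 1" by linarith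
  then show ?case
  proof cases
    case 1
    have *: "label_pfaffian n R (two_blocks j p q a b c) =
        label_pfaffian n R (two_blocks (j + 2) (p - 2) q a b (c(j := 0, j + 1 := 0)))" for a b
    proof -
      have "two_blocks j p q a b c = (two_blocks j p q a b c)(j := a, j + 1 := a)"
        using 1 by (auto simp: two_blocks_def fun_eq_iff)
      then have "label_pfaffian n R (two_blocks j p q a b c) =
          label_pfaffian n R ((two_blocks j p q a b c)(j := a, j + 1 := a))"
        by (rule arg_cong)
      also have "\<dots> = label_pfaffian n R ((two_blocks j p q a b c)(j := 0, j + 1 := 0))"
        using 1 less.prems by (intro label_pfaffian_relabel_pair R) simp
      also have "(two_blocks j p q a b c)(j := 0, j + 1 := 0) =
          two_blocks (j + 2) (p - 2) q a b (c(j := 0, j + 1 := 0))"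
        using 1 by (auto simp: two_blocks_def fun_eq_iff)
      finally show ?thesis .
    qed
    have "p - 2 + q < p + q" "j + 2 + (p - 2) + q \<le> 2 * n" using 1 less.prems by simp_all
    from less.hyps[OF this] show ?thesis by (simp only: *)
  next
    case 2
    have *: "label_pfaffian n R (two_blocks j p q a b c) =
        label_pfaffian n R (two_blocks j p (q - 2) a b (c(j + p + q - 2 := 0, j + p + q - 2 + 1 := 0)))" for a b
    proof -
      have "two_blocks j p q a b c = (two_blocks j p q a b c)(j + p + q - 2 := b, j + p + q - 2 + 1 := b)"
        using 2 by (auto simp: two_blocks_def fun_eq_iff)
      then have "label_pfaffian n R (two_blocks j p q a b c) =
          label_pfaffian n R ((two_blocks j p q a b c)(j + p + q - 2 := b, j + p + q - 2 + 1 := b))"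
        by (rule arg_cong)
      also have "\<dots> = label_pfaffian n R ((two_blocks j p q a b c)(j + p + q - 2 := 0, j + p + q - 2 + 1 := 0))"
        using 2 less.prems by (intro label_pfaffian_relabel_pair R) simp
      also have "(two_blocks j p q a b c)(j + p + q - 2 := 0, j + p + q - 2 + 1 := 0) =
          two_blocks j p (q - 2) a b (c(j + p + q - 2 := 0, j + p + q - 2 + 1 := 0))"
        using 2 by (auto simp: two_blocks_def fun_eq_iff)
      finally show ?thesis .
    qed
    have "p + (q - 2) < p + q" "j + p + (q - 2) \<le> 2 * n" using 2 less.prems by simp_all
    from less.hyps[OF this] show ?thesis by (simp only: *)
  next
    case 3
    then have "two_blocks j p q u v c = two_blocks j p q v v c" "two_blocks j p q v u c = two_blocks j p q u u c"
      by (auto simp: two_blocks_def fun_eq_iff)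
    then show ?thesis by (simp only: add.commute)
  next
    case 4
    then have "two_blocks j p q u v c = two_blocks j p q u u c" "two_blocks j p q v u c = two_blocks j p q v v c"
      by (auto simp: two_blocks_def fun_eq_iff)
    then show ?thesis by simp
  next
    case 5
    then have *: "two_blocks j p q a b c = c(j := a, j + 1 := b)" for a b
      by (auto simp: two_blocks_def fun_eq_iff)
    have j: "j + 1 < 2 * n" using less.prems 5 by simp
    have "label_pfaffian n R (c(j := u, j + 1 := u)) = label_pfaffian n R (c(j := v, j + 1 := v))"
      using j R(1) by (rule label_pfaffian_relabel_pair)
    with label_pfaffian_adjacent[OF j, of R u v c, OF R] show ?thesis
      unfolding * by linarith
  qed
qed

text \<open>
  This fixes the normalisation. In the sum over permutations, the position at which \<open>p\<close> takes its
  largest value does not matter: exchanging the two members of a factor, or two factors, preserves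
  each term. So in the step from \<open>n\<close> to \<open>n + 1\<close> the sum is \<open>2 n + 2\<close> times the part where the
  largest value stands last, and there only the permutations that fix the last two indices
  contribute.
\<close>

lemma pfaffian_direct_sum:
  "pfaffian n (\<lambda>k l. sgn (real l - real k) * of_bool (k div 2 = l div 2)) = 1"
proof -
  define D :: "nat \<Rightarrow> nat \<Rightarrow> real" where "D k l = sgn (real l - real k) * of_bool (k div 2 = l div 2)" for k l
  define g where "g n p = of_int (sign p) * (\<Prod>i<n. D (p (2 * i)) (p (2 * i + 1)))" for n and p :: "nat \<Rightarrow> nat"
  have anti: "D l k = - D k l" for k l
    by (simp add: D_def sgn_if)
  have "(\<Sum>p | p permutes {..<2 * n}. g n p) = 2 ^ n * fact n"
  proof (induction n)
    case 0
    have "{p. p permutes {..<2 * (0::nat)}} = {id}" by simp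
    then show ?case by (simp add: g_def del: permutes_empty)
  next
    case (Suc n)
    let ?P = "{p. p permutes {..<2 * Suc n}}" and ?m = "2 * n + 1"
    have fin: "finite ?P" by (simp add: finite_permutations)
    \<comment> \<open>The part of the sum where the largest value \<open>?m\<close> stands at position \<open>s\<close>.\<close>
    define h where "h s = (\<Sum>p\<in>?P. of_bool (p s = ?m) * g (Suc n) p)" for s
    have reindex: "h s = h s'"
      if t: "t permutes {..<2 * Suc n}" "t s = s'"
        and inv: "\<And>p. p \<in> ?P \<Longrightarrow> g (Suc n) (p \<circ> t) = g (Suc n) p" for s s' t
      unfolding h_def by (subst sum_permutations_compose_right[OF t(1)]) (simp add: inv t(2))
    have flip: "h (2 * i) = h (2 * i + 1)" if i: "i \<le> n" for i
    proof (rule reindex[of "Transposition.transpose (2 * i) (2 * i + 1)"])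
      let ?t = "Transposition.transpose (2 * i) (2 * i + 1)"
      show t: "?t permutes {..<2 * Suc n}"
        using i by (auto intro!: permutes_swap_id)
      fix p assume p: "p \<in> ?P"
      have "permutation p"
        using p by (auto simp: permutation_permutes)
      then have "sign (p \<circ> ?t) = - sign p"
        by (simp add: sign_compose permutation_swap_id sign_swap_id)
      moreover have "(\<Prod>j<Suc n. D ((p \<circ> ?t) (2 * j)) ((p \<circ> ?t) (2 * j + 1))) =
          - (\<Prod>j<Suc n. D (p (2 * j)) (p (2 * j + 1)))"
      proof -
        have i': "i \<in> {..<Suc n}" using i by simp
        have "(\<Prod>j\<in>{..<Suc n} - {i}. D ((p \<circ> ?t) (2 * j)) ((p \<circ> ?t) (2 * j + 1))) =
            (\<Prod>j\<in>{..<Suc n} - {i}. D (p (2 * j)) (p (2 * j + 1)))"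
        proof (intro prod.cong refl)
          fix j assume "j \<in> {..<Suc n} - {i}"
          then have "j \<noteq> i" by simp
          then have "2 * j \<noteq> 2 * i" "2 * j \<noteq> 2 * i + 1" "2 * j + 1 \<noteq> 2 * i" "2 * j + 1 \<noteq> 2 * i + 1" by presburger+
          then show "D ((p \<circ> ?t) (2 * j)) ((p \<circ> ?t) (2 * j + 1)) = D (p (2 * j)) (p (2 * j + 1))"
            by simp
        qed
        moreover have "D ((p \<circ> ?t) (2 * i)) ((p \<circ> ?t) (2 * i + 1)) = - D (p (2 * i)) (p (2 * i + 1))"
          by (simp add: anti[of "p (Suc (2 * i))"])
        ultimately show ?thesis
          by (simp only: prod.remove[OF finite_lessThan i'])
      qed
      ultimately show "g (Suc n) (p \<circ> ?t) = g (Suc n) p" unfolding g_def by simp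
    qed simp
    have move: "h (2 * i + 1) = h ?m" if i: "i < n" for i
    proof (rule reindex[of "Transposition.transpose (2 * i + 1) ?m \<circ> Transposition.transpose (2 * i) (2 * n)"])
      let ?t1 = "Transposition.transpose (2 * i + 1) ?m" and ?t2 = "Transposition.transpose (2 * i) (2 * n)"
      have t: "?t1 permutes {..<2 * Suc n}" "?t2 permutes {..<2 * Suc n}"
        using i by (auto intro!: permutes_swap_id)
      show "?t1 \<circ> ?t2 permutes {..<2 * Suc n}" using t by (rule permutes_compose[rotated])
      have n: "2 * i + 1 \<noteq> 2 * i" "2 * i + 1 \<noteq> 2 * n" by presburger+
      show "(?t1 \<circ> ?t2) (2 * i + 1) = ?m" using n by (simp add: Transposition.transpose_def)
      fix p assume p: "p \<in> ?P"
      have "permutation p"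
        using p by (auto simp: permutation_permutes)
      then have "sign (p \<circ> (?t1 \<circ> ?t2)) = sign p"
        using i by (simp add: sign_compose permutation_compose permutation_swap_id sign_swap_id)
      moreover have "(\<Prod>j<Suc n. D ((p \<circ> (?t1 \<circ> ?t2)) (2 * j)) ((p \<circ> (?t1 \<circ> ?t2)) (2 * j + 1))) =
          (\<Prod>j<Suc n. D (p (2 * j)) (p (2 * j + 1)))"
      proof -
        have tj: "(?t1 \<circ> ?t2) (2 * j) = 2 * Transposition.transpose i n j" "(?t1 \<circ> ?t2) (2 * j + 1) = 2 * Transposition.transpose i n j + 1" for j
        proof -
          have "2 * j \<noteq> 2 * i + 1" "2 * j \<noteq> 2 * n + 1" "2 * i \<noteq> 2 * n + 1" "2 * i + 1 \<noteq> 2 * n"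
            "2 * j + 1 \<noteq> 2 * i" "2 * j + 1 \<noteq> 2 * n" by presburger+
          then show "(?t1 \<circ> ?t2) (2 * j) = 2 * Transposition.transpose i n j"
            "(?t1 \<circ> ?t2) (2 * j + 1) = 2 * Transposition.transpose i n j + 1"
            by (simp_all add: Transposition.transpose_def)
        qed
        have "(\<Prod>j<Suc n. D ((p \<circ> (?t1 \<circ> ?t2)) (2 * j)) ((p \<circ> (?t1 \<circ> ?t2)) (2 * j + 1))) =
           (\<Prod>j<Suc n. D (p (2 * Transposition.transpose i n j)) (p (2 * Transposition.transpose i n j + 1)))"
          using tj by (simp del: prod.lessThan_Suc)
        also have "\<dots> = (\<Prod>j<Suc n. D (p (2 * j)) (p (2 * j + 1)))"
          by (rule prod.reindex_bij_betw[of "Transposition.transpose i n" "{..<Suc n}" "{..<Suc n}" "\<lambda>j. D (p (2 * j)) (p (2 * j + 1))"])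
             (rule permutes_imp_bij, use i in \<open>auto intro!: permutes_swap_id\<close>)
        finally show ?thesis .
      qed
      ultimately show "g (Suc n) (p \<circ> (?t1 \<circ> ?t2)) = g (Suc n) p" unfolding g_def by simp
    qed
    have h_const: "h s = h ?m" if s: "s < 2 * Suc n" for s
    proof -
      have "h (2 * (s div 2) + 1) = h ?m"
        using move[of "s div 2"] s by (cases "s div 2 = n") auto
      moreover have "h s = h (2 * (s div 2) + 1)"
        using flip[of "s div 2"] s by (cases "even s") auto
      ultimately show ?thesis by simp
    qed
    have "(\<Sum>p\<in>?P. g (Suc n) p) = (\<Sum>p\<in>?P. \<Sum>s<2 * Suc n. of_bool (p s = ?m) * g (Suc n) p)"
    proof (rule sum.cong[OF refl])
      fix p assume p: "p \<in> ?P"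
      have "(\<Sum>s<2 * Suc n. of_bool (p s = ?m)) = (\<Sum>s<2 * Suc n. of_bool (s = ?m) :: real)"
        using p by (intro sum.reindex_bij_betw[of p "{..<2 * Suc n}" "{..<2 * Suc n}" "\<lambda>s. of_bool (s = ?m)"] permutes_imp_bij) auto
      also have "\<dots> = 1" by (simp add: of_bool_def)
      finally show "g (Suc n) p = (\<Sum>s<2 * Suc n. of_bool (p s = ?m) * g (Suc n) p)"
        by (simp only: sum_distrib_right[symmetric])
    qed
    also have "\<dots> = (\<Sum>s<2 * Suc n. h s)" unfolding h_def by (rule sum.swap)
    also have "\<dots> = real (2 * Suc n) * h ?m"
      by (simp only: sum.cong[OF refl h_const[OF lessThan_iff[THEN iffD1]]] sum_constant card_lessThan of_nat_mult)
    also have "h ?m = (\<Sum>p | p permutes {..<2 * n}. g n p)"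
    proof -
      have sub: "{p. p permutes {..<2 * n}} \<subseteq> ?P" by (auto intro: permutes_subset)
      have "h ?m = (\<Sum>p | p permutes {..<2 * n}. of_bool (p ?m = ?m) * g (Suc n) p)"
        unfolding h_def
      proof (rule sum.mono_neutral_right[OF fin sub], rule ballI)
        fix p assume "p \<in> ?P - {p. p permutes {..<2 * n}}"
        then have p: "p permutes {..<2 * Suc n}" "\<not> p permutes {..<2 * n}" by auto
        have "g (Suc n) p = 0" if m: "p ?m = ?m"
        proof -
          have ne: "p (2 * n) \<noteq> 2 * n"
          proof
            assume "p (2 * n) = 2 * n"
            then have "p permutes {..<2 * n}"
              using m by (intro permutes_superset[OF p(1)]) (auto simp: less_Suc_eq)
            then show False using p(2) by simp
          qed
          have "p (2 * n) \<noteq> ?m" using inj_eq[OF permutes_inj[OF p(1)], of "2 * n" ?m] m by simp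
          then have "p (2 * n) div 2 \<noteq> n" using ne by presburger
          then have "D (p (2 * n)) (p (2 * n + 1)) = 0" using m by (simp add: D_def)
          then show ?thesis by (simp add: g_def)
        qed
        then show "of_bool (p ?m = ?m) * g (Suc n) p = 0" by auto
      qed
      also have "\<dots> = (\<Sum>p | p permutes {..<2 * n}. g n p)"
      proof (intro sum.cong refl)
        fix p assume "p \<in> {p. p permutes {..<2 * n}}"
        then have "p (2 * n) = 2 * n" "p ?m = ?m" by (auto simp: permutes_def)
        then show "of_bool (p ?m = ?m) * g (Suc n) p = g n p" by (simp add: g_def D_def)
      qed
      finally show ?thesis .
    qed
    finally show ?case using Suc by (simp add: algebra_simps)
  qed
  then show ?thesis unfolding pfaffian_def g_def D_def by simp
qed

text \<open>
  Relabelling the pairs \<open>2 i, 2 i + 1\<close> one after another leads to a constant labelling, whose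
  Pfaffian depends neither on \<open>c\<close> nor on \<open>R\<close>. For the equality relation and pairwise distinct labels
  it is that of a direct sum of two by two blocks.
\<close>

lemma label_pfaffian_all_paired:
  assumes R: "\<And>u. R u u" and c: "\<And>i. i < n \<Longrightarrow> c (2 * i) = c (2 * i + 1)"
  shows "label_pfaffian n R c = 1"
proof -
  have to_0: "label_pfaffian n R c = label_pfaffian n R (\<lambda>_. 0)"
    if R: "\<And>u. R u u" and c: "\<And>i. i < n \<Longrightarrow> c (2 * i) = c (2 * i + 1)" for R c
  proof -
    have "m \<le> n \<Longrightarrow> label_pfaffian n R c = label_pfaffian n R (\<lambda>k. if k < 2 * m then 0 else c k)" for m
    proof (induction m)
      case 0 then show ?case by simp
    next
      case (Suc m)
      let ?c = "\<lambda>k. if k < 2 * m then 0 else c k"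
      have "?c = ?c(2 * m := c (2 * m), 2 * m + 1 := c (2 * m))"
        using c[of m] Suc.prems by auto
      moreover have "(\<lambda>k. if k < 2 * Suc m then 0 else c k) = ?c(2 * m := 0, 2 * m + 1 := 0)"
        by (auto simp: less_Suc_eq)
      moreover have "2 * m + 1 < 2 * n" using Suc.prems by simp
      ultimately have "label_pfaffian n R ?c = label_pfaffian n R (\<lambda>k. if k < 2 * Suc m then 0 else c k)"
        using label_pfaffian_relabel_pair[of "2 * m" n R ?c "c (2 * m)" 0, OF _ R] by simp
      then show ?case using Suc by simp
    qed
    from this[of n] show ?thesis
      unfolding label_pfaffian_def by (auto intro: pfaffian_cong)
  qed
  have "label_pfaffian n (=) (\<lambda>k. k div 2) = 1"
    unfolding label_pfaffian_def by (rule pfaffian_direct_sum)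
  moreover have "label_pfaffian n (=) (\<lambda>k. k div 2) = label_pfaffian n (=) (\<lambda>_. 0)"
    by (rule to_0) auto
  moreover have "label_pfaffian n (=) (\<lambda>_. 0) = label_pfaffian n R (\<lambda>_. 0)"
    unfolding label_pfaffian_def using R by (intro pfaffian_cong) simp
  moreover have "label_pfaffian n R c = label_pfaffian n R (\<lambda>_. 0)"
    by (rule to_0) (use R c in auto)
  ultimately show ?thesis by simp
qed

lemma even_card_pairs:
  "(\<And>i. i < n \<Longrightarrow> Q (2 * i) = Q (2 * i + 1)) \<Longrightarrow> even (card {s::nat. s < 2 * n \<and> Q s})"
proof (induction n)
  case (Suc n)
  have "{s. s < 2 * Suc n \<and> Q s} = {s. s < 2 * n \<and> Q s} \<union> (if Q (2 * n) then {2 * n, 2 * n + 1} else {})"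
    using Suc.prems[of n] by (auto simp: less_Suc_eq)
  then have "card {s. s < 2 * Suc n \<and> Q s} = card {s. s < 2 * n \<and> Q s} + (if Q (2 * n) then 2 else 0)"
    by (simp add: card_Un_disjoint)
  then show ?case using Suc by auto
qed simp

text \<open>
  If a pair \<open>2 m, 2 m + 1\<close> has different labels, then no label occurs on both sides of the gap
  between these two indices, since labels are monotone. On the left there is an odd number of
  indices, so every perfect matching joins some index on the left to one on the right, with
  different and hence unrelated labels.
\<close>

lemma label_pfaffian_separated:
  assumes R: "\<And>u. R u u" and mono: "\<And>k l. k \<le> l \<Longrightarrow> l < 2 * n \<Longrightarrow> c k \<le> c l"
    and sep: "\<And>k l. k < 2 * n \<Longrightarrow> l < 2 * n \<Longrightarrow> R (c k) (c l) \<Longrightarrow> c k = c l"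
  shows "label_pfaffian n R c = of_bool (\<forall>i<n. c (2 * i) = c (2 * i + 1))"
proof (cases "\<forall>i<n. c (2 * i) = c (2 * i + 1)")
  case True
  then show ?thesis using label_pfaffian_all_paired[of R n c, OF R] by simp
next
  case False
  then obtain m where m: "m < n" "c (2 * m) \<noteq> c (2 * m + 1)" by auto
  have split: "k \<le> 2 * m \<longleftrightarrow> l \<le> 2 * m" if kl: "k < 2 * n" "l < 2 * n" "c k = c l" for k l
  proof -
    have lt: "c (2 * m) < c (2 * m + 1)" using mono[of "2 * m" "2 * m + 1"] m by simp
    have "c k \<le> c (2 * m)" if "k \<le> 2 * m" for k using mono[OF that] m by simp
    moreover have "c (2 * m + 1) \<le> c k" if "\<not> k \<le> 2 * m" "k < 2 * n" for k
      using mono[of "2 * m + 1" k] that by simp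
    ultimately have "c k \<le> c (2 * m) \<longleftrightarrow> k \<le> 2 * m" "c l \<le> c (2 * m) \<longleftrightarrow> l \<le> 2 * m"
      using kl(1,2) lt by fastforce+
    then show ?thesis using kl(3) by simp
  qed
  have "(\<Prod>i<n. sgn (real (p (2 * i + 1)) - real (p (2 * i))) * of_bool (R (c (p (2 * i))) (c (p (2 * i + 1))))) = (0::real)"
    if p: "p permutes {..<2 * n}" for p
  proof (rule ccontr)
    assume nz: "\<not> ?thesis"
    have lt: "p (2 * i) < 2 * n" "p (2 * i + 1) < 2 * n" if "i < n" for i
      using permutes_in_image[OF p] that by auto
    have "R (c (p (2 * i))) (c (p (2 * i + 1)))" if i: "i < n" for i
      using nz i by (auto simp: prod_zero_iff)
    then have "p (2 * i) \<le> 2 * m \<longleftrightarrow> p (2 * i + 1) \<le> 2 * m" if "i < n" for i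
      using that lt sep split by blast
    then have "even (card {s. s < 2 * n \<and> p s \<le> 2 * m})"
      by (intro even_card_pairs)
    also have "card {s. s < 2 * n \<and> p s \<le> 2 * m} = card {..2 * m}"
    proof (rule bij_betw_same_card[of p])
      have "p ` {s. s < 2 * n \<and> p s \<le> 2 * m} = p ` {..<2 * n} \<inter> {..2 * m}" by auto
      also have "\<dots> = {..2 * m}" using permutes_image[OF p] m by auto
      finally show "bij_betw p {s. s < 2 * n \<and> p s \<le> 2 * m} {..2 * m}"
        using permutes_inj[OF p] by (auto simp: bij_betw_def intro: inj_on_subset)
    qed
    finally show False by simp
  qed
  then have "label_pfaffian n R c = 0"
    unfolding label_pfaffian_def pfaffian_def by (simp del: prod_zero_iff)
  then show ?thesis using False by auto
qed

section \<open>Operations on skip-free paths\<close>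

definition path_join :: "real set \<Rightarrow> real \<Rightarrow> (real \<Rightarrow> real) \<Rightarrow> (real \<Rightarrow> real) \<Rightarrow> real \<Rightarrow> real" where
  "path_join I s v v' = (\<lambda>t\<in>I. if t < s then v t else v' (t - s))"

definition path_switch :: "real set \<Rightarrow> real \<Rightarrow> (real \<Rightarrow> real) \<Rightarrow> (real \<Rightarrow> real) \<Rightarrow> real \<Rightarrow> real" where
  "path_switch I s v w = (\<lambda>t\<in>I. if t < s then v t else w t)"

definition path_stop :: "real set \<Rightarrow> real \<Rightarrow> (real \<Rightarrow> real) \<Rightarrow> real \<Rightarrow> real" where
  "path_stop I s w = (\<lambda>t\<in>I. w (min t s))"

context skip_free_process
begin

lemma Ints_ne_UNIV: "(\<int> :: real set) \<noteq> UNIV"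
proof
  assume "(\<int> :: real set) = UNIV"
  then have "(1 / 2 :: real) \<in> \<int>" by simp
  then show False by simp
qed

lemma Nats_ne_atLeast: "(\<nat> :: real set) \<noteq> {0..}"
proof
  assume "(\<nat> :: real set) = {0..}"
  then have "(1 / 2 :: real) \<in> \<int>" using Nats_subset_Ints by (metis atLeast_iff divide_nonneg_nonneg subsetD zero_le_numeral zero_le_one)
  then show False by simp
qed

lemma time_cases [consumes 0, case_names discrete jump continuous]:
  obtains "S = \<int>" "I = \<nat>" "\<And>w. w \<in> skip_free_paths \<int> \<nat> \<longleftrightarrow> w \<in> \<nat> \<rightarrow>\<^sub>E \<int> \<and> (\<forall>t\<in>\<nat>. \<bar>w (t + 1) - w t\<bar> \<le> 1)"
  | "S = \<int>" "I = {0..}" "\<And>w. w \<in> skip_free_paths \<int> {0..} \<longleftrightarrow> w \<in> {0..} \<rightarrow>\<^sub>E \<int> \<and>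
        (\<forall>t\<ge>0. (w \<longlongrightarrow> w t) (at_right t)) \<and> (\<forall>t>0::real. \<exists>l. (w \<longlongrightarrow> l) (at_left t) \<and> \<bar>w t - l\<bar> \<le> 1)"
  | "S = UNIV" "I = {0..}" "\<And>w. w \<in> skip_free_paths UNIV {0..} \<longleftrightarrow> w \<in> {0..} \<rightarrow>\<^sub>E UNIV \<and> continuous_on {0..} w"
  using state_time Ints_ne_UNIV Nats_ne_atLeast
  by (auto simp: skip_free_paths_def continuous_within)

lemma skip_free_left_limit:
  assumes "S = \<int>" "I = {0..}" "w \<in> skip_free_paths S I" "0 < t"
  shows "\<exists>l. (w \<longlongrightarrow> l) (at_left t) \<and> \<bar>w t - l\<bar> \<le> 1"
  using assms Ints_ne_UNIV Nats_ne_atLeast by (auto simp: skip_free_paths_def)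

lemma zero_time [simp]: "0 \<in> I"
  using state_time by auto

lemma time_nonneg: "t \<in> I \<Longrightarrow> 0 \<le> t"
  using state_time by (auto elim: Nats_cases)

lemma time_add: "s \<in> I \<Longrightarrow> t \<in> I \<Longrightarrow> s + t \<in> I"
  using state_time by auto

lemma time_diff: "s \<in> I \<Longrightarrow> t \<in> I \<Longrightarrow> s \<le> t \<Longrightarrow> t - s \<in> I"
  using state_time by auto

lemma closed_time: "closed I"
  using state_time by auto

lemma path_in_states: "w \<in> skip_free_paths S I \<Longrightarrow> t \<in> I \<Longrightarrow> w t \<in> S"
  by (auto simp: skip_free_paths_def)

lemma path_undefined: "w \<in> skip_free_paths S I \<Longrightarrow> t \<notin> I \<Longrightarrow> w t = undefined"
  by (auto simp: skip_free_paths_def PiE_def extensional_def)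

text \<open>
  Right-continuity along times in \<open>I\<close> is what the first meeting times and all measurability
  arguments rest on, and it holds for the three kinds of paths alike.
\<close>

lemma path_right_limit:
  assumes w: "w \<in> skip_free_paths S I" and t: "t \<in> I"
    and X: "\<And>k. X k \<in> I" "\<And>k. t \<le> X k" "X \<longlonglongrightarrow> t"
  shows "(\<lambda>k. w (X k)) \<longlonglongrightarrow> w t"
proof (cases rule: time_cases)
  case discrete
  have "\<forall>\<^sub>F k in sequentially. \<bar>X k - t\<bar> < 1"
    using X(3) by (auto simp: tendsto_iff dist_real_def)
  then have "\<forall>\<^sub>F k in sequentially. w (X k) = w t"
  proof eventually_elim
    case (elim k)
    have "X k - t \<in> \<int>" using X(1) t discrete Nats_subset_Ints by (auto intro!: Ints_diff)
    then obtain m where m: "X k - t = of_int m" by (auto elim: Ints_cases)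
    with elim have "\<bar>real_of_int m\<bar> < 1" by simp
    then have "m = 0" by linarith
    then show ?case using m by simp
  qed
  then show ?thesis by (rule tendsto_eventually)
next
  case jump
  have "(w \<longlongrightarrow> w t) (at_right t)"
    using w t by (simp add: jump)
  moreover have "at t within {t..} = at_right t"
    by (auto simp: at_within_def intro!: arg_cong[where f="\<lambda>A. inf (nhds t) (principal A)"])
  ultimately have "continuous (at t within {t..}) w"
    by (simp add: continuous_within)
  then show ?thesis
    using X by (auto simp: continuous_within_sequentially o_def)
next
  case continuous
  then show ?thesis
    using w X t by (auto simp: continuous_on_sequentially o_def)
qed

text \<open>
  Right-continuity of the joined path at \<open>s\<close> comes from \<open>v'\<close>, its left limit at \<open>s\<close> from \<open>v\<close>; the
  condition \<open>v' 0 = v s\<close> makes the jump at \<open>s\<close> that of \<open>v\<close>.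
\<close>

lemma path_join_path:
  assumes v: "v \<in> skip_free_paths S I" and v': "v' \<in> skip_free_paths S I" and s: "s \<in> I" and eq: "v' 0 = v s"
  shows "path_join I s v v' \<in> skip_free_paths S I"
proof -
  have PiE: "path_join I s v v' \<in> I \<rightarrow>\<^sub>E S"
    using path_in_states[OF v] path_in_states[OF v'] s by (auto simp: path_join_def time_diff)
  have s0: "0 \<le> s" using s by (rule time_nonneg)
  show ?thesis
  proof (cases rule: time_cases)
    case discrete
    have "\<bar>path_join I s v v' (t + 1) - path_join I s v v' t\<bar> \<le> 1" if t: "t \<in> I" for t
    proof -
      have t1: "t + 1 \<in> I" using t discrete by auto
      consider "t + 1 < s" | "t + 1 = s" | "s \<le> t"
      proof -
        have "s - t \<in> \<int>" using s t discrete Nats_subset_Ints by (auto intro!: Ints_diff)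
        then obtain m where m: "s - t = of_int m" by (auto elim: Ints_cases)
        have "m \<le> 0 \<or> m = 1 \<or> 2 \<le> m" by linarith
        then have "real_of_int m \<le> 0 \<or> real_of_int m = 1 \<or> 2 \<le> real_of_int m" by auto
        then have "t + 1 < s \<or> t + 1 = s \<or> s \<le> t" using m by linarith
        then show thesis using that by blast
      qed
      then show ?thesis
      proof cases
        case 1 then show ?thesis using v t t1 by (simp add: path_join_def discrete)
      next
        case 2 then show ?thesis using v t t1 eq by (auto simp: path_join_def discrete)
      next
        case 3
        then have "t - s \<in> I" using time_diff s t by simp
        then have "\<bar>v' (t - s + 1) - v' (t - s)\<bar> \<le> 1" using v' by (simp add: discrete)
        then show ?thesis using t t1 3 by (simp add: path_join_def algebra_simps)
      qed
    qed
    then show ?thesis using PiE by (simp add: discrete)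
  next
    case jump
    have right: "(path_join I s v v' \<longlongrightarrow> path_join I s v v' t) (at_right t)" if t: "t \<ge> 0" for t
    proof (cases "t < s")
      case True
      have "\<forall>\<^sub>F u in at_right t. path_join I s v v' u = v u"
        using eventually_at_right_less[of t] eventually_at_right_field[of "\<lambda>u. u < s" t] True
        by (auto simp: eventually_at_right_field path_join_def jump intro!: exI[of _ s] t[THEN order_trans])
      then show ?thesis
        using v t True by (simp add: jump tendsto_cong path_join_def)
    next
      case False
      have ev: "\<forall>\<^sub>F u in at_right t. v' (u - s) = path_join I s v v' u"
        using False t by (auto simp: eventually_at_right_field path_join_def jump intro!: exI[of _ "t + 1"])
      have "filterlim (\<lambda>u. u - s) (at_right (t - s)) (at_right t)"
        by (auto simp: filterlim_at eventually_at_right_field intro!: tendsto_intros exI[of _ "t + 1"])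
      moreover have "(v' \<longlongrightarrow> v' (t - s)) (at_right (t - s))"
        using v' False by (simp add: jump)
      ultimately have "((\<lambda>u. v' (u - s)) \<longlongrightarrow> v' (t - s)) (at_right t)"
        by (rule filterlim_compose[rotated])
      moreover have "path_join I s v v' t = v' (t - s)" using False t by (auto simp: path_join_def jump)
      ultimately show ?thesis
        using Lim_transform_eventually[OF _ ev] by simp
    qed
    have left: "\<exists>l. (path_join I s v v' \<longlongrightarrow> l) (at_left t) \<and> \<bar>path_join I s v v' t - l\<bar> \<le> 1" if t: "t > 0" for t
    proof (cases "t \<le> s")
      case True
      have ev: "\<forall>\<^sub>F u in at_left t. v u = path_join I s v v' u"
        using t True by (auto simp: eventually_at_left_field path_join_def jump intro!: exI[of _ 0])
      obtain l where l: "(v \<longlongrightarrow> l) (at_left t)" "\<bar>v t - l\<bar> \<le> 1"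
        using skip_free_left_limit[OF jump(1,2) v t] by blast
      have "path_join I s v v' t = v t" using t True eq by (auto simp: path_join_def jump)
      then show ?thesis using l Lim_transform_eventually[OF _ ev] by auto
    next
      case False
      have ev: "\<forall>\<^sub>F u in at_left t. v' (u - s) = path_join I s v v' u"
        using False s0 by (auto simp: eventually_at_left_field path_join_def jump intro!: exI[of _ s])
      have flim: "filterlim (\<lambda>u. u - s) (at_left (t - s)) (at_left t)"
        by (auto simp: filterlim_at eventually_at_left_field intro!: tendsto_intros exI[of _ "t - 1"])
      obtain l where l: "(v' \<longlongrightarrow> l) (at_left (t - s))" "\<bar>v' (t - s) - l\<bar> \<le> 1"
        using skip_free_left_limit[OF jump(1,2) v', of "t - s"] False by auto
      have "((\<lambda>u. v' (u - s)) \<longlongrightarrow> l) (at_left t)"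
        using l(1) flim by (rule filterlim_compose)
      moreover have "path_join I s v v' t = v' (t - s)" using t False by (auto simp: path_join_def jump)
      ultimately show ?thesis using l Lim_transform_eventually[OF _ ev] by auto
    qed
    show ?thesis using PiE left right by (simp add: jump)
  next
    case continuous
    have "continuous_on I (\<lambda>t. if t \<le> s then v t else v' (t - s))"
    proof (rule continuous_on_cases_le)
      show "continuous_on {t \<in> I. t \<le> s} v"
        using v by (auto simp: continuous intro: continuous_on_subset)
      show "continuous_on {t \<in> I. s \<le> t} (\<lambda>t. v' (t - s))"
      proof (rule continuous_on_compose2[of I v'])
        show "continuous_on I v'" using v' by (simp add: continuous)
        show "continuous_on {t \<in> I. s \<le> t} (\<lambda>t. t - s)" by (intro continuous_intros)
        show "(\<lambda>t. t - s) ` {t \<in> I. s \<le> t} \<subseteq> I" using time_diff[OF s] by auto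
      qed
      show "continuous_on I (\<lambda>t. t)" by (rule continuous_on_id)
      show "v t = v' (t - s)" if "t \<in> I" "t = s" for t using that eq by simp
    qed
    then have "continuous_on I (path_join I s v v')"
      by (rule continuous_on_eq) (use eq in \<open>auto simp: path_join_def\<close>)
    then show ?thesis using PiE by (simp add: continuous)
  qed
qed

lemma shift_path:
  assumes w: "w \<in> skip_free_paths S I" and s: "s \<in> I"
  shows "path_shift I s w \<in> skip_free_paths S I"
proof -
  have PiE: "path_shift I s w \<in> I \<rightarrow>\<^sub>E S"
    using path_in_states[OF w] s by (auto simp: path_shift_def time_add)
  have s0: "0 \<le> s" using s by (rule time_nonneg)
  show ?thesis
  proof (cases rule: time_cases)
    case discrete
    have "\<bar>path_shift I s w (t + 1) - path_shift I s w t\<bar> \<le> 1" if t: "t \<in> I" for t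
    proof -
      have "\<bar>w (s + t + 1) - w (s + t)\<bar> \<le> 1" using w time_add[OF s t] by (auto simp: discrete)
      then show ?thesis using t discrete(2) by (simp add: path_shift_def algebra_simps)
    qed
    then show ?thesis using PiE by (simp add: discrete)
  next
    case jump
    have right: "(path_shift I s w \<longlongrightarrow> path_shift I s w t) (at_right t)" if t: "t \<ge> 0" for t
    proof -
      have ev: "\<forall>\<^sub>F u in at_right t. w (s + u) = path_shift I s w u"
        using t by (auto simp: eventually_at_right_field path_shift_def jump intro!: exI[of _ "t + 1"])
      have "filterlim (\<lambda>u. s + u) (at_right (s + t)) (at_right t)"
        by (auto simp: filterlim_at eventually_at_right_field intro!: tendsto_intros exI[of _ "t + 1"])
      moreover have "(w \<longlongrightarrow> w (s + t)) (at_right (s + t))"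
        using w s0 t by (simp add: jump)
      ultimately have "((\<lambda>u. w (s + u)) \<longlongrightarrow> w (s + t)) (at_right t)"
        by (rule filterlim_compose[rotated])
      moreover have "path_shift I s w t = w (s + t)" using t by (auto simp: path_shift_def jump)
      ultimately show ?thesis
        using Lim_transform_eventually[OF _ ev] by simp
    qed
    have left: "\<exists>l. (path_shift I s w \<longlongrightarrow> l) (at_left t) \<and> \<bar>path_shift I s w t - l\<bar> \<le> 1" if t: "t > 0" for t
    proof -
      have ev: "\<forall>\<^sub>F u in at_left t. w (s + u) = path_shift I s w u"
        using t by (auto simp: eventually_at_left_field path_shift_def jump intro!: exI[of _ 0])
      have flim: "filterlim (\<lambda>u. s + u) (at_left (s + t)) (at_left t)"
        by (auto simp: filterlim_at eventually_at_left_field intro!: tendsto_intros exI[of _ "t - 1"])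
      obtain l where l: "(w \<longlongrightarrow> l) (at_left (s + t))" "\<bar>w (s + t) - l\<bar> \<le> 1"
        using skip_free_left_limit[OF jump(1,2) w, of "s + t"] t s0 by auto
      have "((\<lambda>u. w (s + u)) \<longlongrightarrow> l) (at_left t)"
        using l(1) flim by (rule filterlim_compose)
      moreover have "path_shift I s w t = w (s + t)" using t by (auto simp: path_shift_def jump)
      ultimately show ?thesis using l Lim_transform_eventually[OF _ ev] by auto
    qed
    show ?thesis using PiE left right by (simp add: jump)
  next
    case continuous
    have "continuous_on I (\<lambda>t. w (s + t))"
      by (rule continuous_on_compose2[of I w]) (use w s0 in \<open>auto simp: continuous intro!: continuous_intros\<close>)
    then have "continuous_on I (path_shift I s w)"
      by (rule continuous_on_eq) (auto simp: path_shift_def)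
    then show ?thesis using PiE by (simp add: continuous)
  qed
qed

lemma const_path:
  assumes z: "z \<in> S"
  shows "(\<lambda>t\<in>I. z) \<in> skip_free_paths S I"
proof -
  have PiE: "(\<lambda>t\<in>I. z) \<in> I \<rightarrow>\<^sub>E S" using z by auto
  show ?thesis
  proof (cases rule: time_cases)
    case discrete
    then show ?thesis using PiE by simp
  next
    case jump
    have "((\<lambda>t\<in>{0..}. z) \<longlongrightarrow> z) (at_right t)" if "t \<ge> 0" for t :: real
      using that by (intro tendsto_eventually) (auto simp: eventually_at_right_field intro!: exI[of _ "t + 1"])
    moreover have "\<exists>l. ((\<lambda>t\<in>{0..}. z) \<longlongrightarrow> l) (at_left t) \<and> \<bar>z - l\<bar> \<le> 1" if "t > 0" for t :: real
      using that by (intro exI[of _ z] conjI tendsto_eventually)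
        (auto simp: eventually_at_left_field intro!: exI[of _ 0])
    ultimately show ?thesis using PiE by (simp add: jump)
  next
    case continuous
    have "continuous_on I (\<lambda>t\<in>I. z)" by (rule continuous_on_eq[of _ "\<lambda>_. z"]) auto
    then show ?thesis using PiE by (simp add: continuous)
  qed
qed

lemma path_switch_path:
  assumes "v \<in> skip_free_paths S I" "w \<in> skip_free_paths S I" "s \<in> I" "v s = w s"
  shows "path_switch I s v w \<in> skip_free_paths S I"
proof -
  have "path_switch I s v w = path_join I s v (path_shift I s w)"
    using time_diff[OF assms(3)] by (auto simp: path_switch_def path_join_def path_shift_def fun_eq_iff)
  then show ?thesis
    using path_join_path[OF assms(1) shift_path[OF assms(2,3)] assms(3)] assms by (simp add: path_shift_def)
qed

lemma path_stop_path:
  assumes "w \<in> skip_free_paths S I" "s \<in> I"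
  shows "path_stop I s w \<in> skip_free_paths S I"
proof -
  have "path_stop I s w = path_switch I s w (\<lambda>t\<in>I. w s)"
    using assms(2) by (auto simp: path_stop_def path_switch_def fun_eq_iff min_def)
  then show ?thesis
    using assms by (simp add: path_switch_path const_path path_in_states)
qed

lemma join_stopped_shift:
  assumes "w \<in> skip_free_paths S I" "s \<in> I"
  shows "path_join I s (path_stop I s w) (path_shift I s w) = w"
  using assms path_undefined[OF assms(1)] time_diff[OF assms(2)]
  by (auto simp: path_join_def path_stop_def path_shift_def fun_eq_iff)

text \<open>
  The infimum of the meeting times is a limit of meeting times from the right.
\<close>

lemma first_meeting_attained:
  assumes v: "v \<in> skip_free_paths S I" and w: "w \<in> skip_free_paths S I" and t: "t \<in> I" "v t = w t"
  obtains s where "s \<in> I" "v s = w s" "\<And>u. u \<in> I \<Longrightarrow> v u = w u \<Longrightarrow> s \<le> u"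
proof -
  define C where "C = {t \<in> I. v t = w t}"
  have C: "C \<noteq> {}" "bdd_below C" using t time_nonneg by (auto simp: C_def intro!: bdd_belowI)
  have lower: "Inf C \<le> u" if "u \<in> C" for u using that C by (intro cInf_lower)
  have "\<exists>x\<in>C. x < Inf C + 1 / real (Suc k)" for k
    using C by (subst cInf_less_iff[symmetric]) auto
  then obtain X where X: "X k \<in> C" "X k < Inf C + 1 / real (Suc k)" for k by metis
  have XI: "X \<longlonglongrightarrow> Inf C"
  proof (rule real_tendsto_sandwich[of "\<lambda>_. Inf C" _ _ "\<lambda>k. Inf C + 1 / real (Suc k)"])
    show "\<forall>\<^sub>F k in sequentially. Inf C \<le> X k" using lower X by auto
    show "\<forall>\<^sub>F k in sequentially. X k \<le> Inf C + 1 / real (Suc k)" using less_imp_le[OF X(2)] by auto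
    show "(\<lambda>k. Inf C + 1 / real (Suc k)) \<longlonglongrightarrow> Inf C"
      using tendsto_add[OF tendsto_const LIMSEQ_inverse_real_of_nat, of "Inf C"] by (simp add: inverse_eq_divide)
  qed simp
  have XinI: "X k \<in> I" for k using X(1)[of k] by (simp add: C_def)
  have Inf_I: "Inf C \<in> I"
    by (rule closed_sequentially[OF closed_time _ XI]) (use XinI in auto)
  have "(\<lambda>k. v (X k)) \<longlonglongrightarrow> v (Inf C)" "(\<lambda>k. w (X k)) \<longlonglongrightarrow> w (Inf C)"
    by (rule path_right_limit[OF v Inf_I XinI lower[OF X(1)] XI], rule path_right_limit[OF w Inf_I XinI lower[OF X(1)] XI])
  moreover have "v (X k) = w (X k)" for k using X(1)[of k] by (simp add: C_def)
  ultimately have "v (Inf C) = w (Inf C)" by (simp add: LIMSEQ_unique)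
  then show ?thesis using that[of "Inf C"] Inf_I lower by (auto simp: C_def)
qed

lemma first_meeting_attained_finite:
  assumes J: "finite J" and paths: "\<And>v w. (v, w) \<in> J \<Longrightarrow> v \<in> skip_free_paths S I \<and> w \<in> skip_free_paths S I"
    and ex: "\<exists>s\<in>I. \<exists>(v, w)\<in>J. v s = w s"
  obtains s where "s \<in> I" "\<exists>(v, w)\<in>J. v s = w s" "\<And>u v w. u \<in> I \<Longrightarrow> (v, w) \<in> J \<Longrightarrow> v u = w u \<Longrightarrow> s \<le> u"
proof -
  define J' where "J' = {(v, w) \<in> J. \<exists>s\<in>I. v s = w s}"
  have "\<forall>p\<in>J'. \<exists>s\<in>I. fst p s = snd p s \<and> (\<forall>u\<in>I. fst p u = snd p u \<longrightarrow> s \<le> u)"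
    using paths first_meeting_attained unfolding J'_def by (clarsimp) metis
  then obtain m where m: "m p \<in> I" "fst p (m p) = snd p (m p)" "u \<in> I \<Longrightarrow> fst p u = snd p u \<Longrightarrow> m p \<le> u"
    if "p \<in> J'" for p u by metis
  have J': "finite J'" "J' \<noteq> {}"
    using ex J by (auto simp: J'_def intro: finite_subset[of _ J])
  have "Min (m ` J') \<in> m ` J'" using J' by (intro Min_in) auto
  then obtain p where p: "p \<in> J'" "m p = Min (m ` J')" by auto
  show ?thesis
  proof
    show "m p \<in> I" using m p by blast
    show "\<exists>(v, w)\<in>J. v (m p) = w (m p)" using m(2)[OF p(1)] p(1) by (intro bexI[of _ p]) (auto simp: J'_def)
    show "m p \<le> u" if "u \<in> I" "(v, w) \<in> J" "v u = w u" for u v w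
    proof -
      have in': "(v, w) \<in> J'" using that by (auto simp: J'_def)
      then have "m p \<le> m (v, w)" using p J' by (simp add: Min_le)
      also have "\<dots> \<le> u" using m(3)[OF in'] that by simp
      finally show ?thesis .
    qed
  qed
qed

end

section \<open>Measurability on path space\<close>

definition path_agree :: "real set \<Rightarrow> real \<Rightarrow> (real \<Rightarrow> real) \<Rightarrow> (real \<Rightarrow> real) \<Rightarrow> bool" where
  "path_agree I s w w' \<longleftrightarrow> (\<forall>t\<in>I. t \<le> s \<longrightarrow> w t = w' t)"

definition path_meet :: "real set \<Rightarrow> real \<Rightarrow> (real \<Rightarrow> real) \<Rightarrow> (real \<Rightarrow> real) \<Rightarrow> bool" where
  "path_meet I t v w \<longleftrightarrow> (\<exists>s\<in>I. s \<le> t \<and> v s = w s)"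

text \<open>
  The law of the future after time \<open>s\<close> starts at \<open>v s\<close> almost surely, but not surely. Where it does
  not, the stopped path serves as a default, so that glueing always yields a skip-free path.
\<close>

definition path_glue :: "real set \<Rightarrow> real \<Rightarrow> (real \<Rightarrow> real) \<Rightarrow> (real \<Rightarrow> real) \<Rightarrow> real \<Rightarrow> real" where
  "path_glue I s v v' = (if v' 0 = v s then path_join I s v v' else path_stop I s v)"

context skip_free_process
begin

lemma measurable_path_coordinate:
  "t \<in> I \<Longrightarrow> (\<lambda>w. w t) \<in> borel_measurable (path_space S I)"
  unfolding path_space_def by (intro measurable_restrict_space1 measurable_component_singleton)

lemma measurable_into_path_space:
  assumes "\<And>x. x \<in> space M \<Longrightarrow> f x \<in> skip_free_paths S I"
    and "\<And>t. t \<in> I \<Longrightarrow> (\<lambda>x. f x t) \<in> borel_measurable M"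
  shows "f \<in> M \<rightarrow>\<^sub>M path_space S I"
  unfolding path_space_def
proof (rule measurable_restrict_space2)
  show "f \<in> space M \<rightarrow> skip_free_paths S I" using assms(1) by auto
  show "f \<in> M \<rightarrow>\<^sub>M (\<Pi>\<^sub>M t\<in>I. borel)"
    using measurable_PiM_single'[of I "\<lambda>t x. f x t" M "\<lambda>_. borel"] assms
    by (auto simp: skip_free_paths_def PiE_def)
qed

lemma measurable_path_component:
  "f \<in> M \<rightarrow>\<^sub>M path_space S I \<Longrightarrow> t \<in> I \<Longrightarrow> (\<lambda>x. f x t) \<in> borel_measurable M"
  by (rule measurable_compose[OF _ measurable_path_coordinate])

lemma path_space_value: "f \<in> M \<rightarrow>\<^sub>M path_space S I \<Longrightarrow> x \<in> space M \<Longrightarrow> f x \<in> skip_free_paths S I"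
  using measurable_space[of f M "path_space S I" x] by (simp add: space_path_space)

text \<open>
  Paths are right-continuous, so evaluation at a random time is the limit of evaluations at random
  times with countably many values that decrease to it.
\<close>

lemma measurable_path_eval:
  assumes f: "f \<in> M \<rightarrow>\<^sub>M path_space S I" and \<tau>: "\<tau> \<in> borel_measurable M" "\<And>x. x \<in> space M \<Longrightarrow> \<tau> x \<in> I"
  shows "(\<lambda>x. f x (\<tau> x)) \<in> borel_measurable M"
proof (cases "I = \<nat>")
  case True
  have "(\<lambda>x. f x (real (nat \<lfloor>\<tau> x\<rfloor>))) \<in> borel_measurable M"
    using \<tau>(1) by (intro measurable_compose_countable[where f="\<lambda>i x. f x (real i)" and g="\<lambda>x. nat \<lfloor>\<tau> x\<rfloor>"] measurable_path_component[OF f])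
      (auto simp: True)
  moreover have "real (nat \<lfloor>\<tau> x\<rfloor>) = \<tau> x" if "x \<in> space M" for x
    using \<tau>(2)[OF that] True by (auto elim: Nats_cases)
  ultimately show ?thesis by (simp cong: measurable_cong)
next
  case False
  then have I: "I = {0..}" using state_time by auto
  define d where "d m u = (real (nat \<lfloor>real (Suc m) * u\<rfloor>) + 1) / real (Suc m)" for m u
  have d: "d m u \<in> I" "u \<le> d m u" "d m u \<le> u + 1 / real (Suc m)" if "u \<in> I" for m u
  proof -
    have u: "0 \<le> real (Suc m) * u" using that I by simp
    have fl: "real (nat \<lfloor>real (Suc m) * u\<rfloor>) = real_of_int \<lfloor>real (Suc m) * u\<rfloor>" using u by simp
    show "d m u \<in> I" by (simp add: d_def I)
    have "real (Suc m) * u \<le> real_of_int \<lfloor>real (Suc m) * u\<rfloor> + 1" by linarith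
    then show "u \<le> d m u" unfolding d_def fl by (simp add: field_simps)
    have "real_of_int \<lfloor>real (Suc m) * u\<rfloor> \<le> real (Suc m) * u" by simp
    then have "d m u \<le> (real (Suc m) * u + 1) / real (Suc m)"
      unfolding d_def fl by (intro divide_right_mono) auto
    also have "\<dots> = u + 1 / real (Suc m)" by (simp add: add_divide_distrib del: of_nat_Suc)
    finally show "d m u \<le> u + 1 / real (Suc m)" .
  qed
  show ?thesis
  proof (rule borel_measurable_LIMSEQ_metric)
    show "(\<lambda>x. f x (d m (\<tau> x))) \<in> borel_measurable M" for m
      unfolding d_def using \<tau>(1)
      by (intro measurable_compose_countable[where f="\<lambda>i x. f x ((real i + 1) / real (Suc m))" and g="\<lambda>x. nat \<lfloor>real (Suc m) * \<tau> x\<rfloor>"] measurable_path_component[OF f])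
        (auto simp: I)
    show "(\<lambda>m. f x (d m (\<tau> x))) \<longlonglongrightarrow> f x (\<tau> x)" if x: "x \<in> space M" for x
    proof (rule path_right_limit[OF path_space_value[OF f x] \<tau>(2)[OF x]])
      show "(\<lambda>m. d m (\<tau> x)) \<longlonglongrightarrow> \<tau> x"
      proof (rule real_tendsto_sandwich[of "\<lambda>_. \<tau> x" _ _ "\<lambda>m. \<tau> x + 1 / real (Suc m)"])
        show "(\<lambda>m. \<tau> x + 1 / real (Suc m)) \<longlonglongrightarrow> \<tau> x"
          using tendsto_add[OF tendsto_const LIMSEQ_inverse_real_of_nat, of "\<tau> x"] by (simp add: inverse_eq_divide)
      qed (use d[OF \<tau>(2)[OF x]] in auto)
    qed (use d[OF \<tau>(2)[OF x]] in auto)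
  qed
qed

text \<open>
  The horizon \<open>t\<close> is added to the rational times because it is the only one available if \<open>s = t\<close>.
\<close>

lemma rational_times_from_right:
  assumes s: "s \<in> I" and t: "t \<in> I" and st: "s \<le> t"
  shows "\<exists>X. (\<forall>k. X k \<in> I \<inter> ({..t} \<inter> \<rat> \<union> {t})) \<and> (\<forall>k. s \<le> X k) \<and> X \<longlonglongrightarrow> s"
proof (cases "s \<in> {..t} \<inter> \<rat> \<union> {t}")
  case True
  then show ?thesis using s by (intro exI[of _ "\<lambda>_. s"]) auto
next
  case False
  then have lt: "s < t" using st by auto
  have I: "I = {0..}" using state_time False s st Nats_subset_Rats by auto
  have "\<exists>q\<in>\<rat>. s < q \<and> q < min t (s + 1 / real (Suc k))" for k
    using lt by (intro Rats_dense_in_real) auto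
  then obtain X where X: "X k \<in> \<rat>" "s < X k" "X k < min t (s + 1 / real (Suc k))" for k by metis
  have "X \<longlonglongrightarrow> s"
  proof (rule real_tendsto_sandwich[of "\<lambda>_. s" _ _ "\<lambda>k. s + 1 / real (Suc k)"])
    show "(\<lambda>k. s + 1 / real (Suc k)) \<longlonglongrightarrow> s"
      using tendsto_add[OF tendsto_const LIMSEQ_inverse_real_of_nat, of s] by (simp add: inverse_eq_divide)
    show "\<forall>\<^sub>F k in sequentially. s \<le> X k" using less_imp_le[OF X(2)] by auto
    have "X k \<le> s + 1 / real (Suc k)" for k using X(3)[of k] by simp
    then show "\<forall>\<^sub>F k in sequentially. X k \<le> s + 1 / real (Suc k)" by auto
  qed auto
  moreover have "X k \<in> I \<inter> ({..t} \<inter> \<rat> \<union> {t})" "s \<le> X k" for k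
    using X[of k] s I by auto
  ultimately show ?thesis by blast
qed

text \<open>
  Meeting is expressed by countably many times, so that it is measurable. On the integers, positions
  at distance less than \<open>1\<close> are equal; on the line, the distance attains its minimum over \<open>{0..t}\<close>.
\<close>

lemma path_meet_iff_rational:
  assumes v: "v \<in> skip_free_paths S I" and w: "w \<in> skip_free_paths S I" and t: "t \<in> I"
  shows "path_meet I t v w \<longleftrightarrow> (\<forall>m. \<exists>q\<in>I \<inter> ({..t} \<inter> \<rat> \<union> {t}). \<bar>v q - w q\<bar> < 1 / real (Suc m))"
    (is "_ \<longleftrightarrow> (\<forall>m. \<exists>q\<in>?D. _ q m)")
proof
  assume "path_meet I t v w"
  then obtain s where s: "s \<in> I" "s \<le> t" "v s = w s" by (auto simp: path_meet_def)
  obtain X where X: "\<And>k. X k \<in> ?D" "\<And>k. s \<le> X k" "X \<longlonglongrightarrow> s"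
    using rational_times_from_right[OF s(1) t s(2)] by blast
  have XI: "X k \<in> I" for k using X(1) by blast
  have "(\<lambda>k. v (X k) - w (X k)) \<longlonglongrightarrow> v s - w s"
    by (intro tendsto_diff path_right_limit[OF v s(1) XI X(2,3)] path_right_limit[OF w s(1) XI X(2,3)])
  then have conv: "(\<lambda>k. v (X k) - w (X k)) \<longlonglongrightarrow> 0" using s by simp
  show "\<forall>m. \<exists>q\<in>?D. \<bar>v q - w q\<bar> < 1 / real (Suc m)"
  proof
    fix m
    have "\<forall>\<^sub>F k in sequentially. \<bar>v (X k) - w (X k)\<bar> < 1 / real (Suc m)"
      using tendstoD[OF conv, of "1 / real (Suc m)"] by (simp add: dist_real_def)
    then obtain k where "\<bar>v (X k) - w (X k)\<bar> < 1 / real (Suc m)"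
      using eventually_happens trivial_limit_sequentially by blast
    then show "\<exists>q\<in>?D. \<bar>v q - w q\<bar> < 1 / real (Suc m)" using X(1)[of k] by blast
  qed
next
  assume *: "\<forall>m. \<exists>q\<in>?D. \<bar>v q - w q\<bar> < 1 / real (Suc m)"
  show "path_meet I t v w"
  proof (cases "S = UNIV")
    case False
    then have S: "S = \<int>" using state_time by auto
    from *[rule_format, of 0] obtain q where q: "q \<in> ?D" "\<bar>v q - w q\<bar> < 1" by auto
    have "v q - w q \<in> \<int>" using path_in_states[OF v] path_in_states[OF w] q S by (auto intro: Ints_diff)
    then obtain z where z: "v q - w q = of_int z" by (auto elim: Ints_cases)
    with q have "\<bar>real_of_int z\<bar> < 1" by simp
    then have "z = 0" by linarith
    then show ?thesis using z q by (auto simp: path_meet_def)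
  next
    case True
    have t0: "0 \<le> t" using t by (rule time_nonneg)
    have I: "I = {0..}" using True state_time Ints_ne_UNIV by auto
    have cont: "continuous_on {0..t} (\<lambda>s. \<bar>v s - w s\<bar>)"
      using v w True I by (intro continuous_intros) (auto simp: skip_free_paths_def intro: continuous_on_subset)
    obtain s where s: "s \<in> {0..t}" "\<And>u. u \<in> {0..t} \<Longrightarrow> \<bar>v s - w s\<bar> \<le> \<bar>v u - w u\<bar>"
      using continuous_attains_inf[OF _ _ cont] t0 by auto
    have "\<bar>v s - w s\<bar> < 1 / real (Suc m)" for m
      using *[rule_format, of m] s(2) t0 I by fastforce
    then have "\<bar>v s - w s\<bar> \<le> 0"
      by (meson linorder_not_less nat_approx_posE order_less_trans less_asym)
    then show ?thesis using s I by (auto simp: path_meet_def)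
  qed
qed

lemma measurable_path_meet:
  assumes f: "f \<in> M \<rightarrow>\<^sub>M path_space S I" and g: "g \<in> M \<rightarrow>\<^sub>M path_space S I" and t: "t \<in> I"
  shows "Measurable.pred M (\<lambda>x. path_meet I t (f x) (g x))"
proof -
  let ?D = "I \<inter> ({..t} \<inter> \<rat> \<union> {t})"
  have cD: "countable ?D" using countable_rat by (auto intro: countable_subset[of _ "\<rat> \<union> {t}"])
  have "Measurable.pred M (\<lambda>x. \<bar>f x q - g x q\<bar> < 1 / real (Suc m))" if "q \<in> ?D" for q m
  proof -
    have [measurable]: "(\<lambda>x. f x q) \<in> borel_measurable M" "(\<lambda>x. g x q) \<in> borel_measurable M"
      using that f g by (auto intro: measurable_path_component)
    show ?thesis by measurable
  qed
  then have "Measurable.pred M (\<lambda>x. \<forall>m. \<exists>q\<in>?D. \<bar>f x q - g x q\<bar> < 1 / real (Suc m))"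
    using cD by (intro pred_intros_countable pred_intros_countable_bounded) auto
  then show ?thesis
    by (rule measurable_cong[THEN iffD2, rotated])
      (use path_space_value[OF f] path_space_value[OF g] t in \<open>auto simp: path_meet_iff_rational\<close>)
qed

lemma measurable_path_if:
  assumes "Measurable.pred M Q" "\<And>x. x \<in> space M \<Longrightarrow> (if Q x then f x else g x) \<in> skip_free_paths S I"
    and "\<And>t. t \<in> I \<Longrightarrow> (\<lambda>x. f x t) \<in> borel_measurable M" "\<And>t. t \<in> I \<Longrightarrow> (\<lambda>x. g x t) \<in> borel_measurable M"
  shows "(\<lambda>x. if Q x then f x else g x) \<in> M \<rightarrow>\<^sub>M path_space S I"
proof (rule measurable_into_path_space)
  fix t assume t: "t \<in> I"
  have "(\<lambda>x. (if Q x then f x else g x) t) = (\<lambda>x. if Q x then f x t else g x t)" by auto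
  then show "(\<lambda>x. (if Q x then f x else g x) t) \<in> borel_measurable M"
    using assms(1) assms(3,4)[OF t] by simp
qed (use assms in auto)

lemma measurable_switch_coordinate:
  assumes f: "f \<in> M \<rightarrow>\<^sub>M path_space S I" and g: "g \<in> M \<rightarrow>\<^sub>M path_space S I"
    and \<tau>: "\<tau> \<in> borel_measurable M" and t: "t \<in> I"
  shows "(\<lambda>x. path_switch I (\<tau> x) (f x) (g x) t) \<in> borel_measurable M"
  using \<tau> measurable_path_component[OF f t] measurable_path_component[OF g t] t
  by (simp add: path_switch_def)

lemma measurable_path_stop:
  assumes f: "f \<in> M \<rightarrow>\<^sub>M path_space S I" and \<tau>: "\<tau> \<in> borel_measurable M" "\<And>x. x \<in> space M \<Longrightarrow> \<tau> x \<in> I"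
  shows "(\<lambda>x. path_stop I (\<tau> x) (f x)) \<in> M \<rightarrow>\<^sub>M path_space S I"
proof (rule measurable_into_path_space)
  fix t assume t: "t \<in> I"
  have "(\<lambda>x. f x (min t (\<tau> x))) \<in> borel_measurable M"
    using \<tau> t by (intro measurable_path_eval[OF f]) (auto simp: min_def)
  then show "(\<lambda>x. path_stop I (\<tau> x) (f x) t) \<in> borel_measurable M"
    using t by (simp add: path_stop_def)
qed (use path_space_value[OF f] \<tau> in \<open>auto intro: path_stop_path\<close>)

lemma measurable_path_shift:
  assumes f: "f \<in> M \<rightarrow>\<^sub>M path_space S I" and \<tau>: "\<tau> \<in> borel_measurable M" "\<And>x. x \<in> space M \<Longrightarrow> \<tau> x \<in> I"
  shows "(\<lambda>x. path_shift I (\<tau> x) (f x)) \<in> M \<rightarrow>\<^sub>M path_space S I"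
proof (rule measurable_into_path_space)
  fix t assume t: "t \<in> I"
  have "(\<lambda>x. f x (\<tau> x + t)) \<in> borel_measurable M"
    using \<tau> t by (intro measurable_path_eval[OF f]) (auto intro: time_add)
  then show "(\<lambda>x. path_shift I (\<tau> x) (f x) t) \<in> borel_measurable M"
    using t by (simp add: path_shift_def)
qed (use path_space_value[OF f] \<tau> in \<open>auto intro: shift_path\<close>)

lemma path_glue_path:
  "v \<in> skip_free_paths S I \<Longrightarrow> v' \<in> skip_free_paths S I \<Longrightarrow> s \<in> I \<Longrightarrow> path_glue I s v v' \<in> skip_free_paths S I"
  by (auto simp: path_glue_def intro: path_join_path path_stop_path)

lemma measurable_path_glue:
  assumes f: "f \<in> M \<rightarrow>\<^sub>M path_space S I" and g: "g \<in> M \<rightarrow>\<^sub>M path_space S I"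
    and \<tau>[measurable]: "\<tau> \<in> borel_measurable M" "\<And>x. x \<in> space M \<Longrightarrow> \<tau> x \<in> I"
  shows "(\<lambda>x. path_glue I (\<tau> x) (f x) (g x)) \<in> M \<rightarrow>\<^sub>M path_space S I"
  unfolding path_glue_def
proof (rule measurable_path_if)
  have [measurable]: "(\<lambda>x. f x (\<tau> x)) \<in> borel_measurable M" "(\<lambda>x. g x 0) \<in> borel_measurable M"
    using f g \<tau> by (auto intro: measurable_path_eval)
  show "Measurable.pred M (\<lambda>x. g x 0 = f x (\<tau> x))" by measurable
  fix t assume t: "t \<in> I"
  have g': "(\<lambda>x. g x (if \<tau> x \<le> t then t - \<tau> x else 0)) \<in> borel_measurable M"
    using \<tau> t by (intro measurable_path_eval[OF g]) (auto intro: time_diff)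
  have [measurable]: "(\<lambda>x. f x t) \<in> borel_measurable M" by (rule measurable_path_component[OF f t])
  have "(\<lambda>x. if t < \<tau> x then f x t else g x (if \<tau> x \<le> t then t - \<tau> x else 0)) \<in> borel_measurable M"
    using g' by measurable
  also have "(\<lambda>x. if t < \<tau> x then f x t else g x (if \<tau> x \<le> t then t - \<tau> x else 0)) = (\<lambda>x. path_join I (\<tau> x) (f x) (g x) t)"
    using t by (auto simp: path_join_def)
  finally show "(\<lambda>x. path_join I (\<tau> x) (f x) (g x) t) \<in> borel_measurable M" .
  show "(\<lambda>x. path_stop I (\<tau> x) (f x) t) \<in> borel_measurable M"
    by (rule measurable_path_component[OF measurable_path_stop[OF f \<tau>] t])
qed (use path_glue_path path_space_value[OF f] path_space_value[OF g] \<tau> in \<open>auto simp: path_glue_def\<close>)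

lemma path_agree_glue:
  assumes "s \<in> I" shows "path_agree I s v (path_glue I s v v')"
  by (auto simp: path_agree_def path_glue_def path_join_def path_stop_def)

lemma path_agree_stop: "path_agree I s v (path_stop I s v)"
  by (auto simp: path_agree_def path_stop_def)

section \<open>The strong Markov property\<close>

text \<open>
  The filtration is indexed by all real times, but paths can only be stopped at times in \<open>I\<close>.
\<close>

lemma time_below:
  assumes "0 \<le> t"
  shows "\<exists>t'\<in>I. t' \<le> t \<and> (\<forall>u\<in>I. u \<le> t \<longrightarrow> u \<le> t')"
proof (cases "I = \<nat>")
  case True
  have "u \<le> real (nat \<lfloor>t\<rfloor>)" if u: "u \<in> \<nat>" "u \<le> t" for u
  proof -
    obtain k where k: "u = real k" using u by (auto elim: Nats_cases)
    then have "k \<le> nat \<lfloor>t\<rfloor>" using u by (simp add: le_nat_floor)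
    then show ?thesis unfolding k by (rule of_nat_mono)
  qed
  moreover have "real (nat \<lfloor>t\<rfloor>) \<in> I" unfolding True by (rule of_nat_in_Nats)
  moreover have "real (nat \<lfloor>t\<rfloor>) \<le> t" using assms by simp
  ultimately show ?thesis using True by blast
next
  case False
  then show ?thesis using state_time assms by (intro bexI[of _ t]) auto
qed

text \<open>
  Galmarino's test. Stopping at time \<open>t\<close> is measurable with respect to the filtration at \<open>t\<close>, and an
  event that depends only on the path up to \<open>t\<close> is its own preimage under this map.
\<close>

lemma filtration_memI:
  assumes A: "A \<in> sets (path_space S I)" and t: "0 \<le> t"
    and past: "\<And>w w'. w \<in> A \<Longrightarrow> w' \<in> skip_free_paths S I \<Longrightarrow> path_agree I t w w' \<Longrightarrow> w' \<in> A"
  shows "A \<in> sets (path_filtration S I t)"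
proof -
  obtain t' where t': "t' \<in> I" "t' \<le> t" "\<And>u. u \<in> I \<Longrightarrow> u \<le> t \<Longrightarrow> u \<le> t'"
    using time_below[OF t] by blast
  have meas: "path_stop I t' \<in> path_filtration S I t \<rightarrow>\<^sub>M path_space S I"
  proof (rule measurable_into_path_space)
    show "path_stop I t' w \<in> skip_free_paths S I" if "w \<in> space (path_filtration S I t)" for w
      using that t' by (auto simp: path_filtration_def intro: path_stop_path)
    fix u assume u: "u \<in> I"
    have m: "min u t' \<in> I \<inter> {..t}" using u t' by (auto simp: min_def)
    have "(\<lambda>w. restrict w (I \<inter> {..t}) (min u t')) \<in> borel_measurable (path_filtration S I t)"
      unfolding path_filtration_def
      by (rule measurable_compose[OF measurable_vimage_algebra1 measurable_component_singleton[OF m]])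
        (simp add: space_PiM Pi_iff PiE_iff extensional_def)
    then show "(\<lambda>w. path_stop I t' w u) \<in> borel_measurable (path_filtration S I t)"
      using m u by (simp add: path_stop_def)
  qed
  have "path_stop I t' -` A \<inter> space (path_filtration S I t) \<in> sets (path_filtration S I t)"
    by (rule measurable_sets[OF meas A])
  also have "path_stop I t' -` A \<inter> space (path_filtration S I t) = A"
  proof -
    have sub: "A \<subseteq> skip_free_paths S I" using sets.sets_into_space[OF A] by (simp add: space_path_space)
    have ag: "path_agree I t w (path_stop I t' w)" "path_agree I t (path_stop I t' w) w" for w
      using t' by (auto simp: path_agree_def path_stop_def min_def)
    have "path_stop I t' w \<in> A \<longleftrightarrow> w \<in> A" if "w \<in> skip_free_paths S I" for w
      using past[OF _ path_stop_path[OF that t'(1)] ag(1)] past[OF _ that ag(2)] by blast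
    then show ?thesis using sub by (auto simp: path_filtration_def)
  qed
  finally show ?thesis .
qed

text \<open>
  Stopping times in the form of Galmarino's test: a measurable time whose value can be read off from
  the path up to this time.
\<close>

definition past_determined :: "((real \<Rightarrow> real) \<Rightarrow> real) \<Rightarrow> bool" where
  "past_determined \<tau> \<longleftrightarrow> \<tau> \<in> borel_measurable (path_space S I) \<and>
     (\<forall>w\<in>skip_free_paths S I. \<tau> w \<in> I \<and>
       (\<forall>w'\<in>skip_free_paths S I. path_agree I (\<tau> w) w w' \<longrightarrow> \<tau> w' = \<tau> w))"

lemma past_determined_stopping_time:
  assumes \<tau>: "past_determined \<tau>"
  shows "stopping_time (path_filtration S I) \<tau>"
proof
  fix t
  have sp: "space (path_filtration S I t) = skip_free_paths S I" by (simp add: path_filtration_def)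
  have [measurable]: "\<tau> \<in> borel_measurable (path_space S I)"
    using \<tau> by (simp add: past_determined_def)
  have "{w \<in> space (path_space S I). \<tau> w \<le> t} \<in> sets (path_space S I)" by measurable
  then have m: "{w \<in> skip_free_paths S I. \<tau> w \<le> t} \<in> sets (path_space S I)"
    by (simp add: space_path_space)
  show "Measurable.pred (path_filtration S I t) (\<lambda>x. \<tau> x \<le> t)"
    unfolding pred_def sp
  proof (cases "0 \<le> t")
    case True
    show "{w \<in> skip_free_paths S I. \<tau> w \<le> t} \<in> sets (path_filtration S I t)"
    proof (rule filtration_memI[OF m True])
      fix w w' assume w: "w \<in> {w \<in> skip_free_paths S I. \<tau> w \<le> t}" "w' \<in> skip_free_paths S I" "path_agree I t w w'"
      then have "path_agree I (\<tau> w) w w'" by (auto simp: path_agree_def)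
      then show "w' \<in> {w \<in> skip_free_paths S I. \<tau> w \<le> t}" using w \<tau> by (auto simp: past_determined_def)
    qed
  next
    case False
    have "{w \<in> skip_free_paths S I. \<tau> w \<le> t} = {}"
    proof -
      have "0 \<le> \<tau> w" if "w \<in> skip_free_paths S I" for w
        using that \<tau> by (intro time_nonneg) (auto simp: past_determined_def)
      then show ?thesis using False by fastforce
    qed
    then show "{w \<in> skip_free_paths S I. \<tau> w \<le> t} \<in> sets (path_filtration S I t)"
      by (simp only: sets.empty_sets)
  qed
qed

text \<open>
  Galmarino's test for the events before a stopping time.
\<close>

lemma pre_sigma_memI:
  assumes \<tau>: "past_determined \<tau>" and A: "A \<in> sets (path_space S I)"
    and past: "\<And>w w'. w \<in> A \<Longrightarrow> w' \<in> skip_free_paths S I \<Longrightarrow> path_agree I (\<tau> w) w w' \<Longrightarrow> w' \<in> A"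
  shows "A \<in> sets (filtration.pre_sigma (skip_free_paths S I) (path_filtration S I) \<tau>)"
proof (rule filtration.sets_pre_sigmaI[OF filtration_path_filtration past_determined_stopping_time[OF \<tau>]])
  fix t
  have sub: "A \<subseteq> skip_free_paths S I" using sets.sets_into_space[OF A] by (simp add: space_path_space)
  show "{w \<in> A. \<tau> w \<le> t} \<in> sets (path_filtration S I t)"
  proof (cases "0 \<le> t")
    case True
    have [measurable]: "\<tau> \<in> borel_measurable (path_space S I)"
      using \<tau> by (simp add: past_determined_def)
    have "{w \<in> space (path_space S I). \<tau> w \<le> t} \<in> sets (path_space S I)" by measurable
    then have "A \<inter> {w \<in> space (path_space S I). \<tau> w \<le> t} \<in> sets (path_space S I)" using A by auto
    also have "A \<inter> {w \<in> space (path_space S I). \<tau> w \<le> t} = {w \<in> A. \<tau> w \<le> t}"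
      using sub by (auto simp: space_path_space)
    finally have m: "{w \<in> A. \<tau> w \<le> t} \<in> sets (path_space S I)" .
    show ?thesis
    proof (rule filtration_memI[OF m True])
      fix w w' assume w: "w \<in> {w \<in> A. \<tau> w \<le> t}" "w' \<in> skip_free_paths S I" "path_agree I t w w'"
      then have ag: "path_agree I (\<tau> w) w w'" by (auto simp: path_agree_def)
      moreover have "\<tau> w' = \<tau> w" using ag w \<tau> sub by (auto simp: past_determined_def)
      ultimately show "w' \<in> {w \<in> A. \<tau> w \<le> t}" using w past by auto
    qed
  next
    case False
    have "{w \<in> A. \<tau> w \<le> t} = {}"
    proof -
      have "0 \<le> \<tau> w" if "w \<in> A" for w
        using that \<tau> sub by (intro time_nonneg) (auto simp: past_determined_def)
      then show ?thesis using False by fastforce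
    qed
    then show ?thesis by (simp only: sets.empty_sets)
  qed
qed

lemma sets_law: "s \<in> I \<Longrightarrow> x \<in> S \<Longrightarrow> sets (P s x) = sets (path_space S I)"
  and prob_space_law: "s \<in> I \<Longrightarrow> x \<in> S \<Longrightarrow> prob_space (P s x)"
  using measurable_space[OF kernel, of "(s, x)"]
  by (auto simp: space_restrict_space space_prob_algebra)

lemma space_law: "s \<in> I \<Longrightarrow> x \<in> S \<Longrightarrow> space (P s x) = skip_free_paths S I"
  using sets_eq_imp_space_eq[OF sets_law] by (simp add: space_path_space)

lemma measurable_law:
  assumes "s \<in> borel_measurable M" "x \<in> borel_measurable M" "\<And>w. w \<in> space M \<Longrightarrow> s w \<in> I \<and> x w \<in> S"
  shows "(\<lambda>w. P (s w) (x w)) \<in> M \<rightarrow>\<^sub>M prob_algebra (path_space S I)"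
proof -
  have "(\<lambda>w. (s w, x w)) \<in> M \<rightarrow>\<^sub>M restrict_space borel (I \<times> S)"
    using assms by (intro measurable_restrict_space2) auto
  from measurable_compose[OF this kernel] show ?thesis by simp
qed

lemma measurable_law_subprob:
  assumes "s \<in> borel_measurable M" "x \<in> borel_measurable M" "\<And>w. w \<in> space M \<Longrightarrow> s w \<in> I \<and> x w \<in> S"
  shows "(\<lambda>w. P (s w) (x w)) \<in> M \<rightarrow>\<^sub>M subprob_algebra (path_space S I)"
  using measurable_law[OF assms] by (rule measurable_prob_algebraD)

lemma past_determinedD:
  assumes "past_determined \<tau>"
  shows "\<tau> \<in> borel_measurable (path_space S I)" "\<And>w. w \<in> skip_free_paths S I \<Longrightarrow> \<tau> w \<in> I"
    "\<And>w w'. w \<in> skip_free_paths S I \<Longrightarrow> w' \<in> skip_free_paths S I \<Longrightarrow> path_agree I (\<tau> w) w w' \<Longrightarrow> \<tau> w' = \<tau> w"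
  using assms unfolding past_determined_def by blast+

text \<open>
  The strong Markov property determines the joint law of the stopped path and the shifted path on
  rectangles, which generate the product \<open>\<sigma>\<close>-algebra; so the joint law is that of the stopped path
  together with a future drawn from the kernel.
\<close>

lemma strong_markov_stop_shift:
  assumes x: "x \<in> S" and \<tau>: "past_determined \<tau>"
    and g: "g \<in> borel_measurable (path_space S I \<Otimes>\<^sub>M path_space S I)"
  shows "(\<integral>\<^sup>+w. g (path_stop I (\<tau> w) w, path_shift I (\<tau> w) w) \<partial>P 0 x) =
    (\<integral>\<^sup>+w. \<integral>\<^sup>+w'. g (path_stop I (\<tau> w) w, w') \<partial>P (\<tau> w) (w (\<tau> w)) \<partial>P 0 x)"
proof -
  let ?PS = "path_space S I" and ?M = "P 0 x"
  note \<tau>D = past_determinedD[OF \<tau>]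
  interpret M: prob_space ?M using x by (simp add: prob_space_law)
  have sM[measurable_cong]: "sets ?M = sets ?PS" using x by (simp add: sets_law)
  have spM: "space ?M = skip_free_paths S I" using x by (simp add: space_law)
  have \<tau>m[measurable]: "\<tau> \<in> borel_measurable ?M" using \<tau>D(1) by simp
  have idm: "(\<lambda>w. w) \<in> ?M \<rightarrow>\<^sub>M ?PS" by measurable
  have \<tau>I: "\<tau> w \<in> I" if "w \<in> space ?M" for w using that \<tau>D(2) spM by simp
  have stop[measurable]: "(\<lambda>w. path_stop I (\<tau> w) w) \<in> ?M \<rightarrow>\<^sub>M ?PS"
    by (rule measurable_path_stop[OF idm \<tau>m \<tau>I])
  have shift[measurable]: "(\<lambda>w. path_shift I (\<tau> w) w) \<in> ?M \<rightarrow>\<^sub>M ?PS"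
    by (rule measurable_path_shift[OF idm \<tau>m \<tau>I])
  define K where "K w = P (\<tau> w) (w (\<tau> w))" for w
  have K: "K \<in> ?M \<rightarrow>\<^sub>M prob_algebra ?PS"
    unfolding K_def using \<tau>I path_in_states spM
    by (intro measurable_law \<tau>m measurable_path_eval[OF idm \<tau>m \<tau>I]) auto
  then have Ks[measurable]: "K \<in> ?M \<rightarrow>\<^sub>M subprob_algebra ?PS" by (rule measurable_prob_algebraD)
  have sK: "sets (K w) = sets ?PS" "prob_space (K w)" if "w \<in> space ?M" for w
    using measurable_space[OF K that] by (auto simp: space_prob_algebra)
  have pair: "(\<lambda>w'. (path_stop I (\<tau> w) w, w')) \<in> K w \<rightarrow>\<^sub>M ?PS \<Otimes>\<^sub>M ?PS" if w: "w \<in> space ?M" for w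
    unfolding measurable_cong_sets[OF sK(1)[OF w] refl]
    by (rule measurable_Pair1'[OF measurable_space[OF stop w]])
  define N where "N w = distr (K w) (?PS \<Otimes>\<^sub>M ?PS) (\<lambda>w'. (path_stop I (\<tau> w) w, w'))" for w
  have N[measurable]: "N \<in> ?M \<rightarrow>\<^sub>M subprob_algebra (?PS \<Otimes>\<^sub>M ?PS)"
    unfolding N_def
  proof (rule measurable_distr2[OF _ Ks])
    show "(\<lambda>(w, w'). (path_stop I (\<tau> w) w, w')) \<in> ?M \<Otimes>\<^sub>M ?PS \<rightarrow>\<^sub>M ?PS \<Otimes>\<^sub>M ?PS"
      using measurable_Pair[OF measurable_compose[OF measurable_fst stop] measurable_snd]
      by (simp only: split_beta')
  qed
  define M1 where "M1 = distr ?M (?PS \<Otimes>\<^sub>M ?PS) (\<lambda>w. (path_stop I (\<tau> w) w, path_shift I (\<tau> w) w))"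
  \<comment> \<open>\<open>M1\<close> is the joint law, \<open>N w\<close> its conditional law given the path \<open>w\<close> up to \<open>\<tau> w\<close>.\<close>
  have "M1 = ?M \<bind> N"
  proof (rule measure_eqI_generator_eq[OF Int_stable_pair_measure_generator[of ?PS ?PS]])
    show "{a \<times> b |a b. a \<in> sets ?PS \<and> b \<in> sets ?PS} \<subseteq> Pow (space ?PS \<times> space ?PS)"
      by (rule pair_measure_closed)
    show "sets M1 = sigma_sets (space ?PS \<times> space ?PS) {a \<times> b |a b. a \<in> sets ?PS \<and> b \<in> sets ?PS}"
      by (simp add: M1_def sets_pair_measure)
    show "sets (?M \<bind> N) = sigma_sets (space ?PS \<times> space ?PS) {a \<times> b |a b. a \<in> sets ?PS \<and> b \<in> sets ?PS}"
      using sets_bind[OF sets_kernel[OF N] M.not_empty] by (simp add: sets_pair_measure)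
    show "range (\<lambda>i::nat. space ?PS \<times> space ?PS) \<subseteq> {a \<times> b |a b. a \<in> sets ?PS \<and> b \<in> sets ?PS}" by auto
    show "emeasure M1 (space ?PS \<times> space ?PS) \<noteq> \<infinity>" for i :: nat
    proof -
      have "prob_space M1" unfolding M1_def by (rule M.prob_space_distr[OF measurable_Pair[OF stop shift]])
      then show ?thesis
        unfolding infinity_ennreal_def by (intro finite_measure.emeasure_finite prob_space.finite_measure)
    qed
    fix C assume "C \<in> {a \<times> b |a b. a \<in> sets ?PS \<and> b \<in> sets ?PS}"
    then obtain A B where C: "C = A \<times> B" and A[measurable]: "A \<in> sets ?PS" and B[measurable]: "B \<in> sets ?PS" by auto
    let ?A = "{w \<in> skip_free_paths S I. path_stop I (\<tau> w) w \<in> A}"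
    have "?A = (\<lambda>w. path_stop I (\<tau> w) w) -` A \<inter> space ?M" by (auto simp: spM)
    then have Am: "?A \<in> sets ?PS"
      using measurable_sets[OF stop A] by (simp only: sM)
    have pre: "?A \<in> sets (filtration.pre_sigma (skip_free_paths S I) (path_filtration S I) \<tau>)"
    proof (rule pre_sigma_memI[OF \<tau> Am])
      fix w w' assume w: "w \<in> ?A" "w' \<in> skip_free_paths S I" "path_agree I (\<tau> w) w w'"
      then have "\<tau> w' = \<tau> w" using \<tau>D(3)[of w w'] by blast
      moreover have "path_stop I (\<tau> w) w' = path_stop I (\<tau> w) w"
        using w(3) \<tau>D(2)[of w] w(1) unfolding path_agree_def path_stop_def
        by (intro restrict_ext) (simp add: min_def)
      ultimately show "w' \<in> ?A" using w by simp
    qed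
    have "emeasure M1 C = emeasure ?M {w \<in> ?A. path_shift I (\<tau> w) w \<in> B}"
    proof -
      have "(\<lambda>w. (path_stop I (\<tau> w) w, path_shift I (\<tau> w) w)) -` (A \<times> B) \<inter> space ?M =
          {w \<in> ?A. path_shift I (\<tau> w) w \<in> B}" by (auto simp: spM)
      then show ?thesis
        unfolding M1_def C by (simp only: emeasure_distr[OF measurable_Pair[OF stop shift] pair_measureI[OF A B]])
    qed
    also have "\<dots> = (\<integral>\<^sup>+w\<in>?A. emeasure (P (0 + \<tau> w) (w (\<tau> w))) B \<partial>?M)"
      by (rule strong_markov[OF zero_time x past_determined_stopping_time[OF \<tau>] _ pre B])
        (rule Pi_I, erule \<tau>D(2))
    also have "\<dots> = (\<integral>\<^sup>+w. emeasure (N w) C \<partial>?M)"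
    proof (rule nn_integral_cong)
      fix w assume w: "w \<in> space ?M"
      have "emeasure (N w) C = emeasure (K w) ((\<lambda>w'. (path_stop I (\<tau> w) w, w')) -` C \<inter> space (K w))"
        unfolding N_def C by (rule emeasure_distr[OF pair[OF w] pair_measureI[OF A B]])
      also have "(\<lambda>w'. (path_stop I (\<tau> w) w, w')) -` C \<inter> space (K w) = (if w \<in> ?A then B else {})"
      proof (cases "w \<in> ?A")
        case True
        then show ?thesis
          using sets.sets_into_space[OF B] sets_eq_imp_space_eq[OF sK(1)[OF w]] by (auto simp: C)
      next
        case False
        then have "path_stop I (\<tau> w) w \<notin> A" using w by (simp add: spM)
        then show ?thesis using False by (auto simp: C)
      qed
      finally show "emeasure (P (0 + \<tau> w) (w (\<tau> w))) B * indicator ?A w = emeasure (N w) C"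
        by (auto simp: K_def)
    qed
    also have "\<dots> = emeasure (?M \<bind> N) C"
      unfolding C by (rule emeasure_bind[symmetric, OF M.not_empty N pair_measureI[OF A B]])
    finally show "emeasure M1 C = emeasure (?M \<bind> N) C" .
  qed auto
  have gd: "g \<in> borel_measurable (distr A (?PS \<Otimes>\<^sub>M ?PS) f)" for A :: "(real \<Rightarrow> real) measure" and f
    unfolding measurable_distr_eq1 by (rule g)
  have "(\<integral>\<^sup>+w. g (path_stop I (\<tau> w) w, path_shift I (\<tau> w) w) \<partial>?M) = (\<integral>\<^sup>+z. g z \<partial>M1)"
    unfolding M1_def by (rule nn_integral_distr[OF measurable_Pair[OF stop shift] gd, symmetric])
  also have "\<dots> = (\<integral>\<^sup>+w. \<integral>\<^sup>+z. g z \<partial>N w \<partial>?M)"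
    unfolding \<open>M1 = ?M \<bind> N\<close> by (rule nn_integral_bind[OF g N])
  also have "\<dots> = (\<integral>\<^sup>+w. \<integral>\<^sup>+w'. g (path_stop I (\<tau> w) w, w') \<partial>K w \<partial>?M)"
  proof (rule nn_integral_cong)
    fix w assume w: "w \<in> space ?M"
    show "(\<integral>\<^sup>+z. g z \<partial>N w) = (\<integral>\<^sup>+w'. g (path_stop I (\<tau> w) w, w') \<partial>K w)"
      unfolding N_def by (rule nn_integral_distr[OF pair[OF w] gd])
  qed
  finally show ?thesis unfolding K_def .
qed

text \<open>
  A path is recovered by glueing its shifted future to its stopped past, and \<open>\<tau>\<close> depends on the
  stopped past only.
\<close>

lemma resample_future:
  assumes x: "x \<in> S" and \<tau>: "past_determined \<tau>" and f: "f \<in> borel_measurable (path_space S I)"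
  shows "(\<integral>\<^sup>+w. f w \<partial>P 0 x) =
    (\<integral>\<^sup>+w. \<integral>\<^sup>+w'. f (path_glue I (\<tau> w) w w') \<partial>P (\<tau> w) (w (\<tau> w)) \<partial>P 0 x)"
proof -
  let ?PS = "path_space S I"
  note \<tau>D = past_determinedD[OF \<tau>]
  define g where "g z = f (path_glue I (\<tau> (fst z)) (fst z) (snd z))" for z
  have "(\<lambda>z. path_glue I (\<tau> (fst z)) (fst z) (snd z)) \<in> ?PS \<Otimes>\<^sub>M ?PS \<rightarrow>\<^sub>M ?PS"
    using \<tau>D(2) by (intro measurable_path_glue measurable_compose[OF measurable_fst \<tau>D(1)])
      (auto simp: space_pair_measure space_path_space)
  from measurable_compose[OF this f] have g: "g \<in> borel_measurable (?PS \<Otimes>\<^sub>M ?PS)"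
    unfolding g_def .
  have \<tau>stop: "\<tau> (path_stop I (\<tau> w) w) = \<tau> w" if "w \<in> skip_free_paths S I" for w
    using that \<tau>D(2) by (intro \<tau>D(3) path_stop_path path_agree_stop) auto
  have g1: "g (path_stop I (\<tau> w) w, path_shift I (\<tau> w) w) = f w" if w: "w \<in> skip_free_paths S I" for w
    using w \<tau>D(2)[OF w] \<tau>stop[OF w] join_stopped_shift[OF w \<tau>D(2)[OF w]]
    by (simp add: g_def path_glue_def path_stop_def path_shift_def)
  have g2: "g (path_stop I (\<tau> w) w, w') = f (path_glue I (\<tau> w) w w')" if w: "w \<in> skip_free_paths S I" for w w'
  proof -
    have "path_glue I (\<tau> w) (path_stop I (\<tau> w) w) w' = path_glue I (\<tau> w) w w'"
      using \<tau>D(2)[OF w] by (auto simp: path_glue_def path_stop_def path_join_def fun_eq_iff min_def)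
    then show ?thesis using \<tau>stop[OF w] by (simp add: g_def)
  qed
  have "(\<integral>\<^sup>+w. f w \<partial>P 0 x) = (\<integral>\<^sup>+w. g (path_stop I (\<tau> w) w, path_shift I (\<tau> w) w) \<partial>P 0 x)"
    using g1 x by (intro nn_integral_cong) (simp add: space_law)
  also have "\<dots> = (\<integral>\<^sup>+w. \<integral>\<^sup>+w'. g (path_stop I (\<tau> w) w, w') \<partial>P (\<tau> w) (w (\<tau> w)) \<partial>P 0 x)"
    by (rule strong_markov_stop_shift[OF x \<tau> g])
  also have "\<dots> = (\<integral>\<^sup>+w. \<integral>\<^sup>+w'. f (path_glue I (\<tau> w) w w') \<partial>P (\<tau> w) (w (\<tau> w)) \<partial>P 0 x)"
    using g2 x by (intro nn_integral_cong) (simp add: space_law)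
  finally show ?thesis .
qed

text \<open>
  If \<open>w\<close> is held fixed, \<open>\<lambda>v. \<tau> v w\<close> is a stopping time of \<open>v\<close> alone, so the future of \<open>v\<close> can be
  resampled; by Fubini's theorem the same holds afterwards with the roles exchanged. Resampling the
  future of \<open>w\<close> does not affect \<open>\<tau> v w\<close>, so both futures are resampled at the same time. In this way
  the strong Markov property of one copy suffices for two.
\<close>

lemma resample_pair_future:
  fixes \<tau> :: "(real \<Rightarrow> real) \<Rightarrow> (real \<Rightarrow> real) \<Rightarrow> real"
  assumes x: "x \<in> S" and y: "y \<in> S"
    and \<tau>: "(\<lambda>(v, w). \<tau> v w) \<in> borel_measurable (path_space S I \<Otimes>\<^sub>M path_space S I)"
    and \<tau>I: "\<And>v w. v \<in> skip_free_paths S I \<Longrightarrow> w \<in> skip_free_paths S I \<Longrightarrow> \<tau> v w \<in> I"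
    and past: "\<And>v w v' w'. v \<in> skip_free_paths S I \<Longrightarrow> w \<in> skip_free_paths S I \<Longrightarrow>
      v' \<in> skip_free_paths S I \<Longrightarrow> w' \<in> skip_free_paths S I \<Longrightarrow>
      path_agree I (\<tau> v w) v v' \<Longrightarrow> path_agree I (\<tau> v w) w w' \<Longrightarrow> \<tau> v' w' = \<tau> v w"
    and k: "(\<lambda>(v, w). k v w) \<in> borel_measurable (path_space S I \<Otimes>\<^sub>M path_space S I)"
  shows "(\<integral>\<^sup>+v. \<integral>\<^sup>+w. k v w \<partial>P 0 y \<partial>P 0 x) =
    (\<integral>\<^sup>+v. \<integral>\<^sup>+w. \<integral>\<^sup>+w'. \<integral>\<^sup>+v'. k (path_glue I (\<tau> v w) v v') (path_glue I (\<tau> v w) w w')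
      \<partial>P (\<tau> v w) (v (\<tau> v w)) \<partial>P (\<tau> v w) (w (\<tau> v w)) \<partial>P 0 y \<partial>P 0 x)"
proof -
  let ?PS = "path_space S I"
  interpret X: prob_space "P 0 x" using x by (simp add: prob_space_law)
  interpret Y: prob_space "P 0 y" using y by (simp add: prob_space_law)
  interpret XY: pair_sigma_finite "P 0 x" "P 0 y" ..
  have sets[measurable_cong]: "sets (P 0 x) = sets ?PS" "sets (P 0 y) = sets ?PS"
    using x y by (simp_all add: sets_law)
  have sp: "space (P 0 x) = skip_free_paths S I" "space (P 0 y) = skip_free_paths S I"
    using x y by (simp_all add: space_law)
  have agree: "path_agree I s v v" for s v by (simp add: path_agree_def)
  have pd1: "past_determined (\<lambda>v. \<tau> v w)" if w: "w \<in> skip_free_paths S I" for w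
    unfolding past_determined_def
  proof (intro conjI ballI impI)
    show "(\<lambda>v. \<tau> v w) \<in> borel_measurable ?PS"
      using measurable_compose[OF measurable_Pair2' \<tau>, of w] w by (simp add: space_path_space)
  qed (fact \<tau>I[OF _ w], rule past[OF _ w _ w _ agree])
  have pd2: "past_determined (\<lambda>w. \<tau> v w)" if v: "v \<in> skip_free_paths S I" for v
    unfolding past_determined_def
  proof (intro conjI ballI impI)
    show "(\<lambda>w. \<tau> v w) \<in> borel_measurable ?PS"
      using measurable_compose[OF measurable_Pair1' \<tau>, of v] v by (simp add: space_path_space)
  qed (fact \<tau>I[OF v], rule past[OF v _ v _ agree])
  define F where "F v w = (\<integral>\<^sup>+v'. k (path_glue I (\<tau> v w) v v') w \<partial>P (\<tau> v w) (v (\<tau> v w)))" for v w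
  have F: "(\<lambda>(v, w). F v w) \<in> borel_measurable (?PS \<Otimes>\<^sub>M ?PS)"
  proof -
    have fst: "(\<lambda>z. fst (fst z)) \<in> (?PS \<Otimes>\<^sub>M ?PS) \<Otimes>\<^sub>M ?PS \<rightarrow>\<^sub>M ?PS"
      and snd: "(\<lambda>z. snd (fst z)) \<in> (?PS \<Otimes>\<^sub>M ?PS) \<Otimes>\<^sub>M ?PS \<rightarrow>\<^sub>M ?PS"
      by measurable
    have t: "(\<lambda>z. \<tau> (fst z) (snd z)) \<in> borel_measurable (?PS \<Otimes>\<^sub>M ?PS)"
      using \<tau> by (simp add: split_beta')
    have t': "(\<lambda>z. \<tau> (fst (fst z)) (snd (fst z))) \<in> borel_measurable ((?PS \<Otimes>\<^sub>M ?PS) \<Otimes>\<^sub>M ?PS)"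
      by (rule measurable_compose[OF measurable_fst t])
    have "(\<lambda>z. path_glue I (\<tau> (fst (fst z)) (snd (fst z))) (fst (fst z)) (snd z)) \<in> (?PS \<Otimes>\<^sub>M ?PS) \<Otimes>\<^sub>M ?PS \<rightarrow>\<^sub>M ?PS"
      using \<tau>I by (intro measurable_path_glue fst measurable_snd t') (auto simp: space_pair_measure space_path_space)
    from measurable_compose[OF measurable_Pair[OF this snd] k]
    have k': "(\<lambda>(z, v'). k (path_glue I (\<tau> (fst z) (snd z)) (fst z) v') (snd z)) \<in> borel_measurable ((?PS \<Otimes>\<^sub>M ?PS) \<Otimes>\<^sub>M ?PS)"
      by (simp add: split_beta')
    have "(\<lambda>z. P (\<tau> (fst z) (snd z)) (fst z (\<tau> (fst z) (snd z)))) \<in> ?PS \<Otimes>\<^sub>M ?PS \<rightarrow>\<^sub>M subprob_algebra ?PS"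
      using \<tau>I by (intro measurable_law_subprob t measurable_path_eval[OF measurable_fst t])
        (auto simp: space_pair_measure space_path_space intro: path_in_states)
    from nn_integral_measurable_subprob_algebra2[OF k' this]
    show ?thesis by (simp add: F_def split_beta')
  qed
  have "(\<integral>\<^sup>+v. \<integral>\<^sup>+w. k v w \<partial>P 0 y \<partial>P 0 x) = (\<integral>\<^sup>+w. \<integral>\<^sup>+v. k v w \<partial>P 0 x \<partial>P 0 y)"
    using k by (intro XY.Fubini'[symmetric]) simp
  also have "\<dots> = (\<integral>\<^sup>+w. \<integral>\<^sup>+v. F v w \<partial>P 0 x \<partial>P 0 y)"
  proof (rule nn_integral_cong)
    fix w assume "w \<in> space (P 0 y)"
    then have w: "w \<in> skip_free_paths S I" by (simp add: sp)
    have "(\<lambda>v. k v w) \<in> borel_measurable ?PS"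
      using measurable_compose[OF measurable_Pair2' k, of w] w by (simp add: space_path_space)
    then show "(\<integral>\<^sup>+v. k v w \<partial>P 0 x) = (\<integral>\<^sup>+v. F v w \<partial>P 0 x)"
      unfolding F_def by (rule resample_future[OF x pd1[OF w]])
  qed
  also have "\<dots> = (\<integral>\<^sup>+v. \<integral>\<^sup>+w. F v w \<partial>P 0 y \<partial>P 0 x)"
    using F by (intro XY.Fubini') simp
  also have "\<dots> = (\<integral>\<^sup>+v. \<integral>\<^sup>+w. \<integral>\<^sup>+w'. F v (path_glue I (\<tau> v w) w w') \<partial>P (\<tau> v w) (w (\<tau> v w)) \<partial>P 0 y \<partial>P 0 x)"
  proof (rule nn_integral_cong)
    fix v assume "v \<in> space (P 0 x)"
    then have v: "v \<in> skip_free_paths S I" by (simp add: sp)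
    have "(\<lambda>w. F v w) \<in> borel_measurable ?PS"
      using measurable_compose[OF measurable_Pair1' F, of v] v by (simp add: space_path_space)
    then show "(\<integral>\<^sup>+w. F v w \<partial>P 0 y) =
        (\<integral>\<^sup>+w. \<integral>\<^sup>+w'. F v (path_glue I (\<tau> v w) w w') \<partial>P (\<tau> v w) (w (\<tau> v w)) \<partial>P 0 y)"
      by (rule resample_future[OF y pd2[OF v]])
  qed
  also have "\<dots> = (\<integral>\<^sup>+v. \<integral>\<^sup>+w. \<integral>\<^sup>+w'. \<integral>\<^sup>+v'. k (path_glue I (\<tau> v w) v v') (path_glue I (\<tau> v w) w w')
      \<partial>P (\<tau> v w) (v (\<tau> v w)) \<partial>P (\<tau> v w) (w (\<tau> v w)) \<partial>P 0 y \<partial>P 0 x)"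
  proof (intro nn_integral_cong)
    fix v w w' assume "v \<in> space (P 0 x)" "w \<in> space (P 0 y)" "w' \<in> space (P (\<tau> v w) (w (\<tau> v w)))"
    then have p: "v \<in> skip_free_paths S I" "w \<in> skip_free_paths S I" "w' \<in> skip_free_paths S I"
      using \<tau>I path_in_states by (auto simp: sp space_law)
    have "\<tau> v (path_glue I (\<tau> v w) w w') = \<tau> v w"
      using p \<tau>I[OF p(1,2)] by (intro past path_glue_path agree path_agree_glue)
    then show "F v (path_glue I (\<tau> v w) w w') = (\<integral>\<^sup>+v'. k (path_glue I (\<tau> v w) v v') (path_glue I (\<tau> v w) w w')
      \<partial>P (\<tau> v w) (v (\<tau> v w)))" by (simp add: F_def)
  qed
  finally show ?thesis .
qed

text \<open>
  After resampling, the two futures are independent with the laws \<open>P s (v s)\<close> and \<open>P s (w s)\<close>, where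
  \<open>s = \<tau> v w\<close>. These laws are the same if the paths meet at time \<open>s\<close>, so the futures may be
  exchanged by Fubini's theorem.
\<close>

lemma pair_swap_future:
  fixes \<tau> :: "(real \<Rightarrow> real) \<Rightarrow> (real \<Rightarrow> real) \<Rightarrow> real" and D :: "((real \<Rightarrow> real) \<times> (real \<Rightarrow> real)) set"
  assumes x: "x \<in> S" and y: "y \<in> S"
    and \<tau>: "(\<lambda>(v, w). \<tau> v w) \<in> borel_measurable (path_space S I \<Otimes>\<^sub>M path_space S I)"
    and \<tau>I: "\<And>v w. v \<in> skip_free_paths S I \<Longrightarrow> w \<in> skip_free_paths S I \<Longrightarrow> \<tau> v w \<in> I"
    and past: "\<And>v w v' w'. v \<in> skip_free_paths S I \<Longrightarrow> w \<in> skip_free_paths S I \<Longrightarrow>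
      v' \<in> skip_free_paths S I \<Longrightarrow> w' \<in> skip_free_paths S I \<Longrightarrow>
      path_agree I (\<tau> v w) v v' \<Longrightarrow> path_agree I (\<tau> v w) w w' \<Longrightarrow>
      \<tau> v' w' = \<tau> v w \<and> ((v, w) \<in> D \<longrightarrow> (v', w') \<in> D)"
    and D: "D \<in> sets (path_space S I \<Otimes>\<^sub>M path_space S I)"
    and meet: "\<And>v w. (v, w) \<in> D \<Longrightarrow> v (\<tau> v w) = w (\<tau> v w)"
    and h: "(\<lambda>(v, w). h v w) \<in> borel_measurable (path_space S I \<Otimes>\<^sub>M path_space S I)"
  shows "(\<integral>\<^sup>+v. \<integral>\<^sup>+w. (if (v, w) \<in> D then h (path_switch I (\<tau> v w) v w) (path_switch I (\<tau> v w) w v) else h v w)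
      \<partial>P 0 y \<partial>P 0 x) = (\<integral>\<^sup>+v. \<integral>\<^sup>+w. h v w \<partial>P 0 y \<partial>P 0 x)"
proof -
  let ?PS = "path_space S I" and ?\<Omega> = "skip_free_paths S I"
  define k where "k v w = (if (v, w) \<in> D then h (path_switch I (\<tau> v w) v w) (path_switch I (\<tau> v w) w v) else h v w)" for v w
  have Dsub: "v \<in> ?\<Omega>" "w \<in> ?\<Omega>" if "(v, w) \<in> D" for v w
    using sets.sets_into_space[OF D] that by (auto simp: space_pair_measure space_path_space)
  have k: "(\<lambda>(v, w). k v w) \<in> borel_measurable (?PS \<Otimes>\<^sub>M ?PS)"
  proof -
    have t: "(\<lambda>z. \<tau> (fst z) (snd z)) \<in> borel_measurable (?PS \<Otimes>\<^sub>M ?PS)"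
      using \<tau> by (simp add: split_beta')
    have D': "Measurable.pred (?PS \<Otimes>\<^sub>M ?PS) (\<lambda>z. (fst z, snd z) \<in> D)" using D by simp
    have a: "(\<lambda>z. if (fst z, snd z) \<in> D then path_switch I (\<tau> (fst z) (snd z)) (fst z) (snd z) else fst z) \<in> ?PS \<Otimes>\<^sub>M ?PS \<rightarrow>\<^sub>M ?PS"
    proof (rule measurable_path_if[OF D'])
      show "(if (fst z, snd z) \<in> D then path_switch I (\<tau> (fst z) (snd z)) (fst z) (snd z) else fst z) \<in> ?\<Omega>"
        if "z \<in> space (?PS \<Otimes>\<^sub>M ?PS)" for z
        using that \<tau>I[of "fst z" "snd z"] meet[of "fst z" "snd z"]
        by (auto simp: space_pair_measure space_path_space mem_Times_iff intro!: path_switch_path)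
    next
      fix u assume u: "u \<in> I"
      show "(\<lambda>z. path_switch I (\<tau> (fst z) (snd z)) (fst z) (snd z) u) \<in> borel_measurable (?PS \<Otimes>\<^sub>M ?PS)"
        by (rule measurable_switch_coordinate[OF measurable_fst measurable_snd t u])
      show "(\<lambda>z. fst z u) \<in> borel_measurable (?PS \<Otimes>\<^sub>M ?PS)"
        by (rule measurable_path_component[OF measurable_fst u])
    qed
    have b: "(\<lambda>z. if (fst z, snd z) \<in> D then path_switch I (\<tau> (fst z) (snd z)) (snd z) (fst z) else snd z) \<in> ?PS \<Otimes>\<^sub>M ?PS \<rightarrow>\<^sub>M ?PS"
    proof (rule measurable_path_if[OF D'])
      show "(if (fst z, snd z) \<in> D then path_switch I (\<tau> (fst z) (snd z)) (snd z) (fst z) else snd z) \<in> ?\<Omega>"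
        if "z \<in> space (?PS \<Otimes>\<^sub>M ?PS)" for z
        using that \<tau>I[of "fst z" "snd z"] meet[of "fst z" "snd z"]
        by (auto simp: space_pair_measure space_path_space mem_Times_iff intro!: path_switch_path)
    next
      fix u assume u: "u \<in> I"
      show "(\<lambda>z. path_switch I (\<tau> (fst z) (snd z)) (snd z) (fst z) u) \<in> borel_measurable (?PS \<Otimes>\<^sub>M ?PS)"
        by (rule measurable_switch_coordinate[OF measurable_snd measurable_fst t u])
      show "(\<lambda>z. snd z u) \<in> borel_measurable (?PS \<Otimes>\<^sub>M ?PS)"
        by (rule measurable_path_component[OF measurable_snd u])
    qed
    have "(\<lambda>(v, w). k v w) = (\<lambda>z. case
        (if (fst z, snd z) \<in> D then path_switch I (\<tau> (fst z) (snd z)) (fst z) (snd z) else fst z,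
         if (fst z, snd z) \<in> D then path_switch I (\<tau> (fst z) (snd z)) (snd z) (fst z) else snd z) of (v, w) \<Rightarrow> h v w)"
      by (auto simp: k_def fun_eq_iff)
    then show ?thesis using measurable_compose[OF measurable_Pair[OF a b] h] by (simp only:)
  qed
  note past1 = past[THEN conjunct1]
  have "(\<integral>\<^sup>+v. \<integral>\<^sup>+w. k v w \<partial>P 0 y \<partial>P 0 x) =
    (\<integral>\<^sup>+v. \<integral>\<^sup>+w. \<integral>\<^sup>+w'. \<integral>\<^sup>+v'. k (path_glue I (\<tau> v w) v v') (path_glue I (\<tau> v w) w w')
      \<partial>P (\<tau> v w) (v (\<tau> v w)) \<partial>P (\<tau> v w) (w (\<tau> v w)) \<partial>P 0 y \<partial>P 0 x)"
    by (rule resample_pair_future[OF x y \<tau> \<tau>I past1 k])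
  also have "\<dots> = (\<integral>\<^sup>+v. \<integral>\<^sup>+w. \<integral>\<^sup>+w'. \<integral>\<^sup>+v'. h (path_glue I (\<tau> v w) v v') (path_glue I (\<tau> v w) w w')
      \<partial>P (\<tau> v w) (v (\<tau> v w)) \<partial>P (\<tau> v w) (w (\<tau> v w)) \<partial>P 0 y \<partial>P 0 x)"
  proof (rule nn_integral_cong, rule nn_integral_cong)
    fix v w assume "v \<in> space (P 0 x)" "w \<in> space (P 0 y)"
    then have v: "v \<in> ?\<Omega>" and w: "w \<in> ?\<Omega>" using x y by (simp_all add: space_law)
    define s where "s = \<tau> v w"
    have s: "s \<in> I" using \<tau>I[OF v w] by (simp add: s_def)
    have glue: "path_glue I s u u' \<in> ?\<Omega>" "path_agree I s u (path_glue I s u u')" "path_agree I s (path_glue I s u u') u"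
      if "u \<in> ?\<Omega>" "u' \<in> ?\<Omega>" for u u'
      using path_glue_path[OF that s] path_agree_glue[OF s, of u u'] by (auto simp: path_agree_def)
    have glue_\<tau>: "\<tau> (path_glue I s v v') (path_glue I s w w') = s"
      and glue_D: "(path_glue I s v v', path_glue I s w w') \<in> D \<longleftrightarrow> (v, w) \<in> D"
      if "v' \<in> ?\<Omega>" "w' \<in> ?\<Omega>" for v' w'
    proof -
      note g = glue[OF v that(1)] glue[OF w that(2)]
      have f: "\<tau> (path_glue I s v v') (path_glue I s w w') = s \<and>
          ((v, w) \<in> D \<longrightarrow> (path_glue I s v v', path_glue I s w w') \<in> D)"
        by (rule past[OF v w g(1,4), folded s_def, OF g(2,5)])
      then show t: "\<tau> (path_glue I s v v') (path_glue I s w w') = s" by blast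
      show "(path_glue I s v v', path_glue I s w w') \<in> D \<longleftrightarrow> (v, w) \<in> D"
        using f past[OF g(1,4) v w, unfolded t, OF g(3,6)] by blast
    qed
    show "(\<integral>\<^sup>+w'. \<integral>\<^sup>+v'. k (path_glue I (\<tau> v w) v v') (path_glue I (\<tau> v w) w w')
        \<partial>P (\<tau> v w) (v (\<tau> v w)) \<partial>P (\<tau> v w) (w (\<tau> v w))) =
      (\<integral>\<^sup>+w'. \<integral>\<^sup>+v'. h (path_glue I (\<tau> v w) v v') (path_glue I (\<tau> v w) w w')
        \<partial>P (\<tau> v w) (v (\<tau> v w)) \<partial>P (\<tau> v w) (w (\<tau> v w)))"
      unfolding s_def[symmetric]
    proof (cases "(v, w) \<in> D")
      case False
      show "(\<integral>\<^sup>+w'. \<integral>\<^sup>+v'. k (path_glue I s v v') (path_glue I s w w') \<partial>P s (v s) \<partial>P s (w s)) =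
        (\<integral>\<^sup>+w'. \<integral>\<^sup>+v'. h (path_glue I s v v') (path_glue I s w w') \<partial>P s (v s) \<partial>P s (w s))"
      proof (intro nn_integral_cong)
        fix w' v' assume "w' \<in> space (P s (w s))" "v' \<in> space (P s (v s))"
        then have "v' \<in> ?\<Omega>" "w' \<in> ?\<Omega>" using s v w path_in_states by (simp_all add: space_law)
        then show "k (path_glue I s v v') (path_glue I s w w') = h (path_glue I s v v') (path_glue I s w w')"
          using False by (simp add: k_def glue_D)
      qed
    next
      case True
      define z where "z = v s"
      have z: "v s = z" "w s = z" "z \<in> S" 
        using meet[OF True] path_in_states[OF v s] by (simp_all add: z_def s_def)
      interpret Z: prob_space "P s z" using s z by (simp add: prob_space_law)
      interpret ZZ: pair_sigma_finite "P s z" "P s z" ..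
      have ae: "AE u in P s z. u 0 = z" by (rule start[OF s z(3)])
      have spz: "space (P s z) = ?\<Omega>" and sez: "sets (P s z) = sets ?PS"
        using s z by (simp_all add: space_law sets_law)
      \<comment> \<open>Switching between the glued paths at time \<open>s\<close> is glueing with exchanged futures. This needs
        futures that start at the common position \<open>z\<close>, as they do almost surely.\<close>
      have key: "k (path_glue I s v v') (path_glue I s w w') = h (path_glue I s v w') (path_glue I s w v')"
        if p: "v' \<in> ?\<Omega>" "w' \<in> ?\<Omega>" "v' 0 = z" "w' 0 = z" for v' w'
      proof -
        have "path_switch I s (path_glue I s v v') (path_glue I s w w') = path_glue I s v w'"
          "path_switch I s (path_glue I s w w') (path_glue I s v v') = path_glue I s w v'"
          by (simp_all add: path_glue_def p(3,4) z path_join_def path_switch_def fun_eq_iff)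
        then show ?thesis using True by (simp add: k_def glue_D[OF p(1,2)] glue_\<tau>[OF p(1,2)])
      qed
      have "(\<integral>\<^sup>+w'. \<integral>\<^sup>+v'. k (path_glue I s v v') (path_glue I s w w') \<partial>P s z \<partial>P s z) =
        (\<integral>\<^sup>+w'. \<integral>\<^sup>+v'. h (path_glue I s v w') (path_glue I s w v') \<partial>P s z \<partial>P s z)"
      proof (rule nn_integral_cong_AE[OF AE_mp[OF ae AE_I2]], rule impI)
        fix w' assume w': "w' \<in> space (P s z)" "w' 0 = z"
        show "(\<integral>\<^sup>+v'. k (path_glue I s v v') (path_glue I s w w') \<partial>P s z) =
          (\<integral>\<^sup>+v'. h (path_glue I s v w') (path_glue I s w v') \<partial>P s z)"
        proof (rule nn_integral_cong_AE[OF AE_mp[OF ae AE_I2]], rule impI)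
          fix v' assume v': "v' \<in> space (P s z)" "v' 0 = z"
          show "k (path_glue I s v v') (path_glue I s w w') = h (path_glue I s v w') (path_glue I s w v')"
            using w' v' by (intro key) (simp_all add: spz)
        qed
      qed
      also have "\<dots> = (\<integral>\<^sup>+v'. \<integral>\<^sup>+w'. h (path_glue I s v w') (path_glue I s w v') \<partial>P s z \<partial>P s z)"
      proof (rule ZZ.Fubini')
        have a: "(\<lambda>q. path_glue I s v (snd q)) \<in> ?PS \<Otimes>\<^sub>M ?PS \<rightarrow>\<^sub>M ?PS"
          by (rule measurable_path_glue[OF measurable_const measurable_snd measurable_const])
            (simp_all add: space_path_space v s)
        have b: "(\<lambda>q. path_glue I s w (fst q)) \<in> ?PS \<Otimes>\<^sub>M ?PS \<rightarrow>\<^sub>M ?PS"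
          by (rule measurable_path_glue[OF measurable_const measurable_fst measurable_const])
            (simp_all add: space_path_space w s)
        have c: "borel_measurable (P s z \<Otimes>\<^sub>M P s z) = borel_measurable (?PS \<Otimes>\<^sub>M ?PS)"
          by (rule measurable_cong_sets[OF sets_pair_measure_cong[OF sez sez] refl])
        show "(\<lambda>(v', w'). h (path_glue I s v w') (path_glue I s w v')) \<in> borel_measurable (P s z \<Otimes>\<^sub>M P s z)"
          using measurable_compose[OF measurable_Pair[OF a b] h]
          by (simp only: c split_beta' prod.case fst_conv snd_conv)
      qed
      finally show "(\<integral>\<^sup>+w'. \<integral>\<^sup>+v'. k (path_glue I s v v') (path_glue I s w w') \<partial>P s (v s) \<partial>P s (w s)) =
        (\<integral>\<^sup>+w'. \<integral>\<^sup>+v'. h (path_glue I s v v') (path_glue I s w w') \<partial>P s (v s) \<partial>P s (w s))"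
        by (simp only: z)
    qed
  qed
  also have "\<dots> = (\<integral>\<^sup>+v. \<integral>\<^sup>+w. h v w \<partial>P 0 y \<partial>P 0 x)"
    by (rule resample_pair_future[OF x y \<tau> \<tau>I past1 h, symmetric])
  finally show ?thesis unfolding k_def .
qed

end

section \<open>Exchanging the futures of two among finitely many copies\<close>

definition swap_futures ::
  "real set \<Rightarrow> nat \<Rightarrow> nat \<Rightarrow> ((nat \<Rightarrow> real \<Rightarrow> real) \<Rightarrow> real) \<Rightarrow> (nat \<Rightarrow> real \<Rightarrow> real) set \<Rightarrow>
    (nat \<Rightarrow> real \<Rightarrow> real) \<Rightarrow> nat \<Rightarrow> real \<Rightarrow> real" where
  "swap_futures I j k \<tau> D w = (if w \<in> D
     then w(j := path_switch I (\<tau> w) (w j) (w k), k := path_switch I (\<tau> w) (w k) (w j)) else w)"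

context skip_free_process
begin

definition paths_upto :: "nat \<Rightarrow> (nat \<Rightarrow> real \<Rightarrow> real) set" where
  "paths_upto N = (\<Pi>\<^sub>E i\<in>{..<N}. skip_free_paths S I)"

lemma space_paths: "space (\<Pi>\<^sub>M i\<in>{..<N}. path_space S I) = paths_upto N"
  by (simp add: space_PiM space_path_space paths_upto_def)

lemma paths_upto_path: "w \<in> paths_upto N \<Longrightarrow> i < N \<Longrightarrow> w i \<in> skip_free_paths S I"
  by (auto simp: paths_upto_def)

lemma paths_upto_upd:
  "w \<in> paths_upto N \<Longrightarrow> i < N \<Longrightarrow> v \<in> skip_free_paths S I \<Longrightarrow> w(i := v) \<in> paths_upto N"
  by (auto simp: paths_upto_def PiE_iff extensional_def)

lemma measurable_swap_futures:
  assumes jk: "j < N" "k < N" "j \<noteq> k"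
    and \<tau>: "\<tau> \<in> borel_measurable (\<Pi>\<^sub>M i\<in>{..<N}. path_space S I)" "\<And>w. w \<in> paths_upto N \<Longrightarrow> \<tau> w \<in> I"
    and D: "D \<in> sets (\<Pi>\<^sub>M i\<in>{..<N}. path_space S I)"
    and meet: "\<And>w. w \<in> D \<Longrightarrow> w j (\<tau> w) = w k (\<tau> w)"
  shows "swap_futures I j k \<tau> D \<in> (\<Pi>\<^sub>M i\<in>{..<N}. path_space S I) \<rightarrow>\<^sub>M (\<Pi>\<^sub>M i\<in>{..<N}. path_space S I)"
proof -
  let ?M = "\<Pi>\<^sub>M i\<in>{..<N}. path_space S I"
  have Dsub: "D \<subseteq> paths_upto N" using sets.sets_into_space[OF D] by (simp add: space_paths)
  have comp: "(\<lambda>w. w i) \<in> ?M \<rightarrow>\<^sub>M path_space S I" if "i < N" for i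
    using that by (intro measurable_component_singleton) simp
  have D': "Measurable.pred ?M (\<lambda>w. w \<in> D)" using D by simp
  have sw: "(\<lambda>w. if w \<in> D then path_switch I (\<tau> w) (w a) (w b) else w a) \<in> ?M \<rightarrow>\<^sub>M path_space S I"
    if ab: "a < N" "b < N" "{a, b} = {j, k}" for a b
  proof (rule measurable_path_if[OF D'])
    fix w assume w: "w \<in> space ?M"
    then have p: "w \<in> paths_upto N" by (simp add: space_paths)
    show "(if w \<in> D then path_switch I (\<tau> w) (w a) (w b) else w a) \<in> skip_free_paths S I"
      using meet[of w] ab paths_upto_path[OF p] \<tau>(2)[OF p]
      by (auto simp: doubleton_eq_iff intro!: path_switch_path)
  next
    fix t assume t: "t \<in> I"
    show "(\<lambda>w. path_switch I (\<tau> w) (w a) (w b) t) \<in> borel_measurable ?M"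
      by (rule measurable_switch_coordinate[OF comp[OF ab(1)] comp[OF ab(2)] \<tau>(1) t])
    show "(\<lambda>w. w a t) \<in> borel_measurable ?M" by (rule measurable_path_component[OF comp[OF ab(1)] t])
  qed
  have range: "swap_futures I j k \<tau> D w \<in> paths_upto N" if w: "w \<in> paths_upto N" for w
    using meet[of w] paths_upto_path[OF w] \<tau>(2)[OF w] jk w
    by (auto simp: swap_futures_def intro!: paths_upto_upd path_switch_path)
  have "(\<lambda>w. \<lambda>i\<in>{..<N}. swap_futures I j k \<tau> D w i) \<in> ?M \<rightarrow>\<^sub>M ?M"
  proof (rule measurable_restrict)
    fix i assume i: "i \<in> {..<N}"
    consider "i = j" | "i = k" | "i \<noteq> j" "i \<noteq> k" by blast
    then show "(\<lambda>w. swap_futures I j k \<tau> D w i) \<in> ?M \<rightarrow>\<^sub>M path_space S I"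
    proof cases
      case 1
      have "(\<lambda>w. swap_futures I j k \<tau> D w i) = (\<lambda>w. if w \<in> D then path_switch I (\<tau> w) (w j) (w k) else w j)"
        using 1 jk by (auto simp: swap_futures_def)
      then show ?thesis using sw[OF jk(1,2)] by simp
    next
      case 2
      have "(\<lambda>w. swap_futures I j k \<tau> D w i) = (\<lambda>w. if w \<in> D then path_switch I (\<tau> w) (w k) (w j) else w k)"
        using 2 jk by (auto simp: swap_futures_def)
      then show ?thesis using sw[OF jk(2,1)] by (simp add: insert_commute)
    next
      case 3
      have "(\<lambda>w. swap_futures I j k \<tau> D w i) = (\<lambda>w. w i)"
        using 3 by (auto simp: swap_futures_def)
      then show ?thesis using comp i by simp
    qed
  qed
  then show ?thesis
    by (rule measurable_cong[THEN iffD1, rotated])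
      (simp add: space_paths PiE_restrict[OF range[unfolded paths_upto_def]] paths_upto_def)
qed

lemma product_nn_integral_two:
  fixes x :: "nat \<Rightarrow> real"
  assumes x: "\<And>i. x i \<in> S" and jk: "j < N" "k < N" "j \<noteq> k"
    and h: "h \<in> borel_measurable (\<Pi>\<^sub>M i\<in>{..<N}. path_space S I)"
  shows "(\<integral>\<^sup>+w. h w \<partial>(\<Pi>\<^sub>M i\<in>{..<N}. P 0 (x i))) =
    (\<integral>\<^sup>+z. \<integral>\<^sup>+w. \<integral>\<^sup>+v. h (z(k := w, j := v)) \<partial>P 0 (x j) \<partial>P 0 (x k) \<partial>(\<Pi>\<^sub>M i\<in>{..<N} - {j, k}. P 0 (x i)))"
proof -
  interpret product_sigma_finite "\<lambda>i. P 0 (x i)"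
    using x by (auto intro!: product_sigma_finite.intro prob_space_imp_sigma_finite prob_space_law)
  let ?R = "{..<N} - {j, k}"
  have eq: "{..<N} = insert j (insert k ?R)" using jk by auto
  have sets: "sets (\<Pi>\<^sub>M i\<in>A. path_space S I) = sets (\<Pi>\<^sub>M i\<in>A. P 0 (x i))" for A
    using x by (intro sets_PiM_cong) (simp_all add: sets_law)
  have h': "h \<in> borel_measurable (\<Pi>\<^sub>M i\<in>insert j (insert k ?R). P 0 (x i))"
    using h unfolding eq[symmetric] measurable_cong_sets[OF sets refl] .
  have "(\<integral>\<^sup>+w. h w \<partial>(\<Pi>\<^sub>M i\<in>{..<N}. P 0 (x i))) = (\<integral>\<^sup>+w. h w \<partial>(\<Pi>\<^sub>M i\<in>insert j (insert k ?R). P 0 (x i)))"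
    by (simp only: eq[symmetric])
  also have "\<dots> = (\<integral>\<^sup>+z. \<integral>\<^sup>+v. h (z(j := v)) \<partial>P 0 (x j) \<partial>(\<Pi>\<^sub>M i\<in>insert k ?R. P 0 (x i)))"
    using jk by (intro product_nn_integral_insert h') auto
  also have "\<dots> = (\<integral>\<^sup>+z. \<integral>\<^sup>+w. \<integral>\<^sup>+v. h (z(k := w, j := v)) \<partial>P 0 (x j) \<partial>P 0 (x k) \<partial>(\<Pi>\<^sub>M i\<in>?R. P 0 (x i)))"
  proof (rule product_nn_integral_insert)
    have "(\<lambda>(z, v). h (z(j := v))) \<in> borel_measurable ((\<Pi>\<^sub>M i\<in>insert k ?R. P 0 (x i)) \<Otimes>\<^sub>M P 0 (x j))"
      using measurable_compose[OF measurable_add_dim h'] by (simp add: split_beta')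
    then show "(\<lambda>z. \<integral>\<^sup>+v. h (z(j := v)) \<partial>P 0 (x j)) \<in> borel_measurable (\<Pi>\<^sub>M i\<in>insert k ?R. P 0 (x i))"
      by (rule M.borel_measurable_nn_integral)
  qed auto
  finally show ?thesis .
qed

text \<open>
  All copies except \<open>j\<close> and \<open>k\<close> are held fixed; then \<open>\<tau>\<close> and \<open>D\<close> are determined by the past of the
  two remaining copies, and \<open>pair_swap_future\<close> applies.
\<close>

lemma swap_futures_invariant:
  fixes x :: "nat \<Rightarrow> real" and \<tau> :: "(nat \<Rightarrow> real \<Rightarrow> real) \<Rightarrow> real"
  assumes x: "\<And>i. x i \<in> S" and jk: "j < N" "k < N" "j \<noteq> k"
    and \<tau>: "\<tau> \<in> borel_measurable (\<Pi>\<^sub>M i\<in>{..<N}. path_space S I)" "\<And>w. w \<in> paths_upto N \<Longrightarrow> \<tau> w \<in> I"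
    and past: "\<And>w w'. w \<in> paths_upto N \<Longrightarrow> w' \<in> paths_upto N \<Longrightarrow>
      (\<And>i. i < N \<Longrightarrow> path_agree I (\<tau> w) (w i) (w' i)) \<Longrightarrow> \<tau> w' = \<tau> w \<and> (w \<in> D \<longrightarrow> w' \<in> D)"
    and D: "D \<in> sets (\<Pi>\<^sub>M i\<in>{..<N}. path_space S I)"
    and meet: "\<And>w. w \<in> D \<Longrightarrow> w j (\<tau> w) = w k (\<tau> w)"
    and h: "h \<in> borel_measurable (\<Pi>\<^sub>M i\<in>{..<N}. path_space S I)"
  shows "(\<integral>\<^sup>+w. h (swap_futures I j k \<tau> D w) \<partial>(\<Pi>\<^sub>M i\<in>{..<N}. P 0 (x i))) =
    (\<integral>\<^sup>+w. h w \<partial>(\<Pi>\<^sub>M i\<in>{..<N}. P 0 (x i)))"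
proof -
  let ?M = "\<Pi>\<^sub>M i\<in>{..<N}. path_space S I" and ?R = "{..<N} - {j, k}" and ?PS = "path_space S I"
  have hs: "(\<lambda>w. h (swap_futures I j k \<tau> D w)) \<in> borel_measurable ?M"
    by (rule measurable_compose[OF measurable_swap_futures[OF jk \<tau>(1) _ D] h]) (fact \<tau>(2) meet)+
  have "(\<integral>\<^sup>+w. \<integral>\<^sup>+v. h (swap_futures I j k \<tau> D (z(k := w, j := v))) \<partial>P 0 (x j) \<partial>P 0 (x k)) =
      (\<integral>\<^sup>+w. \<integral>\<^sup>+v. h (z(k := w, j := v)) \<partial>P 0 (x j) \<partial>P 0 (x k))"
    if "z \<in> space (\<Pi>\<^sub>M i\<in>?R. P 0 (x i))" for z
  proof -
    have z: "z \<in> (\<Pi>\<^sub>E i\<in>?R. skip_free_paths S I)"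
      using that x by (simp add: space_PiM space_law)
    define u where "u w v = z(k := w, j := v)" for w v
    have u_path: "u w v \<in> paths_upto N" if "w \<in> skip_free_paths S I" "v \<in> skip_free_paths S I" for w v
      using z that jk by (auto simp: u_def paths_upto_def PiE_iff extensional_def)
    have u_meas: "(\<lambda>(w, v). u w v) \<in> ?PS \<Otimes>\<^sub>M ?PS \<rightarrow>\<^sub>M ?M"
    proof -
      have "(\<lambda>p. \<lambda>i\<in>{..<N}. u (fst p) (snd p) i) \<in> ?PS \<Otimes>\<^sub>M ?PS \<rightarrow>\<^sub>M ?M"
      proof (rule measurable_restrict)
        fix i assume i: "i \<in> {..<N}"
        consider "i = j" | "i = k" | "i \<in> ?R" using i by blast
        then show "(\<lambda>p. u (fst p) (snd p) i) \<in> ?PS \<Otimes>\<^sub>M ?PS \<rightarrow>\<^sub>M ?PS"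
        proof cases
          case 3
          then have "z i \<in> space ?PS" using z by (auto simp: space_path_space)
          then show ?thesis using 3 by (simp add: u_def)
        qed (use jk in \<open>simp_all add: u_def\<close>)
      qed
      then show ?thesis
        by (rule measurable_cong[THEN iffD1, rotated])
          (auto simp: space_pair_measure space_path_space PiE_restrict[OF u_path[unfolded paths_upto_def]])
    qed
    define D' where "D' = (\<lambda>(w, v). u w v) -` D \<inter> space (?PS \<Otimes>\<^sub>M ?PS)"
    have D': "(w, v) \<in> D' \<longleftrightarrow> u w v \<in> D" if "w \<in> skip_free_paths S I" "v \<in> skip_free_paths S I" for w v
      using that by (simp add: D'_def space_pair_measure space_path_space)
    have "(\<integral>\<^sup>+w. \<integral>\<^sup>+v. (if (w, v) \<in> D' then h (u (path_switch I (\<tau> (u w v)) w v) (path_switch I (\<tau> (u w v)) v w)) else h (u w v))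
        \<partial>P 0 (x j) \<partial>P 0 (x k)) = (\<integral>\<^sup>+w. \<integral>\<^sup>+v. h (u w v) \<partial>P 0 (x j) \<partial>P 0 (x k))"
    proof (rule pair_swap_future[OF x x])
      show "(\<lambda>(w, v). \<tau> (u w v)) \<in> borel_measurable (?PS \<Otimes>\<^sub>M ?PS)"
        using measurable_compose[OF u_meas \<tau>(1)] by (simp only: split_beta')
      show "(\<lambda>(w, v). h (u w v)) \<in> borel_measurable (?PS \<Otimes>\<^sub>M ?PS)"
        using measurable_compose[OF u_meas h] by (simp only: split_beta')
      show "D' \<in> sets (?PS \<Otimes>\<^sub>M ?PS)" unfolding D'_def by (rule measurable_sets[OF u_meas D])
      show "\<tau> (u w v) \<in> I" if "w \<in> skip_free_paths S I" "v \<in> skip_free_paths S I" for w v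
        by (rule \<tau>(2)[OF u_path[OF that]])
      show "w (\<tau> (u w v)) = v (\<tau> (u w v))" if "(w, v) \<in> D'" for w v
      proof -
        have "u w v \<in> D" using that by (simp add: D'_def)
        from meet[OF this] show ?thesis using jk by (simp add: u_def)
      qed
      fix w v w' v' assume p: "w \<in> skip_free_paths S I" "v \<in> skip_free_paths S I" "w' \<in> skip_free_paths S I" "v' \<in> skip_free_paths S I"
        and ag: "path_agree I (\<tau> (u w v)) w w'" "path_agree I (\<tau> (u w v)) v v'"
      have "path_agree I (\<tau> (u w v)) (u w v i) (u w' v' i)" for i
        using ag by (simp add: u_def path_agree_def)
      then have "\<tau> (u w' v') = \<tau> (u w v) \<and> (u w v \<in> D \<longrightarrow> u w' v' \<in> D)"
        by (rule past[OF u_path[OF p(1,2)] u_path[OF p(3,4)]])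
      then show "\<tau> (u w' v') = \<tau> (u w v) \<and> ((w, v) \<in> D' \<longrightarrow> (w', v') \<in> D')"
        using D'[OF p(1,2)] D'[OF p(3,4)] by blast
    qed
    moreover have "(\<integral>\<^sup>+w. \<integral>\<^sup>+v. h (swap_futures I j k \<tau> D (u w v)) \<partial>P 0 (x j) \<partial>P 0 (x k)) =
      (\<integral>\<^sup>+w. \<integral>\<^sup>+v. (if (w, v) \<in> D' then h (u (path_switch I (\<tau> (u w v)) w v) (path_switch I (\<tau> (u w v)) v w)) else h (u w v))
        \<partial>P 0 (x j) \<partial>P 0 (x k))"
    proof (rule nn_integral_cong, rule nn_integral_cong)
      fix w v assume "w \<in> space (P 0 (x k))" "v \<in> space (P 0 (x j))"
      then have p: "w \<in> skip_free_paths S I" "v \<in> skip_free_paths S I" using x by (simp_all add: space_law)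
      have "(u w v)(j := path_switch I (\<tau> (u w v)) (u w v j) (u w v k), k := path_switch I (\<tau> (u w v)) (u w v k) (u w v j)) =
          u (path_switch I (\<tau> (u w v)) w v) (path_switch I (\<tau> (u w v)) v w)"
        using jk by (auto simp: u_def)
      then show "h (swap_futures I j k \<tau> D (u w v)) =
        (if (w, v) \<in> D' then h (u (path_switch I (\<tau> (u w v)) w v) (path_switch I (\<tau> (u w v)) v w)) else h (u w v))"
        using D'[OF p] by (simp add: swap_futures_def)
    qed
    ultimately show ?thesis by (simp add: u_def)
  qed
  then show ?thesis
    unfolding product_nn_integral_two[OF x jk hs] product_nn_integral_two[OF x jk h]
    by (rule nn_integral_cong)
qed

lemma distr_swap_futures:
  fixes x :: "nat \<Rightarrow> real" and \<tau> :: "(nat \<Rightarrow> real \<Rightarrow> real) \<Rightarrow> real" and N :: nat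
  defines "Q \<equiv> \<Pi>\<^sub>M i\<in>{..<N}. P 0 (x i)" and "M \<equiv> \<Pi>\<^sub>M i\<in>{..<N}. path_space S I"
  assumes x: "\<And>i. x i \<in> S" and jk: "j < N" "k < N" "j \<noteq> k"
    and \<tau>: "\<tau> \<in> borel_measurable M" "\<And>w. w \<in> paths_upto N \<Longrightarrow> \<tau> w \<in> I"
    and past: "\<And>w w'. w \<in> paths_upto N \<Longrightarrow> w' \<in> paths_upto N \<Longrightarrow>
      (\<And>i. i < N \<Longrightarrow> path_agree I (\<tau> w) (w i) (w' i)) \<Longrightarrow> \<tau> w' = \<tau> w \<and> (w \<in> D \<longrightarrow> w' \<in> D)"
    and D: "D \<in> sets M" and meet: "\<And>w. w \<in> D \<Longrightarrow> w j (\<tau> w) = w k (\<tau> w)"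
  shows "distr Q M (swap_futures I j k \<tau> D) = Q"
proof (rule measure_eqI)
  have sQ: "sets Q = sets M" unfolding Q_def M_def using x by (intro sets_PiM_cong) (simp_all add: sets_law)
  then show "sets (distr Q M (swap_futures I j k \<tau> D)) = sets Q" by simp
  have meas: "swap_futures I j k \<tau> D \<in> Q \<rightarrow>\<^sub>M M"
    unfolding measurable_cong_sets[OF sQ refl]
    unfolding M_def by (rule measurable_swap_futures[OF jk \<tau>(1)[unfolded M_def] _ D[unfolded M_def]]) (fact \<tau>(2) meet)+
  fix A assume "A \<in> sets (distr Q M (swap_futures I j k \<tau> D))"
  then have A: "A \<in> sets M" by simp
  have "emeasure (distr Q M (swap_futures I j k \<tau> D)) A = (\<integral>\<^sup>+w. indicator A w \<partial>distr Q M (swap_futures I j k \<tau> D))"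
    using A by simp
  also have "\<dots> = (\<integral>\<^sup>+w. indicator A (swap_futures I j k \<tau> D w) \<partial>Q)"
    using A by (intro nn_integral_distr meas) simp
  also have "\<dots> = (\<integral>\<^sup>+w. indicator A w \<partial>Q)"
    unfolding Q_def
  proof (rule swap_futures_invariant[OF x jk \<tau>(1)[unfolded M_def] _ _ D[unfolded M_def]])
    show "\<tau> w \<in> I" if "w \<in> paths_upto N" for w using that by (rule \<tau>(2))
    show "\<tau> w' = \<tau> w \<and> (w \<in> D \<longrightarrow> w' \<in> D)"
      if "w \<in> paths_upto N" "w' \<in> paths_upto N" "\<And>i. i < N \<Longrightarrow> path_agree I (\<tau> w) (w i) (w' i)" for w w'
      using that by (rule past)
    show "w j (\<tau> w) = w k (\<tau> w)" if "w \<in> D" for w using that by (rule meet)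
    show "indicator A \<in> borel_measurable (\<Pi>\<^sub>M i\<in>{..<N}. path_space S I)" using A by (simp add: M_def)
  qed
  also have "\<dots> = emeasure Q A" using A sQ by simp
  finally show "emeasure (distr Q M (swap_futures I j k \<tau> D)) A = emeasure Q A" .
qed

end

section \<open>Coalescing one collision at a time\<close>

text \<open>
  The law of the copies is \<open>Q\<close>, a copy is a coordinate. Starting points may coincide, as \<open>b i\<close> may
  be equal to \<open>a (i + 1)\<close>.
\<close>

locale independent_copies = skip_free_process +
  fixes x :: "nat \<Rightarrow> real" and T :: real and n :: nat
  assumes states: "\<And>i. x i \<in> S" and increasing: "\<And>i j. i \<le> j \<Longrightarrow> x i \<le> x j"
    and time: "T \<in> I"
begin

abbreviation "N \<equiv> 2 * n"
abbreviation "\<Omega> \<equiv> \<Pi>\<^sub>M i\<in>{..<N}. path_space S I"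
abbreviation "Q \<equiv> \<Pi>\<^sub>M i\<in>{..<N}. P 0 (x i)"

lemma T_nonneg: "0 \<le> T"
  using time by (rule time_nonneg)

lemma sets_Q: "sets Q = sets \<Omega>"
  using states by (intro sets_PiM_cong) (simp_all add: sets_law)

lemma space_Q: "space Q = paths_upto N"
  using sets_eq_imp_space_eq[OF sets_Q] by (simp add: space_paths)

sublocale Q: prob_space Q
  using states by (intro prob_space_PiM prob_space_law) auto

lemma measurable_Q: "f \<in> Q \<rightarrow>\<^sub>M M \<longleftrightarrow> f \<in> \<Omega> \<rightarrow>\<^sub>M M"
  by (simp add: measurable_cong_sets[OF sets_Q refl])

lemma measurable_copy: "i < N \<Longrightarrow> (\<lambda>w. w i) \<in> \<Omega> \<rightarrow>\<^sub>M path_space S I"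
  by (rule measurable_component_singleton) simp

text \<open>
  Clusters are intervals of indices, and the leader \<open>c i\<close> of the cluster of \<open>i\<close> is its smallest
  member.
\<close>

definition leaders :: "(nat \<Rightarrow> nat) \<Rightarrow> bool" where
  "leaders c \<longleftrightarrow> (\<forall>i<N. c i \<le> i \<and> c (c i) = c i) \<and> (\<forall>i j. i \<le> j \<longrightarrow> j < N \<longrightarrow> c i \<le> c j)"

lemma leadersD:
  assumes "leaders c"
  shows "i < N \<Longrightarrow> c i \<le> i" "i < N \<Longrightarrow> c (c i) = c i" "i < N \<Longrightarrow> c i < N"
    "i \<le> j \<Longrightarrow> j < N \<Longrightarrow> c i \<le> c j"
  using assms by (auto simp: leaders_def intro: le_less_trans)

definition collide :: "(nat \<Rightarrow> nat) \<Rightarrow> (nat \<Rightarrow> real \<Rightarrow> real) \<Rightarrow> real \<Rightarrow> bool" where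
  "collide c w t \<longleftrightarrow> (\<exists>i<N. \<exists>j<N. c i \<noteq> c j \<and> w (c i) t = w (c j) t)"

text \<open>
  The value is \<open>T\<close> if the leaders do not collide up to time \<open>T\<close>; this makes the first collision a
  stopping time with values in \<open>I\<close>, but one has to ask separately whether there is a collision at
  this time.
\<close>

definition first_collision :: "(nat \<Rightarrow> nat) \<Rightarrow> (nat \<Rightarrow> real \<Rightarrow> real) \<Rightarrow> real" where
  "first_collision c w = Inf ({t \<in> I. t \<le> T \<and> collide c w t} \<union> {T})"

lemma first_collision_none:
  "{t \<in> I. t \<le> T \<and> collide c w t} = {} \<Longrightarrow> first_collision c w = T"
  unfolding first_collision_def by (simp only: Un_empty_left cInf_singleton)

lemma first_collision:
  assumes c: "leaders c" and w: "w \<in> paths_upto N"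
  shows "first_collision c w \<in> I" "first_collision c w \<le> T"
    and "t \<in> I \<Longrightarrow> t < first_collision c w \<Longrightarrow> \<not> collide c w t"
    and "t \<in> I \<Longrightarrow> t \<le> T \<Longrightarrow> collide c w t \<Longrightarrow> collide c w (first_collision c w)"
proof -
  let ?C = "{t \<in> I. t \<le> T \<and> collide c w t}"
  have bdd: "bdd_below (?C \<union> {T})" using time_nonneg T_nonneg by (intro bdd_belowI[of _ 0]) auto
  have *: "first_collision c w \<in> I \<and> first_collision c w \<le> T \<and> (\<forall>t\<in>I. t < first_collision c w \<longrightarrow> \<not> collide c w t)
    \<and> (?C \<noteq> {} \<longrightarrow> collide c w (first_collision c w))"
  proof (cases "?C = {}")
    case True
    have "first_collision c w = T" using True by (rule first_collision_none)
    then show ?thesis using time True by fastforce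
  next
    case False
    define J where "J = (\<lambda>(i, j). (w (c i), w (c j))) ` {(i, j). i < N \<and> j < N \<and> c i \<noteq> c j}"
    have J: "(\<exists>(u, v)\<in>J. u t = v t) \<longleftrightarrow> collide c w t" for t
      by (force simp: J_def collide_def)
    have fin: "finite J"
      unfolding J_def by (rule finite_imageI, rule finite_subset[of _ "{..<N} \<times> {..<N}"]) auto
    have paths: "u \<in> skip_free_paths S I \<and> v \<in> skip_free_paths S I" if "(u, v) \<in> J" for u v
      using that leadersD(3)[OF c] paths_upto_path[OF w] by (auto simp: J_def)
    have ex: "\<exists>s\<in>I. \<exists>(u, v)\<in>J. u s = v s" unfolding J using False by auto
    obtain s where s: "s \<in> I" "\<exists>(u, v)\<in>J. u s = v s" "\<And>t u v. t \<in> I \<Longrightarrow> (u, v) \<in> J \<Longrightarrow> u t = v t \<Longrightarrow> s \<le> t"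
      using first_meeting_attained_finite[OF fin paths ex] by blast
    have s': "collide c w s" "t \<in> I \<Longrightarrow> collide c w t \<Longrightarrow> s \<le> t" for t
      using s(2,3) unfolding J[symmetric] by blast+
    obtain t where "t \<in> I" "t \<le> T" "collide c w t" using False by blast
    then have "s \<le> T" using s'(2)[of t] by linarith
    then have "first_collision c w = s"
      unfolding first_collision_def using s s' by (intro cInf_eq_minimum) auto
    moreover have "\<not> collide c w t" if "t \<in> I" "t < s" for t using s'(2)[of t] that by force
    ultimately show ?thesis using s(1) s'(1) \<open>s \<le> T\<close> by simp
  qed
  then show "first_collision c w \<in> I" "first_collision c w \<le> T"
    "t \<in> I \<Longrightarrow> t < first_collision c w \<Longrightarrow> \<not> collide c w t"
    "t \<in> I \<Longrightarrow> t \<le> T \<Longrightarrow> collide c w t \<Longrightarrow> collide c w (first_collision c w)"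
    by auto
qed

lemma collide_cong:
  assumes c: "leaders c" and "\<And>i. i < N \<Longrightarrow> w i t = w' i t"
  shows "collide c w t \<longleftrightarrow> collide c w' t"
  unfolding collide_def using assms(2)[OF leadersD(3)[OF c]] by metis

lemma first_collision_past:
  assumes c: "leaders c" and w: "w \<in> paths_upto N" "w' \<in> paths_upto N"
    and agree: "\<And>i. i < N \<Longrightarrow> path_agree I (first_collision c w) (w i) (w' i)"
  shows "first_collision c w' = first_collision c w"
proof -
  let ?s = "first_collision c w" and ?s' = "first_collision c w'"
  note f = first_collision[OF c w(1)] and f' = first_collision[OF c w(2)]
  have cong: "collide c w t \<longleftrightarrow> collide c w' t" if "t \<in> I" "t \<le> ?s" for t
    using agree that by (intro collide_cong[OF c]) (simp add: path_agree_def)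
  have le: "?s \<le> ?s'" if "collide c w' ?s'"
    using that f'(1) f(3)[of ?s'] cong[of ?s'] by fastforce
  show ?thesis
  proof (cases "collide c w ?s")
    case True
    then have col: "collide c w' ?s" using cong[OF f(1)] by simp
    then have "\<not> ?s < ?s'" using f'(3)[OF f(1)] by blast
    moreover have "collide c w' ?s'" using f'(4)[OF f(1,2) col] .
    ultimately show ?thesis using le by simp
  next
    case False
    have T: "?s = T"
    proof (rule ccontr)
      assume ne: "?s \<noteq> T"
      have "{t \<in> I. t \<le> T \<and> collide c w t} = {}" using f(4) False by blast
      then have "?s = T" by (rule first_collision_none)
      then show False using ne by simp
    qed
    have "{t \<in> I. t \<le> T \<and> collide c w' t} = {}"
      using cong f(4) False unfolding T by blast
    then have "?s' = T" by (rule first_collision_none)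
    then show ?thesis using T by simp
  qed
qed

lemma measurable_meet_copies:
  assumes "i < N" "j < N"
  shows "Measurable.pred \<Omega> (\<lambda>w. path_meet I t (w i) (w j))"
proof (cases "0 \<le> t")
  case True
  then obtain t' where t': "t' \<in> I" "t' \<le> t" "\<And>u. u \<in> I \<Longrightarrow> u \<le> t \<Longrightarrow> u \<le> t'"
    using time_below[of t] by blast
  then have "path_meet I t v w \<longleftrightarrow> path_meet I t' v w" for v w
    unfolding path_meet_def by (meson order_trans)
  then show ?thesis
    using measurable_path_meet[OF measurable_copy[OF assms(1)] measurable_copy[OF assms(2)] t'(1)] by simp
next
  case False
  then have "\<not> path_meet I t v w" for v w unfolding path_meet_def using time_nonneg by (meson order_trans)
  then show ?thesis by simp
qed

lemma measurable_first_collision: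
  assumes c: "leaders c"
  shows "first_collision c \<in> borel_measurable \<Omega>"
proof (rule borel_measurableI_le)
  fix t
  have "first_collision c w \<le> t \<longleftrightarrow> T \<le> t \<or> (\<exists>i<N. \<exists>j<N. c i \<noteq> c j \<and> path_meet I t (w (c i)) (w (c j)))"
    if w: "w \<in> paths_upto N" for w
  proof
    note f = first_collision[OF c w]
    assume le: "first_collision c w \<le> t"
    show "T \<le> t \<or> (\<exists>i<N. \<exists>j<N. c i \<noteq> c j \<and> path_meet I t (w (c i)) (w (c j)))"
    proof (cases "collide c w (first_collision c w)")
      case True
      then show ?thesis using f(1) le unfolding collide_def path_meet_def by blast
    next
      case False
      then have "{t \<in> I. t \<le> T \<and> collide c w t} = {}" using f(4) by blast
      then have "first_collision c w = T" by (rule first_collision_none)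
      then show ?thesis using le by simp
    qed
  next
    note f = first_collision[OF c w]
    assume "T \<le> t \<or> (\<exists>i<N. \<exists>j<N. c i \<noteq> c j \<and> path_meet I t (w (c i)) (w (c j)))"
    then show "first_collision c w \<le> t"
    proof
      assume "T \<le> t" then show ?thesis using f(2) by simp
    next
      assume "\<exists>i<N. \<exists>j<N. c i \<noteq> c j \<and> path_meet I t (w (c i)) (w (c j))"
      then obtain s where "s \<in> I" "s \<le> t" "collide c w s" unfolding collide_def path_meet_def by blast
      then show ?thesis using f(3)[of s] by force
    qed
  qed
  then have "{w \<in> space \<Omega>. first_collision c w \<le> t} =
      {w \<in> space \<Omega>. T \<le> t \<or> (\<exists>i\<in>{..<N}. \<exists>j\<in>{..<N}. c i \<noteq> c j \<and> path_meet I t (w (c i)) (w (c j)))}"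
    by (auto simp: space_paths)
  also have "\<dots> \<in> sets \<Omega>"
    unfolding pred_def[symmetric]
    using leadersD(3)[OF c]
    by (intro pred_intros_logic pred_intros_finite measurable_meet_copies) auto
  finally show "{w \<in> space \<Omega>. first_collision c w \<le> t} \<in> sets \<Omega>" .
qed

definition meet_pfaffian :: "(nat \<Rightarrow> nat) \<Rightarrow> (nat \<Rightarrow> real \<Rightarrow> real) \<Rightarrow> real" where
  "meet_pfaffian c w = label_pfaffian n (\<lambda>u v. path_meet I T (w u) (w v)) c"

lemma path_meet_refl: "path_meet I T v v"
  using T_nonneg by (auto simp: path_meet_def intro!: bexI[of _ 0])

lemma path_meet_sym: "path_meet I T v w \<longleftrightarrow> path_meet I T w v"
  by (auto simp: path_meet_def eq_commute)

lemma measurable_meet_pfaffian: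
  assumes "\<And>i. i < N \<Longrightarrow> c i < N"
  shows "meet_pfaffian c \<in> borel_measurable \<Omega>"
proof -
  have "(\<lambda>w. of_bool (path_meet I T (w (c (p (2 * i)))) (w (c (p (2 * i + 1))))) :: real) \<in> borel_measurable \<Omega>"
    if "p permutes {..<N}" "i < n" for p i
  proof -
    have "p (2 * i) < N" "p (2 * i + 1) < N"
      using permutes_in_image[OF that(1), of "2 * i"] permutes_in_image[OF that(1), of "2 * i + 1"] that(2) by auto
    then have "Measurable.pred \<Omega> (\<lambda>w. path_meet I T (w (c (p (2 * i)))) (w (c (p (2 * i + 1)))))"
      using assms by (intro measurable_meet_copies) auto
    then show ?thesis by simp
  qed
  then show ?thesis
    unfolding meet_pfaffian_def label_pfaffian_def pfaffian_def
    by (intro borel_measurable_divide borel_measurable_sum borel_measurable_times borel_measurable_prod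
      borel_measurable_const) simp_all
qed

lemma meet_pfaffian_bounded: "\<bar>meet_pfaffian c w\<bar> \<le> real (card {p. p permutes {..<N}}) / (2 ^ n * fact n)"
proof -
  let ?f = "\<lambda>p. of_int (sign p) * (\<Prod>i<n. sgn (real (p (2 * i + 1)) - real (p (2 * i))) *
    of_bool (path_meet I T (w (c (p (2 * i)))) (w (c (p (2 * i + 1))))))::real"
  have "\<bar>?f p\<bar> \<le> 1" for p
  proof -
    have "\<bar>?f p\<bar> = (\<Prod>i<n. \<bar>sgn (real (p (2 * i + 1)) - real (p (2 * i))) *
      of_bool (path_meet I T (w (c (p (2 * i)))) (w (c (p (2 * i + 1)))))\<bar>)"
      by (simp add: abs_mult abs_prod sign_def)
    also have "\<dots> \<le> (\<Prod>i<n. 1)" by (intro prod_mono) (auto simp: sgn_if)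
    finally show ?thesis by simp
  qed
  then have "\<bar>\<Sum>p | p permutes {..<N}. ?f p\<bar> \<le> (\<Sum>p | p permutes {..<N}. 1)"
    by (intro order_trans[OF sum_abs] sum_mono)
  then have "\<bar>\<Sum>p | p permutes {..<N}. ?f p\<bar> / (2 ^ n * fact n) \<le> real (card {p. p permutes {..<N}}) / (2 ^ n * fact n)"
    by (intro divide_right_mono) simp_all
  moreover have "\<bar>meet_pfaffian c w\<bar> = \<bar>\<Sum>p | p permutes {..<N}. ?f p\<bar> / (2 ^ n * fact n)"
    unfolding meet_pfaffian_def label_pfaffian_def pfaffian_def abs_divide by simp
  ultimately show ?thesis by (simp only:)
qed

lemma integrable_meet_pfaffian:
  assumes "\<And>i. i < N \<Longrightarrow> c i < N" and D: "D \<in> sets \<Omega>"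
  shows "integrable Q (\<lambda>w. indicator D w * meet_pfaffian c w)"
proof (rule Q.integrable_const_bound)
  show "AE w in Q. norm (indicator D w * meet_pfaffian c w) \<le> real (card {p. p permutes {..<N}}) / (2 ^ n * fact n)"
    using meet_pfaffian_bounded by (auto simp: indicator_def)
  show "(\<lambda>w. indicator D w * meet_pfaffian c w) \<in> borel_measurable Q"
    unfolding measurable_Q using D measurable_meet_pfaffian[OF assms(1)] by simp
qed

text \<open>
  The cluster of the leader \<open>k\<close> is united with the preceding one, which has the leader \<open>c (k - 1)\<close>
  because clusters are intervals.
\<close>

definition merge :: "(nat \<Rightarrow> nat) \<Rightarrow> nat \<Rightarrow> nat \<Rightarrow> nat" where
  "merge c k = (\<lambda>i. if c i = k then c (k - 1) else c i)"

lemma pred_leader: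
  assumes c: "leaders c" and k: "0 < k" "k < N" "c k = k" and i: "i < N"
  shows "c (k - 1) < k" "c (c (k - 1)) = c (k - 1)" "c (k - 1) \<noteq> k"
    "c i = c (k - 1) \<longleftrightarrow> c (k - 1) \<le> i \<and> i < k"
proof -
  have "c (k - 1) \<le> k - 1" using leadersD(1)[OF c, of "k - 1"] k by simp
  then show 1: "c (k - 1) < k" using k by linarith
  show 2: "c (c (k - 1)) = c (k - 1)" using leadersD(2)[OF c, of "k - 1"] k by simp
  show "c (k - 1) \<noteq> k" using 1 by simp
  show "c i = c (k - 1) \<longleftrightarrow> c (k - 1) \<le> i \<and> i < k"
  proof
    assume eq: "c i = c (k - 1)"
    have "\<not> k \<le> i" using leadersD(4)[OF c, of k i] i eq 1 k by auto
    then show "c (k - 1) \<le> i \<and> i < k" using leadersD(1)[OF c i] eq by simp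
  next
    assume "c (k - 1) \<le> i \<and> i < k"
    then have "c (c (k - 1)) \<le> c i" "c i \<le> c (k - 1)" using leadersD(4)[OF c] i k by auto
    then show "c i = c (k - 1)" using 2 by simp
  qed
qed

lemma leaders_merge:
  assumes c: "leaders c" and k: "0 < k" "k < N" "c k = k"
  shows "leaders (merge c k)"
  unfolding leaders_def
proof (intro conjI allI impI)
  note p = pred_leader[OF c k k(2)]
  fix i assume i: "i < N"
  show "merge c k i \<le> i" using leadersD(1)[OF c i] p(1) by (auto simp: merge_def)
  show "merge c k (merge c k i) = merge c k i"
    using leadersD(2)[OF c i] p(2,3) by (auto simp: merge_def)
next
  note p = pred_leader[OF c k k(2)]
  fix i j assume ij: "i \<le> j" "j < N"
  have m: "c i \<le> c j" using leadersD(4)[OF c] ij by simp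
  show "merge c k i \<le> merge c k j"
  proof (cases "c j = k \<and> c i \<noteq> k")
    case True
    then have "i < k" using m leadersD(4)[OF c, of k i] ij k(3) by (cases "k \<le> i") auto
    then have "c i \<le> c (k - 1)" using leadersD(4)[OF c, of i "k - 1"] k by simp
    then show ?thesis using True by (simp add: merge_def)
  next
    case False
    then show ?thesis using m p(1) by (auto simp: merge_def)
  qed
qed

lemma leader_block:
  assumes c: "leaders c" and k: "0 < k" "k < N" "c k = k"
  shows "\<exists>m. k \<le> m \<and> m \<le> N \<and> (\<forall>i<N. c i = k \<longleftrightarrow> k \<le> i \<and> i < m)"
proof -
  let ?m = "LEAST m. k \<le> m \<and> (m = N \<or> c m \<noteq> k)"
  have ex: "k \<le> N \<and> (N = N \<or> c N \<noteq> k)" using k by simp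
  have m: "k \<le> ?m" "?m = N \<or> c ?m \<noteq> k" using LeastI[of "\<lambda>m. k \<le> m \<and> (m = N \<or> c m \<noteq> k)", OF ex] by auto
  have mN: "?m \<le> N" by (rule Least_le[of "\<lambda>m. k \<le> m \<and> (m = N \<or> c m \<noteq> k)", OF ex])
  have iff: "c i = k \<longleftrightarrow> k \<le> i \<and> i < ?m" if i: "i < N" for i
  proof
    assume ci: "c i = k"
    have "k \<le> i" using leadersD(1)[OF c i] ci by simp
    moreover have "i < ?m"
    proof (rule ccontr)
      assume "\<not> i < ?m"
      then have le: "?m \<le> i" by simp
      then have "c ?m \<noteq> k" using m(2) i by auto
      moreover have "c ?m \<le> k" using leadersD(4)[OF c le i] ci by simp
      moreover have "k \<le> c ?m" using leadersD(4)[OF c m(1)] le i k(3) by simp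
      ultimately show False by simp
    qed
    ultimately show "k \<le> i \<and> i < ?m" by simp
  next
    assume "k \<le> i \<and> i < ?m"
    then show "c i = k" using not_less_Least[of i "\<lambda>m. k \<le> m \<and> (m = N \<or> c m \<noteq> k)"] by auto
  qed
  show ?thesis using m(1) mN iff by blast
qed

lemma label_pfaffian_cong:
  assumes "\<And>i. i < N \<Longrightarrow> c i = d i"
  shows "label_pfaffian n R c = label_pfaffian n R d"
  unfolding label_pfaffian_def using assms by (intro pfaffian_cong) simp

text \<open>
  The relation \<open>R'\<close> arises from \<open>R\<close> by exchanging the leaders \<open>q = c (k - 1)\<close> and \<open>k\<close>, so a Pfaffian
  for \<open>R'\<close> is one for \<open>R\<close> with these labels exchanged. The clusters of \<open>q\<close> and \<open>k\<close> are adjacent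
  blocks, and the four Pfaffians are those of \<open>label_pfaffian_two_blocks\<close>.
\<close>

lemma label_pfaffian_merge:
  assumes c: "leaders c" and k: "0 < k" "k < N" "c k = k"
    and R: "\<And>u. R u u" "R (c (k - 1)) k" "R k (c (k - 1))"
    and R': "\<And>u v. u < N \<Longrightarrow> v < N \<Longrightarrow> c u = u \<Longrightarrow> c v = v \<Longrightarrow> R' u v \<longleftrightarrow>
      R (Transposition.transpose (c (k - 1)) k u) (Transposition.transpose (c (k - 1)) k v)"
  shows "label_pfaffian n R c + label_pfaffian n R' c =
    label_pfaffian n R (merge c k) + label_pfaffian n R' (merge c k)"
proof -
  define q where "q = c (k - 1)"
  note p = pred_leader[OF c k, folded q_def]
  note R = R[folded q_def] and R' = R'[folded q_def]
  let ?t = "Transposition.transpose q k"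
  obtain m where m: "k \<le> m" "m \<le> N" "\<And>i. i < N \<Longrightarrow> c i = k \<longleftrightarrow> k \<le> i \<and> i < m"
    using leader_block[OF c k] by blast
  have merge: "merge c k i = (if c i = k then q else c i)" for i
    by (simp add: merge_def q_def)
  have R'_eq: "label_pfaffian n R' d = label_pfaffian n R (\<lambda>i. ?t (d i))"
    if "\<And>i. i < N \<Longrightarrow> d i < N \<and> c (d i) = d i" for d
    unfolding label_pfaffian_def using that R' by (intro pfaffian_cong) simp
  have merge_leader: "merge c k i < N \<and> c (merge c k i) = merge c k i" if "i < N" for i
    using leadersD[OF c] that p(1,2)[OF k(2)] k by (auto simp: merge)
  let ?b = "\<lambda>u v. two_blocks q (k - q) (m - k) u v c"
  have pk: "q + (k - q) = k" "k + (m - k) = m" using p(1)[OF k(2)] m(1) by simp_all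
  have b: "?b u v i = (if c i = q then u else if c i = k then v else c i)" if "i < N" for u v i
    unfolding two_blocks_def pk using p(4)[OF that] m(3)[OF that] by auto
  have "label_pfaffian n R c = label_pfaffian n R (?b q k)"
    by (rule label_pfaffian_cong) (simp add: b)
  moreover have "label_pfaffian n R' c = label_pfaffian n R (?b k q)"
  proof -
    have "label_pfaffian n R' c = label_pfaffian n R (\<lambda>i. ?t (c i))"
      by (rule R'_eq) (simp add: leadersD[OF c])
    also have "\<dots> = label_pfaffian n R (?b k q)"
      by (rule label_pfaffian_cong) (auto simp: b Transposition.transpose_def)
    finally show ?thesis .
  qed
  moreover have "label_pfaffian n R (merge c k) = label_pfaffian n R (?b q q)"
    by (rule label_pfaffian_cong) (auto simp: b merge)
  moreover have "label_pfaffian n R' (merge c k) = label_pfaffian n R (?b k k)"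
  proof -
    have "label_pfaffian n R' (merge c k) = label_pfaffian n R (\<lambda>i. ?t (merge c k i))"
      by (rule R'_eq[OF merge_leader])
    also have "\<dots> = label_pfaffian n R (?b k k)"
      using p(3)[OF k(2)] by (intro label_pfaffian_cong) (auto simp: b merge Transposition.transpose_def)
    finally show ?thesis .
  qed
  moreover have "label_pfaffian n R (?b q k) + label_pfaffian n R (?b k q) =
      label_pfaffian n R (?b q q) + label_pfaffian n R (?b k k)"
    by (rule label_pfaffian_two_blocks) (use m(2) pk R in auto)
  ultimately show ?thesis by simp
qed

end

section \<open>The coalescing system driven by independent copies\<close>

lemma coalesce_stable: "i < m \<Longrightarrow> coalesce I m w i = coalesce I (Suc i) w i"
proof (induction m)
  case (Suc m)
  then show ?case by (cases "i = m") simp_all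
qed simp

lemma coalesce_outside: "m \<le> i \<Longrightarrow> coalesce I m w i = undefined"
  by (induction m) auto

context skip_free_process
begin

text \<open>
  The infimum in \<^const>\<open>follow\<close> is a minimum, since the first meeting with finitely many paths is
  attained.
\<close>

lemma follow_cases:
  assumes \<xi>: "\<forall>j<i. \<xi> j \<in> skip_free_paths S I" and v: "v \<in> skip_free_paths S I"
  shows "(\<forall>s\<in>I. \<forall>j<i. \<xi> j s \<noteq> v s) \<and> follow I i \<xi> v = v \<or>
    (\<exists>\<sigma> m. \<sigma> \<in> I \<and> m < i \<and> \<xi> m \<sigma> = v \<sigma> \<and> (\<forall>s\<in>I. s < \<sigma> \<longrightarrow> (\<forall>j<i. \<xi> j s \<noteq> v s)) \<and>
      follow I i \<xi> v = path_switch I \<sigma> v (\<xi> m))"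
proof (cases "\<exists>s\<in>I. \<exists>j<i. \<xi> j s = v s")
  case False
  then have H: "{s \<in> I. \<exists>j<i. \<xi> j s = v s} = {}" by auto
  have "follow I i \<xi> v = v"
    unfolding follow_def Let_def H using path_undefined[OF v] by (auto simp: fun_eq_iff restrict_def)
  then show ?thesis using False by blast
next
  case True
  let ?H = "{s \<in> I. \<exists>j<i. \<xi> j s = v s}"
  define J where "J = (\<lambda>j. (\<xi> j, v)) ` {..<i}"
  have J: "(\<exists>(a, b)\<in>J. a s = b s) \<longleftrightarrow> (\<exists>j<i. \<xi> j s = v s)" for s
    by (auto simp: J_def)
  have fin: "finite J" by (simp add: J_def)
  have paths: "a \<in> skip_free_paths S I \<and> b \<in> skip_free_paths S I" if "(a, b) \<in> J" for a b
    using that \<xi> v by (auto simp: J_def)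
  have ex: "\<exists>s\<in>I. \<exists>(a, b)\<in>J. a s = b s" unfolding J using True .
  obtain \<sigma> where \<sigma>: "\<sigma> \<in> I" "\<exists>(a, b)\<in>J. a \<sigma> = b \<sigma>" "\<And>t a b. t \<in> I \<Longrightarrow> (a, b) \<in> J \<Longrightarrow> a t = b t \<Longrightarrow> \<sigma> \<le> t"
    using first_meeting_attained_finite[OF fin paths ex] by blast
  have min: "\<sigma> \<le> t" if "t \<in> I" "j < i" "\<xi> j t = v t" for t j
    using \<sigma>(3)[of t "\<xi> j" v] that by (simp add: J_def)
  have in_H: "\<sigma> \<in> ?H" using \<sigma>(1,2) unfolding J by simp
  then have Inf: "Inf ?H = \<sigma>" using min by (intro cInf_eq_minimum) auto
  have ne: "?H \<noteq> {}" using in_H by blast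
  define m where "m = (LEAST j. j < i \<and> \<xi> j \<sigma> = v \<sigma>)"
  have m: "m < i \<and> \<xi> m \<sigma> = v \<sigma>"
    unfolding m_def by (rule LeastI_ex) (use in_H in auto)
  have "follow I i \<xi> v = path_switch I \<sigma> v (\<xi> m)"
    unfolding follow_def Let_def Inf m_def[symmetric] path_switch_def using ne
    by (auto simp: fun_eq_iff restrict_def)
  moreover have "\<xi> j s \<noteq> v s" if "s \<in> I" "s < \<sigma>" "j < i" for s j
    using min[of s j] that by auto
  ultimately show ?thesis using \<sigma>(1) m by blast
qed

end

context independent_copies
begin

abbreviation coalesced :: "(nat \<Rightarrow> real \<Rightarrow> real) \<Rightarrow> nat \<Rightarrow> real \<Rightarrow> real" where
  "coalesced \<equiv> coalesce I N"

lemma coalesced_follow: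
  assumes "i < N"
  shows "coalesced w i = follow I i (coalesce I i w) (w i)" "j < i \<Longrightarrow> coalesce I i w j = coalesced w j"
  using coalesce_stable[OF assms, of I w] coalesce_stable[of j i I w] coalesce_stable[of j N I w] assms
  by simp_all

lemma coalesced_path:
  assumes w: "w \<in> paths_upto N"
  shows "i < N \<Longrightarrow> coalesced w i \<in> skip_free_paths S I"
proof (induction i rule: less_induct)
  case (less i)
  have prev: "\<forall>j<i. coalesce I i w j \<in> skip_free_paths S I"
    using less coalesced_follow(2)[OF less.prems, where w=w] by simp
  note wi = paths_upto_path[OF w less.prems]
  from follow_cases[of i "coalesce I i w", OF prev wi] show ?case
    unfolding coalesced_follow(1)[OF less.prems]
  proof (elim disjE exE conjE)
    assume "follow I i (coalesce I i w) (w i) = w i"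
    then show "follow I i (coalesce I i w) (w i) \<in> skip_free_paths S I" using wi by (simp only:)
  next
    fix \<sigma> m assume m: "\<sigma> \<in> I" "m < i" "coalesce I i w m \<sigma> = w i \<sigma>"
      and eq: "follow I i (coalesce I i w) (w i) = path_switch I \<sigma> (w i) (coalesce I i w m)"
    show "follow I i (coalesce I i w) (w i) \<in> skip_free_paths S I"
      unfolding eq by (rule path_switch_path[OF wi prev[rule_format, OF m(2)] m(1) m(3)[symmetric]])
  qed
qed

lemma coalesced_cases:
  assumes w: "w \<in> paths_upto N" and i: "i < N"
  obtains "\<And>s j. s \<in> I \<Longrightarrow> j < i \<Longrightarrow> coalesced w j s \<noteq> w i s" "coalesced w i = w i"
  | \<sigma> m where "\<sigma> \<in> I" "m < i" "coalesced w m \<sigma> = w i \<sigma>"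
    "\<And>s j. s \<in> I \<Longrightarrow> s < \<sigma> \<Longrightarrow> j < i \<Longrightarrow> coalesced w j s \<noteq> w i s"
    "\<And>t. t \<in> I \<Longrightarrow> coalesced w i t = (if t < \<sigma> then w i t else coalesced w m t)"
proof -
  note eq = coalesced_follow(1)[OF i, of w] coalesced_follow(2)[OF i, where w=w]
  have prev: "\<forall>j<i. coalesce I i w j \<in> skip_free_paths S I"
    using coalesced_path[OF w] eq(2) i by simp
  note wi = paths_upto_path[OF w i]
  consider (none) "\<forall>s\<in>I. \<forall>j<i. coalesce I i w j s \<noteq> w i s" "coalesced w i = w i"
    | (meet) \<sigma> m where "\<sigma> \<in> I" "m < i" "coalesce I i w m \<sigma> = w i \<sigma>"
      "\<forall>s\<in>I. s < \<sigma> \<longrightarrow> (\<forall>j<i. coalesce I i w j s \<noteq> w i s)"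
      "coalesced w i = path_switch I \<sigma> (w i) (coalesce I i w m)"
    using follow_cases[of i "coalesce I i w", OF prev wi] unfolding eq(1)[symmetric] by blast
  then show thesis
  proof cases
    case none
    then show thesis using that(1) eq(2) by simp
  next
    case (meet \<sigma> m)
    show thesis
    proof (rule that(2)[OF meet(1,2)])
      show "coalesced w m \<sigma> = w i \<sigma>" using meet(2,3) eq(2) by simp
      show "coalesced w j s \<noteq> w i s" if "s \<in> I" "s < \<sigma>" "j < i" for s j
      proof -
        have "coalesce I i w j s \<noteq> w i s" using meet(4) that by blast
        then show ?thesis by (simp only: eq(2)[OF that(3)] not_False_eq_True)
      qed
      show "coalesced w i t = (if t < \<sigma> then w i t else coalesced w m t)" if "t \<in> I" for t
        using that eq(2)[OF meet(2)] meet(5) by (simp add: path_switch_def)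
    qed
  qed
qed

text \<open>
  By induction on the larger index: if the later particle already follows another one at time \<open>s\<close>,
  that one replaces it. Otherwise it would meet an earlier particle before it starts to follow one,
  which is impossible.
\<close>

lemma coalesced_merge:
  assumes w: "w \<in> paths_upto N" and st: "s \<in> I" "t \<in> I" "s \<le> t"
  shows "i < N \<Longrightarrow> j < N \<Longrightarrow> coalesced w i s = coalesced w j s \<Longrightarrow> coalesced w i t = coalesced w j t"
proof (induction "max i j" arbitrary: i j rule: less_induct)
  case less
  have *: "coalesced w a t = coalesced w b t"
    if ab: "b < a" "max a b = max i j" "a < N" "coalesced w a s = coalesced w b s" for a b
    using w ab(3)
  proof (cases rule: coalesced_cases)
    case 1
    then have "coalesced w b s = w a s" using ab(4) by simp
    then show ?thesis using 1(1)[OF st(1) ab(1)] by simp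
  next
    case (2 \<sigma> m)
    show ?thesis
    proof (cases "s < \<sigma>")
      case True
      then have "coalesced w b s = w a s" using ab(4) 2(5)[OF st(1)] by simp
      then show ?thesis using 2(4)[OF st(1) True ab(1)] by simp
    next
      case False
      then have "coalesced w a s = coalesced w m s" "coalesced w a t = coalesced w m t"
        using False st(3) 2(5)[OF st(1)] 2(5)[OF st(2)] by simp_all
      moreover have "coalesced w m s = coalesced w b s \<Longrightarrow> coalesced w m t = coalesced w b t"
      proof -
        have "max m b < max i j" using ab(1) 2(2) unfolding ab(2)[symmetric] by simp
        moreover have "m < N" "b < N" using ab(1,3) 2(2) by simp_all
        ultimately show "coalesced w m s = coalesced w b s \<Longrightarrow> coalesced w m t = coalesced w b t"
          by (rule less.hyps)
      qed
      ultimately show ?thesis using ab(4) by simp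
    qed
  qed
  consider "i = j" | "j < i" | "i < j" by linarith
  then show ?case
  proof cases
    case 1 then show ?thesis by simp
  next
    case 2 then show ?thesis using *[of j i] less.prems by simp
  next
    case 3 then show ?thesis using *[of i j] less.prems by simp
  qed
qed

text \<open>
  A particle that has met none of smaller index before time \<open>s\<close> still moves along its own copy.
\<close>

definition separate_before :: "(nat \<Rightarrow> real \<Rightarrow> real) \<Rightarrow> real \<Rightarrow> nat \<Rightarrow> bool" where
  "separate_before w s l \<longleftrightarrow> (\<forall>t\<in>I. t < s \<longrightarrow> (\<forall>j<l. coalesced w j t \<noteq> coalesced w l t))"

lemma separate_beforeD:
  assumes w: "w \<in> paths_upto N" and l: "l < N" and sep: "separate_before w s l" and t: "t \<in> I" "t \<le> s"
  shows "coalesced w l t = w l t"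
  using w l
proof (cases rule: coalesced_cases)
  case 1
  then show ?thesis by simp
next
  case (2 \<sigma> m)
  have "coalesced w m \<sigma> = coalesced w l \<sigma>" using 2(5)[OF 2(1)] by simp
  then have "\<not> \<sigma> < s" using sep 2(1,2) unfolding separate_before_def by blast
  then consider "t < \<sigma>" | "t = \<sigma>" using t by linarith
  then show ?thesis
  proof cases
    case 1
    then show ?thesis using 2(5)[OF t(1)] by simp
  next
    case eq: 2
    then show ?thesis using 2(3) 2(5)[OF t(1)] by simp
  qed
qed

text \<open>
  The labelling \<open>c\<close> describes the coalescing system at time \<open>s\<close>: every particle sits at the position
  of its leader, and the leaders move along their own copies.
\<close>

definition merged :: "(nat \<Rightarrow> nat) \<Rightarrow> (nat \<Rightarrow> real \<Rightarrow> real) \<Rightarrow> real \<Rightarrow> bool" where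
  "merged c w s \<longleftrightarrow> (\<forall>i<N. coalesced w i s = coalesced w (c i) s) \<and>
     (\<forall>l<N. c l = l \<longrightarrow> separate_before w s l)"

lemma mergedD:
  assumes "merged c w s"
  shows "i < N \<Longrightarrow> coalesced w i s = coalesced w (c i) s"
    and "l < N \<Longrightarrow> c l = l \<Longrightarrow> separate_before w s l"
  by (fact assms[unfolded merged_def, THEN conjunct1, rule_format]
    assms[unfolded merged_def, THEN conjunct2, rule_format])+

lemma mergedI:
  assumes "\<And>i. i < N \<Longrightarrow> coalesced w i s = coalesced w (c i) s"
    and "\<And>l. l < N \<Longrightarrow> c l = l \<Longrightarrow> separate_before w s l"
  shows "merged c w s"
  unfolding merged_def by (intro conjI allI impI assms)

text \<open>
  Suppose the leader \<open>l\<close> is absorbed by a particle \<open>m\<close> at a time \<open>\<sigma>\<close> before the first collision.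
  Then \<open>m\<close> is at the position of its leader \<open>c m < l\<close>, which by induction still moves along its own
  copy; so the copies of two leaders collide at \<open>\<sigma>\<close>.
\<close>

lemma merged_until_collision:
  assumes c: "leaders c" and w: "w \<in> paths_upto N" and s: "s \<in> I" "s \<le> first_collision c w"
    and merged: "merged c w s"
  shows "merged c w (first_collision c w)"
proof -
  let ?\<tau> = "first_collision c w"
  note f = first_collision[OF c w]
  have eq: "coalesced w i t = coalesced w (c i) t" if "i < N" "t \<in> I" "s \<le> t" for i t
    by (rule coalesced_merge[OF w s(1) that(2,3,1) leadersD(3)[OF c that(1)] mergedD(1)[OF merged that(1)]])
  have "l < N \<Longrightarrow> c l = l \<Longrightarrow> separate_before w ?\<tau> l" for l
  proof (induction l rule: less_induct)
    case (less l)
    have sep: "separate_before w s l" by (rule mergedD(2)[OF merged less.prems])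
    show ?case unfolding separate_before_def
    proof (intro ballI allI impI notI)
      fix t j assume t: "t \<in> I" "t < ?\<tau>" and j: "j < l" and meet: "coalesced w j t = coalesced w l t"
      from w less.prems(1) show False
      proof (cases rule: coalesced_cases)
        case 1
        then show False using 1(1)[OF t(1) j] meet by simp
      next
        case (2 \<sigma> m)
        have "\<sigma> \<le> t"
        proof (rule ccontr)
          assume "\<not> \<sigma> \<le> t"
          then have lt: "t < \<sigma>" by simp
          then have "coalesced w j t = w l t" using meet 2(5)[OF t(1)] by simp
          then show False using 2(4)[OF t(1) lt j] by blast
        qed
        then have \<sigma>: "\<sigma> < ?\<tau>" using t by simp
        have l\<sigma>: "coalesced w m \<sigma> = coalesced w l \<sigma>" using 2(5)[OF 2(1)] by simp
        then have "s \<le> \<sigma>" using sep 2(1,2) unfolding separate_before_def by (metis not_le)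
        have mN: "m < N" using 2(2) less.prems by simp
        have cm: "c m < l" "c m < N" "c (c m) = c m"
          using leadersD(1,2,3)[OF c mN] 2(2) by simp_all
        have "w l \<sigma> = coalesced w m \<sigma>" using 2(3) by simp
        also have "\<dots> = coalesced w (c m) \<sigma>" by (rule eq[OF mN 2(1) \<open>s \<le> \<sigma>\<close>])
        also have "\<dots> = w (c m) \<sigma>"
          using \<sigma> by (intro separate_beforeD[OF w cm(2) less.IH[OF cm] 2(1)]) simp
        finally have "collide c w \<sigma>"
          unfolding collide_def using less.prems cm
          by (intro exI[of _ l] conjI exI[of _ "c m"]) simp_all
        then show False using f(3)[OF 2(1) \<sigma>] by simp
      qed
    qed
  qed
  then show ?thesis by (intro mergedI eq f(1) s(2))
qed

lemma merged_initial: "w \<in> paths_upto N \<Longrightarrow> merged (\<lambda>i. i) w 0"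
  by (auto simp: merged_def separate_before_def dest: time_nonneg)

lemma merged_merge:
  assumes c: "leaders c" and k: "0 < k" "k < N" "c k = k" and w: "w \<in> paths_upto N"
    and merged: "merged c w (first_collision c w)"
    and hit: "w (c (k - 1)) (first_collision c w) = w k (first_collision c w)"
  shows "merged (merge c k) w (first_collision c w)"
proof -
  let ?\<tau> = "first_collision c w"
  note f = first_collision[OF c w] and p = pred_leader[OF c k k(2)]
  have q: "c (k - 1) < N" using p(1) k(2) by simp
  have lead: "coalesced w l ?\<tau> = w l ?\<tau>" if "l < N" "c l = l" for l
    by (rule separate_beforeD[OF w that(1) mergedD(2)[OF merged that] f(1) order_refl])
  have lead_merge: "c l = l" if "merge c k l = l" for l
    using that p(2) by (auto simp: merge_def split: if_splits)
  have "coalesced w k ?\<tau> = coalesced w (c (k - 1)) ?\<tau>"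
    using lead[OF k(2,3)] lead[OF q p(2)] hit by simp
  then have "coalesced w i ?\<tau> = coalesced w (merge c k i) ?\<tau>" if "i < N" for i
    using mergedD(1)[OF merged that] by (cases "c i = k") (simp_all only: merge_def if_True if_False refl)
  moreover have "separate_before w ?\<tau> l" if "l < N" "merge c k l = l" for l
    by (rule mergedD(2)[OF merged that(1) lead_merge[OF that(2)]])
  ultimately show ?thesis by (intro mergedI)
qed

lemma merged_no_collision:
  assumes c: "leaders c" and w: "w \<in> paths_upto N" and merged: "merged c w (first_collision c w)"
    and sep: "\<And>i j. i < N \<Longrightarrow> j < N \<Longrightarrow> path_meet I T (w (c i)) (w (c j)) \<Longrightarrow> c i = c j"
    and ij: "i < N" "j < N"
  shows "coalesced w i T = coalesced w j T \<longleftrightarrow> c i = c j"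
proof -
  have "{t \<in> I. t \<le> T \<and> collide c w t} = {}"
    using sep by (auto simp: collide_def path_meet_def)
  then have T: "first_collision c w = T" by (rule first_collision_none)
  have "coalesced w i T = w (c i) T" if "i < N" for i
  proof -
    have "coalesced w i T = coalesced w (c i) T" using mergedD(1)[OF merged that] by (simp only: T)
    also have "\<dots> = w (c i) T"
      by (rule separate_beforeD[OF w leadersD(3)[OF c that] mergedD(2)[OF merged[unfolded T] leadersD(3)[OF c that] leadersD(2)[OF c that]] time order_refl])
    finally show ?thesis .
  qed
  moreover have "w (c i) T = w (c j) T \<Longrightarrow> c i = c j"
    using sep[OF ij] time by (auto simp: path_meet_def)
  ultimately show ?thesis using ij by metis
qed

end

section \<open>Merging labels in expectation\<close>

context independent_copies
begin

lemma merge_collide: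
  assumes c: "leaders c" and k: "0 < k" "k < N" "c k = k" and col: "collide (merge c k) w t"
  shows "collide c w t"
proof -
  obtain i j where ij: "i < N" "j < N" "merge c k i \<noteq> merge c k j" "w (merge c k i) t = w (merge c k j) t"
    using col by (auto simp: collide_def)
  have lead: "c (merge c k i) = merge c k i" "merge c k i < N" if "i < N" for i
    using that leadersD(2,3)[OF c that] pred_leader(1,2)[OF c k that] k
    by (auto simp: merge_def)
  show ?thesis
    unfolding collide_def
    using ij lead[OF ij(1)] lead[OF ij(2)]
    by (intro exI[of _ "merge c k i"] conjI exI[of _ "merge c k j"]) simp_all
qed

lemma first_collision_merge:
  assumes c: "leaders c" and k: "0 < k" "k < N" "c k = k" and w: "w \<in> paths_upto N"
  shows "first_collision c w \<le> first_collision (merge c k) w"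
proof (rule ccontr)
  let ?c = "merge c k"
  note f = first_collision[OF c w] and f' = first_collision[OF leaders_merge[OF c k] w]
  assume "\<not> ?thesis"
  then have lt: "first_collision ?c w < first_collision c w" by simp
  then have "\<not> collide c w (first_collision ?c w)" using f(3) f'(1) by blast
  then have "\<not> collide ?c w (first_collision ?c w)" using merge_collide[OF c k] by blast
  then have "{t \<in> I. t \<le> T \<and> collide ?c w t} = {}" using f'(4) by blast
  then have "first_collision ?c w = T" by (rule first_collision_none)
  then show False using lt f(2) by simp
qed

definition past_event :: "(nat \<Rightarrow> nat) \<Rightarrow> (nat \<Rightarrow> real \<Rightarrow> real) set \<Rightarrow> bool" where
  "past_event c D \<longleftrightarrow> D \<in> sets \<Omega> \<and> (\<forall>w\<in>D. \<forall>w'\<in>paths_upto N.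
     (\<forall>i<N. path_agree I (first_collision c w) (w i) (w' i)) \<longrightarrow> w' \<in> D)"

lemma past_event_paths: "past_event c D \<Longrightarrow> w \<in> D \<Longrightarrow> w \<in> paths_upto N"
  using sets.sets_into_space[of D \<Omega>] by (auto simp: past_event_def space_paths)

lemma past_eventD:
  "past_event c D \<Longrightarrow> w \<in> D \<Longrightarrow> w' \<in> paths_upto N \<Longrightarrow>
    (\<And>i. i < N \<Longrightarrow> path_agree I (first_collision c w) (w i) (w' i)) \<Longrightarrow> w' \<in> D"
  unfolding past_event_def by blast

lemma past_event_merge:
  assumes c: "leaders c" and k: "0 < k" "k < N" "c k = k" and D: "past_event c D"
  shows "past_event (merge c k) D"
  unfolding past_event_def
proof (intro conjI ballI impI)
  show "D \<in> sets \<Omega>" using D by (simp add: past_event_def)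
  fix w w' assume w: "w \<in> D" "w' \<in> paths_upto N"
    and ag: "\<forall>i<N. path_agree I (first_collision (merge c k) w) (w i) (w' i)"
  show "w' \<in> D"
  proof (rule past_eventD[OF D w])
    fix i assume "i < N"
    then show "path_agree I (first_collision c w) (w i) (w' i)"
      using ag first_collision_merge[OF c k past_event_paths[OF D w(1)]] by (auto simp: path_agree_def)
  qed
qed

definition hit :: "(nat \<Rightarrow> nat) \<Rightarrow> nat \<Rightarrow> (nat \<Rightarrow> real \<Rightarrow> real) \<Rightarrow> bool" where
  "hit c k w \<longleftrightarrow> w (c (k - 1)) (first_collision c w) = w k (first_collision c w)"

lemma measurable_hit:
  assumes c: "leaders c" and k: "k < N"
  shows "Measurable.pred \<Omega> (hit c k)"
proof -
  have q: "c (k - 1) < N" using leadersD(3)[OF c, of "k - 1"] k by simp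
  have I: "first_collision c w \<in> I" if "w \<in> space \<Omega>" for w
    using that first_collision(1)[OF c] by (simp add: space_paths)
  have a: "(\<lambda>w. w (c (k - 1)) (first_collision c w)) \<in> borel_measurable \<Omega>"
    by (rule measurable_path_eval[OF measurable_copy[OF q] measurable_first_collision[OF c] I])
  have b: "(\<lambda>w. w k (first_collision c w)) \<in> borel_measurable \<Omega>"
    by (rule measurable_path_eval[OF measurable_copy[OF k] measurable_first_collision[OF c] I])
  show ?thesis unfolding hit_def pred_def by (rule borel_measurable_eq[OF a b])
qed

lemma hit_past:
  assumes c: "leaders c" and k: "k < N" and w: "w \<in> paths_upto N" "w' \<in> paths_upto N"
    and ag: "\<And>i. i < N \<Longrightarrow> path_agree I (first_collision c w) (w i) (w' i)"
  shows "hit c k w' \<longleftrightarrow> hit c k w"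
proof -
  have q: "c (k - 1) < N" using leadersD(3)[OF c, of "k - 1"] k by simp
  have t: "first_collision c w' = first_collision c w" by (rule first_collision_past[OF c w ag])
  have "w i (first_collision c w) = w' i (first_collision c w)" if "i < N" for i
    using ag[OF that] first_collision(1)[OF c w(1)] by (simp add: path_agree_def)
  then show ?thesis unfolding hit_def t using q k by simp
qed

text \<open>
  Before the first collision no two leaders meet, with or without the exchange; from then on the
  exchange permutes the copies.
\<close>

lemma swap_futures_meet:
  fixes c :: "nat \<Rightarrow> nat"
  assumes c: "leaders c" and k: "0 < k" "k < N" "c k = k"
    and w: "w \<in> paths_upto N" "w \<in> E"
    and uv: "u < N" "v < N" "c u = u" "c v = v"
  defines "w' \<equiv> swap_futures I (c (k - 1)) k (first_collision c) E w"
    and "t \<equiv> Transposition.transpose (c (k - 1)) k"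
  shows "path_meet I T (w' u) (w' v) \<longleftrightarrow> path_meet I T (w (t u)) (w (t v))"
proof (cases "u = v")
  case True
  then show ?thesis by (simp add: path_meet_refl)
next
  case False
  let ?s = "first_collision c w"
  define q where "q = c (k - 1)"
  note f = first_collision[OF c w(1)]
  note p = pred_leader(1-3)[OF c k k(2), folded q_def]
  have w': "w' = w(q := path_switch I ?s (w q) (w k), k := path_switch I ?s (w k) (w q))"
    using w(2) by (simp add: w'_def swap_futures_def q_def)
  have t: "t = Transposition.transpose q k" by (simp add: t_def q_def)
  have before: "w' i r = w i r" if "r \<in> I" "r < ?s" for i r
    using that p(3) by (simp add: w' path_switch_def)
  have after: "w' i r = w (t i) r" if "r \<in> I" "?s \<le> r" for i r
    using that p(3) by (simp add: w' t path_switch_def Transposition.transpose_def)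
  have tl: "t i < N" "c (t i) = t i" if "i < N" "c i = i" for i
    using that p k by (auto simp: t Transposition.transpose_def)
  have ne: "t u \<noteq> t v" using False by (auto simp: t Transposition.transpose_def)
  have sep: "w a r \<noteq> w b r" if "a < N" "c a = a" "b < N" "c b = b" "a \<noteq> b" "r \<in> I" "r < ?s" for a b r
    using f(3)[OF that(6,7)] that unfolding collide_def by metis
  have "(r \<in> I \<and> r \<le> T \<and> w' u r = w' v r) \<longleftrightarrow> (r \<in> I \<and> r \<le> T \<and> w (t u) r = w (t v) r)" for r
  proof (cases "r \<in> I \<and> r < ?s")
    case True
    then show ?thesis
      using before[of r u] before[of r v] sep[of u v r] sep[of "t u" "t v" r] uv False ne tl[of u] tl[of v] by simp
  next
    case False
    then show ?thesis using after[of r u] after[of r v] by fastforce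
  qed
  then show ?thesis unfolding path_meet_def by blast
qed

text \<open>
  Averaging over \<open>w\<close> and \<open>sw w\<close>, the copies with exchanged futures, does not change expectations.
  For each outcome in \<open>E\<close> the sum of the two Pfaffians is the same for \<open>c\<close> and for \<open>merge c k\<close>.
\<close>

lemma expectation_merge:
  assumes c: "leaders c" and k: "0 < k" "k < N" "c k = k"
    and E: "past_event c E" and hit: "\<And>w. w \<in> E \<Longrightarrow> hit c k w"
  shows "(\<integral>w. indicator E w * meet_pfaffian c w \<partial>Q) = (\<integral>w. indicator E w * meet_pfaffian (merge c k) w \<partial>Q)"
proof -
  define q where "q = c (k - 1)"
  note p = pred_leader(1-3)[OF c k k(2), folded q_def]
  have qN: "q < N" using p(1) k(2) by simp
  have Em: "E \<in> sets \<Omega>" using E by (simp add: past_event_def)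
  define sw where "sw = swap_futures I q k (first_collision c) E"
  have past: "first_collision c w' = first_collision c w \<and> (w \<in> E \<longrightarrow> w' \<in> E)"
    if w: "w \<in> paths_upto N" "w' \<in> paths_upto N"
      "\<And>i. i < N \<Longrightarrow> path_agree I (first_collision c w) (w i) (w' i)" for w w'
    using first_collision_past[OF c w] past_eventD[OF E _ w(2,3)] by blast
  have meet: "w q (first_collision c w) = w k (first_collision c w)" if "w \<in> E" for w
    using hit[OF that] by (simp add: hit_def q_def)
  have \<tau>I: "first_collision c w \<in> I" if "w \<in> paths_upto N" for w by (rule first_collision(1)[OF c that])
  have sw_meas: "sw \<in> \<Omega> \<rightarrow>\<^sub>M \<Omega>"
    unfolding sw_def
    by (rule measurable_swap_futures[OF qN k(2) p(3) measurable_first_collision[OF c] _ Em]) (fact \<tau>I meet)+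
  have distr: "distr Q \<Omega> sw = Q"
    unfolding sw_def
  proof (rule distr_swap_futures[OF states qN k(2) p(3) measurable_first_collision[OF c] _ _ Em])
    show "first_collision c w \<in> I" if "w \<in> paths_upto N" for w using that by (rule \<tau>I)
    show "first_collision c w' = first_collision c w \<and> (w \<in> E \<longrightarrow> w' \<in> E)"
      if "w \<in> paths_upto N" "w' \<in> paths_upto N" "\<And>i. i < N \<Longrightarrow> path_agree I (first_collision c w) (w i) (w' i)" for w w'
      using that by (rule past)
    show "w q (first_collision c w) = w k (first_collision c w)" if "w \<in> E" for w using that by (rule meet)
  qed
  have sw_E: "sw w \<in> E \<longleftrightarrow> w \<in> E" if w: "w \<in> paths_upto N" for w
  proof (cases "w \<in> E")
    case True
    have "path_agree I (first_collision c w) (w i) (sw w i)" for i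
      using True meet[OF True] p(3) by (auto simp: sw_def swap_futures_def path_agree_def path_switch_def)
    moreover have "sw w \<in> paths_upto N"
      using measurable_space[OF sw_meas, of w] w by (simp add: space_paths)
    ultimately show ?thesis using past_eventD[OF E True] True by blast
  next
    case False
    then show ?thesis by (simp add: sw_def swap_futures_def)
  qed
  have swap: "integrable Q (\<lambda>w. indicator E w * meet_pfaffian d (sw w))"
    "(\<integral>w. indicator E w * meet_pfaffian d w \<partial>Q) = (\<integral>w. indicator E w * meet_pfaffian d (sw w) \<partial>Q)"
    if d: "\<And>i. i < N \<Longrightarrow> d i < N" for d
  proof -
    have swQ: "sw \<in> Q \<rightarrow>\<^sub>M \<Omega>" using sw_meas by (simp add: measurable_Q)
    have int: "integrable Q (\<lambda>w. indicator E w * meet_pfaffian d w)"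
      by (rule integrable_meet_pfaffian[OF d Em])
    have meas: "(\<lambda>w. indicator E w * meet_pfaffian d w) \<in> borel_measurable \<Omega>"
      using Em measurable_meet_pfaffian[OF d] by simp
    have eq: "indicator E (sw w) * meet_pfaffian d (sw w) = indicator E w * meet_pfaffian d (sw w)"
      if "w \<in> space Q" for w
      using sw_E that by (simp add: space_Q indicator_def)
    have "integrable (distr Q \<Omega> sw) (\<lambda>w. indicator E w * meet_pfaffian d w)" using int by (simp only: distr)
    then have "integrable Q (\<lambda>w. indicator E (sw w) * meet_pfaffian d (sw w))"
      by (rule integrable_distr[OF swQ])
    moreover have "integrable Q (\<lambda>w. indicator E (sw w) * meet_pfaffian d (sw w)) \<longleftrightarrow>
        integrable Q (\<lambda>w. indicator E w * meet_pfaffian d (sw w))"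
      by (rule Bochner_Integration.integrable_cong[OF refl eq])
    ultimately show "integrable Q (\<lambda>w. indicator E w * meet_pfaffian d (sw w))" by blast
    have "(\<integral>w. indicator E w * meet_pfaffian d w \<partial>Q) = (\<integral>w. indicator E w * meet_pfaffian d w \<partial>distr Q \<Omega> sw)"
      by (simp only: distr)
    also have "\<dots> = (\<integral>w. indicator E (sw w) * meet_pfaffian d (sw w) \<partial>Q)"
      by (rule integral_distr[OF swQ meas])
    also have "\<dots> = (\<integral>w. indicator E w * meet_pfaffian d (sw w) \<partial>Q)"
      by (rule Bochner_Integration.integral_cong[OF refl eq])
    finally show "(\<integral>w. indicator E w * meet_pfaffian d w \<partial>Q) = (\<integral>w. indicator E w * meet_pfaffian d (sw w) \<partial>Q)" .
  qed
  have dN: "c i < N" "merge c k i < N" if "i < N" for i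
    using leadersD(3)[OF c that] leadersD(3)[OF leaders_merge[OF c k] that] by simp_all
  have pointwise: "indicator E w * meet_pfaffian c w + indicator E w * meet_pfaffian c (sw w) =
      indicator E w * meet_pfaffian (merge c k) w + indicator E w * meet_pfaffian (merge c k) (sw w)" for w
  proof (cases "w \<in> E")
    case True
    have w: "w \<in> paths_upto N" by (rule past_event_paths[OF E True])
    have "path_meet I T (w q) (w k)"
      using meet[OF True] first_collision(1,2)[OF c w] by (auto simp: path_meet_def)
    then have "label_pfaffian n (\<lambda>u v. path_meet I T (w u) (w v)) c +
        label_pfaffian n (\<lambda>u v. path_meet I T (sw w u) (sw w v)) c =
      label_pfaffian n (\<lambda>u v. path_meet I T (w u) (w v)) (merge c k) +
        label_pfaffian n (\<lambda>u v. path_meet I T (sw w u) (sw w v)) (merge c k)"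
      unfolding sw_def q_def
      by (intro label_pfaffian_merge[OF c k] path_meet_refl swap_futures_meet[OF c k w True])
         (auto simp: path_meet_sym)
    then show ?thesis by (simp add: meet_pfaffian_def True)
  qed simp
  let ?a = "\<integral>w. indicator E w * meet_pfaffian c w \<partial>Q" and ?b = "\<integral>w. indicator E w * meet_pfaffian (merge c k) w \<partial>Q"
  have "?a + ?a = (\<integral>w. indicator E w * meet_pfaffian c w + indicator E w * meet_pfaffian c (sw w) \<partial>Q)"
    using Bochner_Integration.integral_add[OF integrable_meet_pfaffian[OF dN(1) Em] swap(1)[OF dN(1)]] swap(2)[OF dN(1)]
    by simp
  also have "\<dots> = (\<integral>w. indicator E w * meet_pfaffian (merge c k) w + indicator E w * meet_pfaffian (merge c k) (sw w) \<partial>Q)"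
    by (simp only: pointwise)
  also have "\<dots> = ?b + ?b"
    using Bochner_Integration.integral_add[OF integrable_meet_pfaffian[OF dN(2) Em] swap(1)[OF dN(2)]] swap(2)[OF dN(2)]
    by simp
  finally show ?thesis by simp
qed

definition ordered :: "(nat \<Rightarrow> real \<Rightarrow> real) \<Rightarrow> bool" where
  "ordered w \<longleftrightarrow> (\<forall>i j t. i < j \<longrightarrow> j < N \<longrightarrow> t \<in> I \<longrightarrow> w j t < w i t \<longrightarrow> (\<exists>u\<in>I. u \<le> t \<and> w i u = w j u))"

text \<open>
  At the first collision of leaders their copies are still in weak order. If the leaders \<open>a < b\<close>
  collide there, the leader preceding \<open>b\<close> is between them and hence at the same position.
\<close>

lemma no_hit_no_meeting:
  assumes c: "leaders c" and w: "w \<in> paths_upto N" and ord: "ordered w"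
    and no_hit: "\<And>k. 0 < k \<Longrightarrow> k < N \<Longrightarrow> c k = k \<Longrightarrow> \<not> hit c k w"
    and ij: "i < N" "j < N" "path_meet I T (w (c i)) (w (c j))"
  shows "c i = c j"
proof (rule ccontr)
  assume "c i \<noteq> c j"
  then obtain t where "t \<in> I" "t \<le> T" "collide c w t"
    using ij unfolding collide_def path_meet_def by blast
  note f = first_collision[OF c w]
  let ?s = "first_collision c w"
  have "collide c w ?s" using f(4) \<open>t \<in> I\<close> \<open>t \<le> T\<close> \<open>collide c w t\<close> by blast
  then obtain a b where ab: "a < b" "b < N" "c a = a" "c b = b" "w a ?s = w b ?s"
  proof -
    obtain a b where "a < N" "b < N" "c a \<noteq> c b" "w (c a) ?s = w (c b) ?s"
      using \<open>collide c w ?s\<close> by (auto simp: collide_def)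
    then show thesis
      using that[of "c a" "c b"] that[of "c b" "c a"] leadersD(2,3)[OF c] by (metis linorder_neqE_nat)
  qed
  define q where "q = c (b - 1)"
  have q: "q < b" "c q = q" using pred_leader(1,2)[OF c _ ab(2,4) ab(2)] ab(1) by (simp_all add: q_def)
  have "a \<le> q" using leadersD(4)[OF c, of a "b - 1"] ab by (simp add: q_def)
  have le: "w a' ?s \<le> w b' ?s" if l: "a' < b'" "b' < N" "c a' = a'" "c b' = b'" for a' b'
  proof (rule ccontr)
    assume "\<not> ?thesis"
    then have lt: "w b' ?s < w a' ?s" by simp
    then obtain u where u: "u \<in> I" "u \<le> ?s" "w a' u = w b' u"
      using ord l(1,2) f(1) unfolding ordered_def by blast
    then have "u < ?s" using lt by (cases "u = ?s") auto
    moreover have "collide c w u" using l u(3) unfolding collide_def by (metis less_trans nat_neq_iff)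
    ultimately show False using f(3)[OF u(1)] by blast
  qed
  have "w q ?s = w b ?s"
  proof (cases "a = q")
    case True
    then show ?thesis using ab(5) by simp
  next
    case False
    then have "a < q" using \<open>a \<le> q\<close> by simp
    then show ?thesis using le[of a q] le[of q b] q ab by simp
  qed
  then have "hit c b w" by (simp add: hit_def q_def)
  moreover have "0 < b" using ab(1) by simp
  ultimately show False using no_hit[OF _ ab(2,4)] by blast
qed

definition pairs_coalesced :: "(nat \<Rightarrow> real \<Rightarrow> real) set" where
  "pairs_coalesced = {w \<in> paths_upto N. \<forall>i<n. coalesced w (2 * i) T = coalesced w (2 * i + 1) T}"

text \<open>
  The event \<open>D\<close> is split according to the smallest leader \<open>k\<close> that is hit at the first collision. On
  the part where \<open>k\<close> is hit, the cluster of \<open>k\<close> is merged with the preceding one, and the induction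
  hypothesis applies to fewer leaders. If no leader is hit, there is no collision at all up to time
  \<open>T\<close>, and the Pfaffian is the indicator of the event that the pairs have coalesced.
\<close>

lemma expectation_eq_prob:
  assumes ord: "AE w in Q. ordered w" and G: "pairs_coalesced \<in> sets \<Omega>"
  shows "leaders c \<Longrightarrow> past_event c D \<Longrightarrow> (\<And>w. w \<in> D \<Longrightarrow> merged c w (first_collision c w)) \<Longrightarrow>
    (\<integral>w. indicator D w * meet_pfaffian c w \<partial>Q) = measure Q (D \<inter> pairs_coalesced)"
proof (induction "card {k. 0 < k \<and> k < N \<and> c k = k}" arbitrary: c D rule: less_induct)
  case less
  note c = less.prems(1) and D = less.prems(2) and merged = less.prems(3)
  define K where "K = {k. 0 < k \<and> k < N \<and> c k = k}"
  have K: "0 < k" "k < N" "c k = k" if "k \<in> K" for k using that by (auto simp: K_def)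
  have fin: "finite K" unfolding K_def by (rule finite_subset[of _ "{..<N}"]) auto
  have Dm: "D \<in> sets \<Omega>" using D by (simp add: past_event_def)
  have Dp: "w \<in> paths_upto N" if "w \<in> D" for w by (rule past_event_paths[OF D that])
  define E where "E k = {w \<in> D. hit c k w \<and> (\<forall>k'\<in>K. k' < k \<longrightarrow> \<not> hit c k' w)}" for k
  define E0 where "E0 = {w \<in> D. \<forall>k\<in>K. \<not> hit c k w}"
  have hit_meas: "{w \<in> space \<Omega>. hit c k w} \<in> sets \<Omega>" if "k \<in> K" for k
    using measurable_hit[OF c K(2)[OF that]] by (simp add: pred_def)
  have E0m: "E0 \<in> sets \<Omega>"
  proof -
    have "E0 = D - (\<Union>k\<in>K. {w \<in> space \<Omega>. hit c k w})" using Dp by (auto simp: E0_def space_paths)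
    then show ?thesis using Dm hit_meas fin by auto
  qed
  have Em: "E k \<in> sets \<Omega>" if "k \<in> K" for k
  proof -
    have "E k = D \<inter> {w \<in> space \<Omega>. hit c k w} - (\<Union>k'\<in>{k'\<in>K. k' < k}. {w \<in> space \<Omega>. hit c k' w})"
      using Dp by (auto simp: E_def space_paths)
    then show ?thesis using Dm hit_meas that fin by auto
  qed
  have past: "past_event c (E k)" if k: "k \<in> K" for k
    unfolding past_event_def
  proof (intro conjI ballI impI)
    show "E k \<in> sets \<Omega>" by (rule Em[OF k])
    fix w w' assume w: "w \<in> E k" "w' \<in> paths_upto N"
      and ag: "\<forall>i<N. path_agree I (first_collision c w) (w i) (w' i)"
    have wD: "w \<in> D" using w by (simp add: E_def)
    have "hit c k' w' \<longleftrightarrow> hit c k' w" if "k' \<in> K" for k'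
      using hit_past[OF c K(2)[OF that] Dp[OF wD] w(2)] ag by blast
    moreover have "w' \<in> D" using past_eventD[OF D wD w(2)] ag by blast
    ultimately show "w' \<in> E k" using w(1) k by (auto simp: E_def)
  qed
  have partition: "indicator D w = indicator E0 w + (\<Sum>k\<in>K. indicator (E k) w :: real)" for w
  proof (cases "w \<in> D \<and> (\<exists>k\<in>K. hit c k w)")
    case True
    define m where "m = (LEAST k. k \<in> K \<and> hit c k w)"
    have m: "m \<in> K" "hit c m w"
      using LeastI_ex[of "\<lambda>k. k \<in> K \<and> hit c k w"] True by (auto simp: m_def)
    have "w \<in> E k \<longleftrightarrow> k = m" if "k \<in> K" for k
    proof
      assume "w \<in> E k"
      then have "hit c k w" "\<not> m < k" using m by (auto simp: E_def)
      moreover have "m \<le> k" unfolding m_def using \<open>hit c k w\<close> that by (intro Least_le) simp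
      ultimately show "k = m" by simp
    next
      assume "k = m"
      have "\<not> hit c k' w" if "k' \<in> K" "k' < m" for k'
        using not_less_Least[of k' "\<lambda>k. k \<in> K \<and> hit c k w"] that by (auto simp: m_def)
      then show "w \<in> E k" using True m \<open>k = m\<close> by (auto simp: E_def)
    qed
    then have "(\<Sum>k\<in>K. indicator (E k) w) = (\<Sum>k\<in>K. if k = m then 1 else 0 :: real)"
      by (intro sum.cong refl) (simp add: indicator_def)
    also have "\<dots> = 1" using fin m by simp
    finally have "(\<Sum>k\<in>K. indicator (E k) w) = (1 :: real)" .
    moreover have "w \<notin> E0" using True by (auto simp: E0_def)
    ultimately show ?thesis using True by simp
  next
    case False
    then have "(\<Sum>k\<in>K. indicator (E k) w) = (0 :: real)"
      by (intro sum.neutral ballI) (auto simp: E_def indicator_def)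
    then show ?thesis using False by (auto simp: E0_def indicator_def)
  qed
  have cN: "c i < N" if "i < N" for i by (rule leadersD(3)[OF c that])
  have step: "(\<integral>w. indicator (E k) w * meet_pfaffian c w \<partial>Q) = measure Q (E k \<inter> pairs_coalesced)" if k: "k \<in> K" for k
  proof -
    have "(\<integral>w. indicator (E k) w * meet_pfaffian c w \<partial>Q) = (\<integral>w. indicator (E k) w * meet_pfaffian (merge c k) w \<partial>Q)"
      by (rule expectation_merge[OF c K[OF k] past[OF k]]) (simp add: E_def)
    also have "\<dots> = measure Q (E k \<inter> pairs_coalesced)"
    proof (rule less.hyps)
      have "{k'. 0 < k' \<and> k' < N \<and> merge c k k' = k'} \<subseteq> K - {k}"
        using pred_leader(2,3)[OF c K[OF k] K(2)[OF k]] by (auto simp: merge_def K_def K(3)[OF k] split: if_splits)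
      then have "card {k'. 0 < k' \<and> k' < N \<and> merge c k k' = k'} \<le> card (K - {k})"
        using fin by (intro card_mono) auto
      also have "\<dots> < card K" using fin k by (intro card_Diff1_less)
      finally show "card {k'. 0 < k' \<and> k' < N \<and> merge c k k' = k'} < card {k. 0 < k \<and> k < N \<and> c k = k}"
        by (simp add: K_def)
      show l: "leaders (merge c k)" by (rule leaders_merge[OF c K[OF k]])
      show "past_event (merge c k) (E k)" by (rule past_event_merge[OF c K[OF k] past[OF k]])
      fix w assume w: "w \<in> E k"
      then have wD: "w \<in> D" and h: "hit c k w" by (simp_all add: E_def)
      note wp = Dp[OF wD]
      show "merged (merge c k) w (first_collision (merge c k) w)"
        by (rule merged_until_collision[OF l wp first_collision(1)[OF c wp] first_collision_merge[OF c K[OF k] wp]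
              merged_merge[OF c K[OF k] wp merged[OF wD] h[unfolded hit_def]]])
    qed
    finally show ?thesis .
  qed
  have base: "(\<integral>w. indicator E0 w * meet_pfaffian c w \<partial>Q) = measure Q (E0 \<inter> pairs_coalesced)"
  proof -
    have "AE w in Q. indicator E0 w * meet_pfaffian c w = indicator (E0 \<inter> pairs_coalesced) w"
      using ord
    proof eventually_elim
      case (elim w)
      show ?case
      proof (cases "w \<in> E0")
        case True
        then have wD: "w \<in> D" and no_hit: "\<And>k. 0 < k \<Longrightarrow> k < N \<Longrightarrow> c k = k \<Longrightarrow> \<not> hit c k w"
          by (auto simp: E0_def K_def)
        note wp = Dp[OF wD]
        have sep: "c i = c j" if "i < N" "j < N" "path_meet I T (w (c i)) (w (c j))" for i j
          by (rule no_hit_no_meeting[OF c wp elim no_hit that])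
        have "meet_pfaffian c w = of_bool (\<forall>i<n. c (2 * i) = c (2 * i + 1))"
          unfolding meet_pfaffian_def
          by (rule label_pfaffian_separated) (use path_meet_refl leadersD(4)[OF c] sep in auto)
        moreover have "coalesced w (2 * i) T = coalesced w (2 * i + 1) T \<longleftrightarrow> c (2 * i) = c (2 * i + 1)" if "i < n" for i
          using that by (intro merged_no_collision[OF c wp merged[OF wD] sep]) auto
        ultimately show ?thesis using True wp by (simp add: pairs_coalesced_def indicator_def)
      qed simp
    qed
    then have "(\<integral>w. indicator E0 w * meet_pfaffian c w \<partial>Q) = (\<integral>w. indicator (E0 \<inter> pairs_coalesced) w \<partial>Q)"
      using E0m G measurable_meet_pfaffian[OF cN] by (intro integral_cong_AE) (simp_all add: measurable_Q)
    also have "\<dots> = measure Q (E0 \<inter> pairs_coalesced)"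
      using E0m G by (simp add: sets_Q Int_absorb2 sets.sets_into_space)
    finally show ?thesis .
  qed
  have "(\<integral>w. indicator D w * meet_pfaffian c w \<partial>Q) =
      (\<integral>w. indicator E0 w * meet_pfaffian c w + (\<Sum>k\<in>K. indicator (E k) w * meet_pfaffian c w) \<partial>Q)"
    by (simp add: partition distrib_right sum_distrib_right)
  also have "\<dots> = (\<integral>w. indicator E0 w * meet_pfaffian c w \<partial>Q) + (\<Sum>k\<in>K. \<integral>w. indicator (E k) w * meet_pfaffian c w \<partial>Q)"
    by (simp add: integrable_meet_pfaffian[OF cN] E0m Em)
  also have "\<dots> = measure Q (E0 \<inter> pairs_coalesced) + (\<Sum>k\<in>K. measure Q (E k \<inter> pairs_coalesced))"
    by (simp add: base step)
  also have "\<dots> = (\<integral>w. indicator (E0 \<inter> pairs_coalesced) w + (\<Sum>k\<in>K. indicator (E k \<inter> pairs_coalesced) w) \<partial>Q)"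
  proof -
    have m: "A \<inter> pairs_coalesced \<in> sets Q" if "A \<in> sets \<Omega>" for A using that G by (simp add: sets_Q)
    have i: "integrable Q (indicator (A \<inter> pairs_coalesced) :: _ \<Rightarrow> real)"
      "(\<integral>w. indicator (A \<inter> pairs_coalesced) w \<partial>Q) = measure Q (A \<inter> pairs_coalesced)" if "A \<in> sets \<Omega>" for A
      using m[OF that] by (simp_all add: Q.emeasure_eq_measure)
    show ?thesis
      using i[OF E0m] i[OF Em] by (simp add: Bochner_Integration.integral_add Bochner_Integration.integral_sum)
  qed
  also have "\<dots> = (\<integral>w. indicator (D \<inter> pairs_coalesced) w \<partial>Q)"
    by (simp add: partition indicator_inter_arith distrib_right sum_distrib_right)
  also have "\<dots> = measure Q (D \<inter> pairs_coalesced)"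
    using Dm G by (simp add: sets_Q Int_absorb2 sets.sets_into_space)
  finally show ?case .
qed

end

section \<open>The Pfaffian of independent copies\<close>

context skip_free_process
begin

text \<open>
  A strict inequality between right-continuous paths persists for a short time to the right.
\<close>

lemma path_before_iff_rational:
  assumes v: "v \<in> skip_free_paths S I" and w: "w \<in> skip_free_paths S I" and t: "t \<in> I"
  shows "(\<exists>s\<in>I. s \<le> t \<and> w s < v s) \<longleftrightarrow> (\<exists>q\<in>I \<inter> ({..t} \<inter> \<rat> \<union> {t}). w q < v q)"
proof
  assume "\<exists>s\<in>I. s \<le> t \<and> w s < v s"
  then obtain s where s: "s \<in> I" "s \<le> t" "w s < v s" by blast
  obtain X where X: "\<And>k. X k \<in> I \<inter> ({..t} \<inter> \<rat> \<union> {t})" "\<And>k. s \<le> X k" "X \<longlonglongrightarrow> s"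
    using rational_times_from_right[OF s(1) t s(2)] by blast
  have XI: "X k \<in> I" for k using X(1) by blast
  have "(\<lambda>k. v (X k) - w (X k)) \<longlonglongrightarrow> v s - w s"
    by (intro tendsto_diff path_right_limit[OF v s(1) XI X(2,3)] path_right_limit[OF w s(1) XI X(2,3)])
  then have "\<forall>\<^sub>F k in sequentially. 0 < v (X k) - w (X k)"
    using s(3) by (intro order_tendstoD(1)) auto
  then obtain k where "0 < v (X k) - w (X k)"
    using eventually_happens trivial_limit_sequentially by blast
  then show "\<exists>q\<in>I \<inter> ({..t} \<inter> \<rat> \<union> {t}). w q < v q" using X(1)[of k] by (intro bexI[of _ "X k"]) auto
qed auto

lemma measurable_cross_or_meet:
  assumes f: "f \<in> M \<rightarrow>\<^sub>M path_space S I" and g: "g \<in> M \<rightarrow>\<^sub>M path_space S I" and t: "t \<in> I"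
  shows "Measurable.pred M (\<lambda>x. cross_or_meet I t (f x) (g x))"
proof -
  let ?D = "I \<inter> ({..t} \<inter> \<rat> \<union> {t})"
  have cD: "countable ?D" using countable_rat by (auto intro: countable_subset[of _ "\<rat> \<union> {t}"])
  have before: "Measurable.pred M (\<lambda>x. \<exists>s\<in>I. s \<le> t \<and> h x s < k x s)"
    if h: "h \<in> M \<rightarrow>\<^sub>M path_space S I" and k: "k \<in> M \<rightarrow>\<^sub>M path_space S I" for h k
  proof -
    have "Measurable.pred M (\<lambda>x. h x q < k x q)" if q: "q \<in> ?D" for q
    proof -
      have a: "(\<lambda>x. h x q) \<in> borel_measurable M" using q by (intro measurable_path_component[OF h]) auto
      have b: "(\<lambda>x. k x q) \<in> borel_measurable M" using q by (intro measurable_path_component[OF k]) auto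
      show ?thesis unfolding pred_def by (rule borel_measurable_less[OF a b])
    qed
    then have "(\<Union>q\<in>?D. {x \<in> space M. h x q < k x q}) \<in> sets M"
      using cD by (intro sets.countable_UN') (auto simp: pred_def)
    also have "(\<Union>q\<in>?D. {x \<in> space M. h x q < k x q}) = {x \<in> space M. \<exists>q\<in>?D. h x q < k x q}" by blast
    finally have "Measurable.pred M (\<lambda>x. \<exists>q\<in>?D. h x q < k x q)" by (simp only: pred_def)
    then show ?thesis
      by (rule measurable_cong[THEN iffD2, rotated])
        (rule path_before_iff_rational[OF path_space_value[OF k] path_space_value[OF h] t])
  qed
  note z = measurable_path_component[OF f zero_time] measurable_path_component[OF g zero_time]
  have fg: "Measurable.pred M (\<lambda>x. f x 0 < g x 0)" unfolding pred_def by (rule borel_measurable_less[OF z])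
  have gf: "Measurable.pred M (\<lambda>x. g x 0 < f x 0)" unfolding pred_def by (rule borel_measurable_less[OF z(2,1)])
  have "cross_or_meet I t v w \<longleftrightarrow> path_meet I t v w \<or>
      (v 0 < w 0 \<and> (\<exists>s\<in>I. s \<le> t \<and> w s < v s)) \<or> (w 0 < v 0 \<and> (\<exists>s\<in>I. s \<le> t \<and> v s < w s))" for v w
    unfolding cross_or_meet_def path_meet_def by blast
  then show ?thesis
    using measurable_path_meet[OF f g t] before[OF f g] before[OF g f] fg gf
    by (simp only:) (intro pred_intros_logic)
qed

end

context independent_copies
begin

lemma distr_two_copies:
  assumes "j < N" "k < N" "j \<noteq> k"
  shows "distr Q (path_space S I \<Otimes>\<^sub>M path_space S I) (\<lambda>w. (w k, w j)) = P 0 (x k) \<Otimes>\<^sub>M P 0 (x j)"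
proof (rule measure_eqI)
  let ?PS = "path_space S I"
  interpret K: prob_space "P 0 (x k)" using states by (simp add: prob_space_law)
  interpret J: prob_space "P 0 (x j)" using states by (simp add: prob_space_law)
  interpret R: prob_space "\<Pi>\<^sub>M i\<in>{..<N} - {j, k}. P 0 (x i)"
    using states by (intro prob_space_PiM prob_space_law) auto
  have s: "sets (P 0 (x k) \<Otimes>\<^sub>M P 0 (x j)) = sets (?PS \<Otimes>\<^sub>M ?PS)"
    using states by (intro sets_pair_measure_cong) (simp_all add: sets_law)
  then show "sets (distr Q (?PS \<Otimes>\<^sub>M ?PS) (\<lambda>w. (w k, w j))) = sets (P 0 (x k) \<Otimes>\<^sub>M P 0 (x j))" by simp
  fix A assume "A \<in> sets (distr Q (?PS \<Otimes>\<^sub>M ?PS) (\<lambda>w. (w k, w j)))"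
  then have A: "A \<in> sets (?PS \<Otimes>\<^sub>M ?PS)" by simp
  have pair: "(\<lambda>w. (w k, w j)) \<in> \<Omega> \<rightarrow>\<^sub>M ?PS \<Otimes>\<^sub>M ?PS"
    by (rule measurable_Pair[OF measurable_copy[OF assms(2)] measurable_copy[OF assms(1)]])
  then have pairQ: "(\<lambda>w. (w k, w j)) \<in> Q \<rightarrow>\<^sub>M ?PS \<Otimes>\<^sub>M ?PS" by (simp only: measurable_Q)
  have ind: "indicator A \<in> borel_measurable (?PS \<Otimes>\<^sub>M ?PS)" using A by simp
  have "emeasure (distr Q (?PS \<Otimes>\<^sub>M ?PS) (\<lambda>w. (w k, w j))) A =
      (\<integral>\<^sup>+z. indicator A z \<partial>distr Q (?PS \<Otimes>\<^sub>M ?PS) (\<lambda>w. (w k, w j)))"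
    using A by simp
  also have "\<dots> = (\<integral>\<^sup>+w. indicator A (w k, w j) \<partial>Q)"
    using A by (intro nn_integral_distr[OF pairQ]) simp
  also have "\<dots> = (\<integral>\<^sup>+z. \<integral>\<^sup>+w. \<integral>\<^sup>+v. indicator A (w, v) \<partial>P 0 (x j) \<partial>P 0 (x k) \<partial>(\<Pi>\<^sub>M i\<in>{..<N} - {j, k}. P 0 (x i)))"
    using assms by (subst product_nn_integral_two[OF states assms measurable_compose[OF pair ind]]) simp
  also have "\<dots> = (\<integral>\<^sup>+w. \<integral>\<^sup>+v. indicator A (w, v) \<partial>P 0 (x j) \<partial>P 0 (x k))"
    by (simp add: R.emeasure_space_1)
  also have "\<dots> = emeasure (P 0 (x k) \<Otimes>\<^sub>M P 0 (x j)) A"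
    using A by (subst J.emeasure_pair_measure) (simp_all add: s)
  finally show "emeasure (distr Q (?PS \<Otimes>\<^sub>M ?PS) (\<lambda>w. (w k, w j))) A = emeasure (P 0 (x k) \<Otimes>\<^sub>M P 0 (x j)) A" .
qed

lemma AE_two_copies:
  assumes "j < N" "k < N" "j \<noteq> k" and ae: "AE z in P 0 (x k) \<Otimes>\<^sub>M P 0 (x j). R (fst z) (snd z)"
  shows "AE w in Q. R (w k) (w j)"
proof -
  have pair: "(\<lambda>w. (w k, w j)) \<in> Q \<rightarrow>\<^sub>M path_space S I \<Otimes>\<^sub>M path_space S I"
    unfolding measurable_Q
    by (rule measurable_Pair[OF measurable_copy[OF assms(2)] measurable_copy[OF assms(1)]])
  have "AE z in distr Q (path_space S I \<Otimes>\<^sub>M path_space S I) (\<lambda>w. (w k, w j)). R (fst z) (snd z)"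
    unfolding distr_two_copies[OF assms(1-3)] by (rule ae)
  from AE_distrD[OF pair this] show ?thesis by (simp only: fst_conv snd_conv)
qed

lemma AE_start:
  assumes "i < N"
  shows "AE w in Q. w i 0 = x i"
  by (rule AE_PiM_component[OF prob_space_law[OF zero_time states] _ start[OF zero_time states]])
    (simp add: assms)

lemma AE_ordered: "AE w in Q. ordered w"
proof -
  have "AE w in Q. \<forall>t\<in>I. w j t < w i t \<longrightarrow> (\<exists>u\<in>I. u \<le> t \<and> w i u = w j u)" if ij: "i < j" "j < N" for i j
  proof (cases "x i < x j")
    case True
    have "AE z in P 0 (x i) \<Otimes>\<^sub>M P 0 (x j). \<forall>t\<in>I. snd z t < fst z t \<longrightarrow> (\<exists>u\<in>I. u \<le> t \<and> fst z u = snd z u)"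
      using no_swap[OF zero_time states states True] by (simp add: split_beta')
    from AE_two_copies[OF ij(2) _ _ this] ij show ?thesis by simp
  next
    case False
    then have eq: "x i = x j" using increasing[of i j] ij by simp
    have "i < N" using ij by simp
    from AE_start[OF this] AE_start[OF ij(2)] show ?thesis
    proof eventually_elim
      case (elim w)
      then have "w i 0 = w j 0" using eq by simp
      moreover have "0 \<le> t" if "t \<in> I" for t using that by (rule time_nonneg)
      ultimately show ?case by (intro ballI impI bexI[of _ 0]) simp_all
    qed
  qed
  then have pair: "AE w in Q. i < j \<longrightarrow> (\<forall>t\<in>I. w j t < w i t \<longrightarrow> (\<exists>u\<in>I. u \<le> t \<and> w i u = w j u))"
    if "j < N" for i j
    using that by (cases "i < j") simp_all
  have "AE w in Q. \<forall>j\<in>{..<N}. \<forall>i\<in>{..<N}. i < j \<longrightarrow>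
      (\<forall>t\<in>I. w j t < w i t \<longrightarrow> (\<exists>u\<in>I. u \<le> t \<and> w i u = w j u))"
    by (rule AE_finite_allI[OF finite_lessThan], rule AE_finite_allI[OF finite_lessThan], rule pair) simp
  then show ?thesis
  proof eventually_elim
    case (elim w)
    show ?case unfolding ordered_def
    proof (intro allI impI)
      fix i j t assume ij: "i < j" "j < N" "t \<in> I" "w j t < w i t"
      then have "i < N" by simp
      then show "\<exists>u\<in>I. u \<le> t \<and> w i u = w j u" using elim ij by blast
    qed
  qed
qed

lemma indep_copies: "0 < n \<Longrightarrow> Q.indep_vars (\<lambda>_. path_space S I) (\<lambda>i w. w i) {..<N}"
proof (subst Q.indep_vars_iff_distr_eq_PiM')
  assume "0 < n" then show "{..<N} \<noteq> {}" by (auto simp: lessThan_empty_iff)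
  show "(\<lambda>w. w i) \<in> Q \<rightarrow>\<^sub>M path_space S I" if "i \<in> {..<N}" for i
    using that measurable_copy[of i] by (simp add: measurable_Q)
  have "distr Q \<Omega> (\<lambda>w. \<lambda>i\<in>{..<N}. w i) = distr Q Q (\<lambda>w. w)"
    by (intro distr_cong refl) (simp_all add: sets_Q space_Q paths_upto_def PiE_restrict)
  also have "\<dots> = Q" by (rule distr_id)
  also have "\<dots> = (\<Pi>\<^sub>M i\<in>{..<N}. distr Q (path_space S I) (\<lambda>w. w i))"
  proof (intro PiM_cong refl)
    fix i assume i: "i \<in> {..<N}"
    have "distr Q (path_space S I) (\<lambda>w. w i) = distr Q (P 0 (x i)) (\<lambda>w. w i)"
      using states by (intro distr_cong) (simp_all add: sets_law)
    also have "\<dots> = P 0 (x i)" using states i by (intro distr_PiM_component prob_space_law) auto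
    finally show "P 0 (x i) = distr Q (path_space S I) (\<lambda>w. w i)" ..
  qed
  finally show "distr Q \<Omega> (\<lambda>w. \<lambda>i\<in>{..<N}. w i) = (\<Pi>\<^sub>M i\<in>{..<N}. distr Q (path_space S I) (\<lambda>w. w i))" .
qed

text \<open>
  A permutation arranges the copies in disjoint pairs, and disjoint pairs are independent.
\<close>

lemma expectation_prod_meet:
  assumes p: "p permutes {..<N}"
  shows "(\<integral>w. (\<Prod>i<n. of_bool (path_meet I T (w (p (2 * i))) (w (p (2 * i + 1)))) :: real) \<partial>Q) =
    (\<Prod>i<n. \<integral>w. of_bool (path_meet I T (w (p (2 * i))) (w (p (2 * i + 1)))) \<partial>Q)"
proof (cases "n = 0")
  case True
  then show ?thesis using Q.prob_space by simp
next
  case False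
  define K where "K i = {p (2 * i), p (2 * i + 1)}" for i
  have lt: "p (2 * i) < N" "p (2 * i + 1) < N" if "i < n" for i
    using permutes_in_image[OF p, of "2 * i"] permutes_in_image[OF p, of "2 * i + 1"] that by auto
  have sub: "K i \<subseteq> {..<N}" if "i \<in> {..<n}" for i using lt that by (auto simp: K_def)
  have inj: "inj p" by (rule permutes_inj[OF p])
  have disj: "disjoint_family_on K {..<n}"
    unfolding disjoint_family_on_def
  proof (intro ballI impI)
    fix i j :: nat assume "i \<noteq> j"
    then have "2 * i \<noteq> 2 * j" "2 * i \<noteq> 2 * j + 1" "2 * i + 1 \<noteq> 2 * j" "2 * i + 1 \<noteq> 2 * j + 1" by presburger+
    then show "K i \<inter> K j = {}" unfolding K_def by (simp add: inj_eq[OF inj])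
  qed
  define Y where "Y i u = (of_bool (path_meet I T (u (p (2 * i))) (u (p (2 * i + 1)))) :: real)"
    for i and u :: "nat \<Rightarrow> real \<Rightarrow> real"
  have Y: "Y i \<in> borel_measurable (\<Pi>\<^sub>M j\<in>K i. path_space S I)" for i
  proof -
    have "Measurable.pred (\<Pi>\<^sub>M j\<in>K i. path_space S I) (\<lambda>u. path_meet I T (u (p (2 * i))) (u (p (2 * i + 1))))"
      by (intro measurable_path_meet measurable_component_singleton time) (auto simp: K_def)
    then show ?thesis unfolding Y_def[abs_def] by simp
  qed
  have ind: "Q.indep_vars (\<lambda>_. borel) (\<lambda>i w. Y i (restrict (\<lambda>j. w j) (K i))) {..<n}"
    by (rule Q.indep_vars_compose2[OF Q.indep_vars_restrict[OF indep_copies sub disj] Y]) (use False in simp)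
  have Ymeas: "(\<lambda>w. Y i (restrict (\<lambda>j. w j) (K i))) \<in> borel_measurable Q" if "i \<in> {..<n}" for i
    using ind that unfolding Q.indep_vars_def by blast
  have Yint: "integrable Q (\<lambda>w. Y i (restrict (\<lambda>j. w j) (K i)))" if "i \<in> {..<n}" for i
    by (rule Q.integrable_const_bound[of _ 1, OF _ Ymeas[OF that]]) (simp add: Y_def)
  have eq: "Y i (restrict (\<lambda>j. w j) (K i)) = of_bool (path_meet I T (w (p (2 * i))) (w (p (2 * i + 1))))" for i w
    by (simp add: Y_def K_def)
  show ?thesis
    using Q.indep_vars_lebesgue_integral[OF finite_lessThan ind Yint] unfolding eq .
qed

text \<open>
  Almost surely the copies start in weak order and cannot be in reversed order before they have met.
\<close>

lemma prob_meet_eq_cross_or_meet: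
  assumes kl: "k < l" "l < N"
  shows "(\<integral>w. of_bool (path_meet I T (w k) (w l)) \<partial>Q) = cross_or_meet_prob I P T (x k) (x l)"
proof -
  let ?PS = "path_space S I" and ?PP = "P 0 (x k) \<Otimes>\<^sub>M P 0 (x l)"
  have k: "k < N" using kl by simp
  have s: "sets ?PP = sets (?PS \<Otimes>\<^sub>M ?PS)"
    using states by (intro sets_pair_measure_cong) (simp_all add: sets_law)
  have pred: "Measurable.pred (?PS \<Otimes>\<^sub>M ?PS) (\<lambda>z. cross_or_meet I T (fst z) (snd z))"
    by (rule measurable_cross_or_meet[OF measurable_fst measurable_snd time])
  let ?C = "{z \<in> space ?PP. cross_or_meet I T (fst z) (snd z)}"
  have Cm: "?C \<in> sets (?PS \<Otimes>\<^sub>M ?PS)"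
    using pred sets_eq_imp_space_eq[OF s] by (simp add: pred_def)
  have pair: "(\<lambda>w. (w k, w l)) \<in> Q \<rightarrow>\<^sub>M ?PS \<Otimes>\<^sub>M ?PS"
    unfolding measurable_Q by (rule measurable_Pair[OF measurable_copy[OF k] measurable_copy[OF kl(2)]])
  have pathm: "Measurable.pred \<Omega> (\<lambda>w. path_meet I T (w k) (w l))"
    by (rule measurable_meet_copies[OF k kl(2)])
  have "cross_or_meet_prob I P T (x k) (x l) = measure ?PP ?C"
    unfolding cross_or_meet_prob_def by (simp add: split_beta')
  also have "\<dots> = measure (distr Q (?PS \<Otimes>\<^sub>M ?PS) (\<lambda>w. (w k, w l))) ?C"
    using distr_two_copies[OF kl(2) k] kl by simp
  also have "\<dots> = measure Q ((\<lambda>w. (w k, w l)) -` ?C \<inter> space Q)"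
    by (rule measure_distr[OF pair Cm])
  also have "\<dots> = measure Q {w \<in> space Q. path_meet I T (w k) (w l)}"
  proof (rule Q.finite_measure_eq_AE)
    show "(\<lambda>w. (w k, w l)) -` ?C \<inter> space Q \<in> sets Q" by (rule measurable_sets[OF pair Cm])
    show "{w \<in> space Q. path_meet I T (w k) (w l)} \<in> sets Q"
      using pathm by (simp add: pred_def sets_Q space_Q space_paths)
    show "AE w in Q. w \<in> (\<lambda>w. (w k, w l)) -` ?C \<inter> space Q \<longleftrightarrow> w \<in> {w \<in> space Q. path_meet I T (w k) (w l)}"
      using AE_start[OF k] AE_start[OF kl(2)] AE_ordered AE_space
    proof eventually_elim
      case (elim w)
      have sp: "(w k, w l) \<in> space ?PP"
        using measurable_space[OF pair elim(4)] sets_eq_imp_space_eq[OF s] by simp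
      have "\<not> w l 0 < w k 0" using elim(1,2) increasing[of k l] kl by simp
      then have "cross_or_meet I T (w k) (w l) \<longleftrightarrow> path_meet I T (w k) (w l)"
        using elim(3) kl unfolding cross_or_meet_def path_meet_def ordered_def by (meson order_trans)
      then show ?case using sp elim(4) by simp
    qed
  qed
  also have "\<dots> = (\<integral>w. indicator {w \<in> space Q. path_meet I T (w k) (w l)} w \<partial>Q)"
    using pathm by (simp add: pred_def sets_Q space_Q space_paths Int_absorb2)
  also have "\<dots> = (\<integral>w. of_bool (path_meet I T (w k) (w l)) \<partial>Q)"
    by (intro Bochner_Integration.integral_cong) (auto simp: indicator_def)
  finally show ?thesis ..
qed

lemma expectation_meet_pfaffian:
  assumes A: "\<And>k l. k < l \<Longrightarrow> l < N \<Longrightarrow> A k l = cross_or_meet_prob I P T (x k) (x l)"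
    and anti: "\<And>k l. k < N \<Longrightarrow> l < N \<Longrightarrow> A l k = - A k l"
  shows "(\<integral>w. meet_pfaffian (\<lambda>i. i) w \<partial>Q) = pfaffian n A"
proof -
  let ?m = "\<lambda>k l w. of_bool (path_meet I T (w k) (w l)) :: real"
  have A': "A k l = sgn (real l - real k) * (\<integral>w. ?m k l w \<partial>Q)" if "k < N" "l < N" "k \<noteq> l" for k l
  proof (cases "k < l")
    case True
    then show ?thesis using A[OF True] that prob_meet_eq_cross_or_meet[OF True] by simp
  next
    case False
    then have lk: "l < k" using that by simp
    have "A k l = - (\<integral>w. ?m l k w \<partial>Q)"
      using anti[OF that(2,1)] A[OF lk that(1)] prob_meet_eq_cross_or_meet[OF lk that(1)] by simp
    then show ?thesis using lk by (simp add: path_meet_sym[of "_ l"])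
  qed
  have summand: "(\<integral>w. of_int (sign p) * (\<Prod>i<n. sgn (real (p (2 * i + 1)) - real (p (2 * i))) * ?m (p (2 * i)) (p (2 * i + 1)) w) \<partial>Q) =
      of_int (sign p) * (\<Prod>i<n. A (p (2 * i)) (p (2 * i + 1)))" if p: "p permutes {..<N}" for p
  proof -
    have lt: "p (2 * i) < N" "p (2 * i + 1) < N" "p (2 * i) \<noteq> p (2 * i + 1)" if "i < n" for i
      using permutes_in_image[OF p, of "2 * i"] permutes_in_image[OF p, of "2 * i + 1"] that
        inj_eq[OF permutes_inj[OF p], of "2 * i" "2 * i + 1"] by auto
    have "(\<integral>w. of_int (sign p) * (\<Prod>i<n. sgn (real (p (2 * i + 1)) - real (p (2 * i))) * ?m (p (2 * i)) (p (2 * i + 1)) w) \<partial>Q) =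
      of_int (sign p) * (\<Prod>i<n. sgn (real (p (2 * i + 1)) - real (p (2 * i)))) *
        (\<integral>w. (\<Prod>i<n. ?m (p (2 * i)) (p (2 * i + 1)) w) \<partial>Q)"
      by (simp add: prod.distrib mult.assoc)
    also have "\<dots> = of_int (sign p) * (\<Prod>i<n. sgn (real (p (2 * i + 1)) - real (p (2 * i))) *
        (\<integral>w. ?m (p (2 * i)) (p (2 * i + 1)) w \<partial>Q))"
      by (simp only: expectation_prod_meet[OF p] prod.distrib mult.assoc)
    also have "\<dots> = of_int (sign p) * (\<Prod>i<n. A (p (2 * i)) (p (2 * i + 1)))"
      using A' lt by (intro arg_cong2[where f="(*)"] refl prod.cong) simp
    finally show ?thesis .
  qed
  have int: "integrable Q (\<lambda>w. of_int (sign p) * (\<Prod>i<n. sgn (real (p (2 * i + 1)) - real (p (2 * i))) * ?m (p (2 * i)) (p (2 * i + 1)) w))"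
    if p: "p permutes {..<N}" for p
  proof (rule Q.integrable_const_bound[of _ 1])
    have "\<bar>(\<Prod>i<n. sgn (real (p (2 * i + 1)) - real (p (2 * i))) * ?m (p (2 * i)) (p (2 * i + 1)) w)\<bar> \<le> (\<Prod>i<n. 1)" for w
      unfolding abs_prod by (intro prod_mono) (auto simp: sgn_if)
    then show "AE w in Q. norm (of_int (sign p) * (\<Prod>i<n. sgn (real (p (2 * i + 1)) - real (p (2 * i))) * ?m (p (2 * i)) (p (2 * i + 1)) w)) \<le> 1"
      by (simp add: abs_mult sign_def)
    have "?m (p (2 * i)) (p (2 * i + 1)) \<in> borel_measurable \<Omega>" if "i < n" for i
    proof -
      have "Measurable.pred \<Omega> (\<lambda>w. path_meet I T (w (p (2 * i))) (w (p (2 * i + 1))))"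
        using permutes_in_image[OF p, of "2 * i"] permutes_in_image[OF p, of "2 * i + 1"] that
        by (intro measurable_meet_copies) auto
      then show ?thesis by simp
    qed
    then show "(\<lambda>w. of_int (sign p) * (\<Prod>i<n. sgn (real (p (2 * i + 1)) - real (p (2 * i))) * ?m (p (2 * i)) (p (2 * i + 1)) w)) \<in> borel_measurable Q"
      unfolding measurable_Q
      by (intro borel_measurable_times borel_measurable_prod borel_measurable_const) simp_all
  qed
  show ?thesis
    unfolding meet_pfaffian_def label_pfaffian_def pfaffian_def
    using int summand by (simp add: Bochner_Integration.integral_sum)
qed

lemma prob_pairs_coalesced:
  assumes A: "\<And>k l. k < l \<Longrightarrow> l < N \<Longrightarrow> A k l = cross_or_meet_prob I P T (x k) (x l)"
    and anti: "\<And>k l. k < N \<Longrightarrow> l < N \<Longrightarrow> A l k = - A k l"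
    and G: "pairs_coalesced \<in> sets \<Omega>"
  shows "measure Q pairs_coalesced = pfaffian n A"
proof -
  have l: "leaders (\<lambda>i. i)" by (simp add: leaders_def)
  have past: "past_event (\<lambda>i. i) (paths_upto N)"
    using sets.top[of \<Omega>] unfolding space_paths by (simp add: past_event_def)
  have m: "merged (\<lambda>i. i) w (first_collision (\<lambda>i. i) w)" if "w \<in> paths_upto N" for w
    by (rule merged_until_collision[OF l that zero_time time_nonneg[OF first_collision(1)[OF l that]] merged_initial[OF that]])
  have "pfaffian n A = (\<integral>w. meet_pfaffian (\<lambda>i. i) w \<partial>Q)"
    by (rule expectation_meet_pfaffian[OF A anti, symmetric])
  also have "\<dots> = (\<integral>w. indicator (paths_upto N) w * meet_pfaffian (\<lambda>i. i) w \<partial>Q)"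
    by (intro Bochner_Integration.integral_cong) (simp_all add: space_Q)
  also have "\<dots> = measure Q (paths_upto N \<inter> pairs_coalesced)"
    by (rule expectation_eq_prob[OF AE_ordered G l past m])
  also have "paths_upto N \<inter> pairs_coalesced = pairs_coalesced" by (auto simp: pairs_coalesced_def)
  finally show ?thesis ..
qed

end

section \<open>Transfer to the coalescing system\<close>

text \<open>
  The equality of laws in \<^locale>\<open>coalescing_system\<close> contains the measurability of \<^const>\<open>coalesce\<close>. By
  definition \<^const>\<open>distr\<close> is the null measure unless the masses of preimages form a measure, and sets
  that are not measurable have mass \<open>0\<close>. If the preimage of \<open>A\<close> is not measurable, neither is that
  of the complement, and the total mass would be \<open>0\<close>.
\<close>

lemma measurable_if_prob_space_distr:
  assumes distr: "prob_space (distr M N f)" and M: "prob_space M" and f: "f \<in> space M \<rightarrow> space N"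
  shows "f \<in> M \<rightarrow>\<^sub>M N"
proof (rule measurableI)
  interpret D: prob_space "distr M N f" by fact
  interpret prob_space M by fact
  let ?\<mu> = "\<lambda>A. emeasure M (f -` A \<inter> space M)"
  have conv: "emeasure (distr M N f) A = (if measure_space (space N) (sets N) ?\<mu> then ?\<mu> A else 0)"
    if "A \<in> sets N" for A
    using that by (simp add: distr_def emeasure_measure_of_conv sets.sigma_sets_eq)
  have "measure_space (space N) (sets N) ?\<mu>"
    using conv[OF sets.top] D.emeasure_space_1 by (auto split: if_splits)
  then have eq: "emeasure (distr M N f) A = ?\<mu> A" if "A \<in> sets N" for A
    using conv[OF that] by simp
  fix A assume A: "A \<in> sets N"
  show "f -` A \<inter> space M \<in> sets M"
  proof (rule ccontr)
    assume nm: "f -` A \<inter> space M \<notin> sets M"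
    have compl: "f -` (space N - A) \<inter> space M = space M - (f -` A \<inter> space M)" using f by auto
    have "f -` (space N - A) \<inter> space M \<notin> sets M"
    proof
      assume "f -` (space N - A) \<inter> space M \<in> sets M"
      then have "space M - (f -` (space N - A) \<inter> space M) \<in> sets M" by auto
      also have "space M - (f -` (space N - A) \<inter> space M) = f -` A \<inter> space M" unfolding compl by auto
      finally show False using nm by simp
    qed
    then have "emeasure (distr M N f) A = 0" "emeasure (distr M N f) (space N - A) = 0"
      using nm A eq by (simp_all add: emeasure_notin_sets)
    moreover have "emeasure (distr M N f) A + emeasure (distr M N f) (space N - A) = emeasure (distr M N f) (space N)"
      using A sets.sets_into_space[OF A] by (subst plus_emeasure) (auto simp: Un_absorb1)
    ultimately show False using D.emeasure_space_1 by simp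
  qed
qed (use f in auto)

context independent_copies
begin

lemma coalesced_space:
  assumes w: "w \<in> paths_upto N"
  shows "coalesced w \<in> paths_upto N"
proof -
  have "coalesced w i = undefined" if "\<not> i < N" for i
    using that by (intro coalesce_outside) simp
  then show ?thesis
    using coalesced_path[OF w] by (auto simp: paths_upto_def PiE_iff extensional_def)
qed

text \<open>
  Particle \<open>0\<close> is copy \<open>0\<close>, and particle \<open>1\<close> moves along copy \<open>1\<close> until it meets particle \<open>0\<close>.
\<close>

lemma coalesced_ordered_pair:
  assumes w: "w \<in> paths_upto N" and ord: "ordered w" and n: "0 < n"
  shows "coalesced w 0 T \<le> coalesced w 1 T"
proof -
  have 0: "0 < N" "(1::nat) < N" using n by simp_all
  have w0: "coalesced w 0 = w 0"
    using w 0(1) by (cases rule: coalesced_cases) simp_all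
  have le: "w 0 T \<le> w 1 T" if "\<And>u. u \<in> I \<Longrightarrow> u \<le> T \<Longrightarrow> w 0 u \<noteq> w 1 u"
    using ord that 0(2) time unfolding ordered_def by (meson not_less zero_less_one)
  from w 0(2) show ?thesis
  proof (cases rule: coalesced_cases)
    case 1
    then show ?thesis using le w0 by (metis less_one)
  next
    case (2 \<sigma> m)
    then have m: "m = 0" by simp
    show ?thesis
    proof (cases "T < \<sigma>")
      case True
      then have "w 0 u \<noteq> w 1 u" if "u \<in> I" "u \<le> T" for u
        using 2(4)[OF that(1), of 0] that w0 by simp
      then show ?thesis using le 2(5)[OF time] True w0 by simp
    next
      case False
      then show ?thesis using 2(5)[OF time] m by simp
    qed
  qed
qed

end

context coalescing_system
begin

lemma X_path: "x \<in> S \<Longrightarrow> \<omega> \<in> space M \<Longrightarrow> (\<lambda>t\<in>I. X x t \<omega>) \<in> skip_free_paths S I"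
  using measurable_space[OF paths] by (simp add: space_path_space)

lemma measurable_X: "x \<in> S \<Longrightarrow> t \<in> I \<Longrightarrow> X x t \<in> borel_measurable M"
  using measurable_path_component[OF paths, of x t] by simp

lemma law_coalesced:
  fixes x :: "nat \<Rightarrow> real" and T :: real and n :: nat
  assumes ic: "independent_copies S I P x T"
  defines "\<Omega> \<equiv> \<Pi>\<^sub>M i\<in>{..<2 * n}. path_space S I" and "Q \<equiv> \<Pi>\<^sub>M i\<in>{..<2 * n}. P 0 (x i)"
  shows "coalesce I (2 * n) \<in> Q \<rightarrow>\<^sub>M \<Omega>"
    and "(\<lambda>\<omega>. \<lambda>i\<in>{..<2 * n}. \<lambda>t\<in>I. X (x i) t \<omega>) \<in> M \<rightarrow>\<^sub>M \<Omega>"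
    and "distr M \<Omega> (\<lambda>\<omega>. \<lambda>i\<in>{..<2 * n}. \<lambda>t\<in>I. X (x i) t \<omega>) = distr Q \<Omega> (coalesce I (2 * n))"
proof -
  interpret independent_copies S I P x T n by (rule ic)
  show Xm: "(\<lambda>\<omega>. \<lambda>i\<in>{..<2 * n}. \<lambda>t\<in>I. X (x i) t \<omega>) \<in> M \<rightarrow>\<^sub>M \<Omega>"
    unfolding \<Omega>_def using states by (intro measurable_restrict paths)
  show law: "distr M \<Omega> (\<lambda>\<omega>. \<lambda>i\<in>{..<2 * n}. \<lambda>t\<in>I. X (x i) t \<omega>) = distr Q \<Omega> (coalesce I (2 * n))"
    unfolding \<Omega>_def Q_def using states by (intro law)
  have "prob_space (distr M \<Omega> (\<lambda>\<omega>. \<lambda>i\<in>{..<2 * n}. \<lambda>t\<in>I. X (x i) t \<omega>))"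
    by (rule prob_space_distr[OF Xm])
  then have "prob_space (distr Q \<Omega> (coalesce I (2 * n)))" by (simp only: law)
  then show "coalesce I (2 * n) \<in> Q \<rightarrow>\<^sub>M \<Omega>"
    using coalesced_space Q.prob_space_axioms
    by (intro measurable_if_prob_space_distr) (simp_all add: Q_def \<Omega>_def space_Q space_paths)
qed

lemma prob_particles_coalesced:
  fixes x :: "nat \<Rightarrow> real" and T :: real and n :: nat and A :: "nat \<Rightarrow> nat \<Rightarrow> real"
  assumes ic: "independent_copies S I P x T"
    and A: "\<And>k l. k < l \<Longrightarrow> l < 2 * n \<Longrightarrow> A k l = cross_or_meet_prob I P T (x k) (x l)"
    and anti: "\<And>k l. k < 2 * n \<Longrightarrow> l < 2 * n \<Longrightarrow> A l k = - A k l"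
  shows "prob {\<omega> \<in> space M. \<forall>i<n. X (x (2 * i)) T \<omega> = X (x (2 * i + 1)) T \<omega>} = pfaffian n A"
proof -
  interpret independent_copies S I P x T n by (rule ic)
  note L = law_coalesced[OF ic]
  let ?X = "\<lambda>\<omega>. \<lambda>i\<in>{..<2 * n}. \<lambda>t\<in>I. X (x i) t \<omega>"
  let ?G = "{f \<in> space \<Omega>. \<forall>i\<in>{..<n}. f (2 * i) T = f (2 * i + 1) T}"
  have coord: "(\<lambda>f. f i T) \<in> borel_measurable \<Omega>" if "i < N" for i
    by (rule measurable_path_component[OF measurable_copy[OF that] time])
  have "Measurable.pred \<Omega> (\<lambda>f. f (2 * i) T = f (2 * i + 1) T)" if "i < n" for i
    unfolding pred_def using that by (intro borel_measurable_eq coord) auto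
  then have "Measurable.pred \<Omega> (\<lambda>f. \<forall>i\<in>{..<n}. f (2 * i) T = f (2 * i + 1) T)"
    by (intro pred_intros_finite) auto
  then have G: "?G \<in> sets \<Omega>" by (simp only: pred_def)
  have pre: "pairs_coalesced = coalesce I N -` ?G \<inter> space Q"
    using coalesced_space by (auto simp: pairs_coalesced_def space_Q space_paths)
  have Gm: "pairs_coalesced \<in> sets \<Omega>"
    unfolding pre using measurable_sets[OF L(1) G] by (simp only: sets_Q)
  have "{\<omega> \<in> space M. \<forall>i<n. X (x (2 * i)) T \<omega> = X (x (2 * i + 1)) T \<omega>} = ?X -` ?G \<inter> space M"
    using measurable_space[OF L(2)] time by auto
  then have "prob {\<omega> \<in> space M. \<forall>i<n. X (x (2 * i)) T \<omega> = X (x (2 * i + 1)) T \<omega>} = measure (distr M \<Omega> ?X) ?G"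
    using measure_distr[OF L(2) G] by simp
  also have "\<dots> = measure (distr Q \<Omega> (coalesce I N)) ?G" by (simp only: L(3))
  also have "\<dots> = measure Q pairs_coalesced"
    unfolding pre by (rule measure_distr[OF L(1) G])
  also have "\<dots> = pfaffian n A"
    by (rule prob_pairs_coalesced[OF A anti Gm])
  finally show ?thesis .
qed

section \<open>Monotonicity of the coalescing flow\<close>

definition monotone_at :: "real \<Rightarrow> 'w \<Rightarrow> bool" where
  "monotone_at T \<omega> \<longleftrightarrow> (\<forall>x\<in>S. \<forall>y\<in>S. x \<le> y \<longrightarrow> X x T \<omega> \<le> X y T \<omega>)"

text \<open>
  A reversal of the order would force the continuous paths to meet before, after which they agree.
\<close>

lemma monotone_continuous:
  assumes S: "S = UNIV" and T: "T \<in> I" and \<omega>: "\<omega> \<in> space M"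
  shows "monotone_at T \<omega>"
  unfolding monotone_at_def
proof (intro ballI impI)
  fix x y assume xy: "x \<in> S" "y \<in> S" "x \<le> y"
  show "X x T \<omega> \<le> X y T \<omega>"
  proof (rule ccontr)
    assume gt: "\<not> ?thesis"
    have I: "I = {0..}" using S state_time Ints_ne_UNIV by auto
    have cont: "continuous_on {0..T} (\<lambda>t. X z t \<omega>)" for z
    proof -
      have "continuous_on I (\<lambda>t\<in>I. X z t \<omega>)"
        using X_path[of z \<omega>] \<omega> S by (simp add: skip_free_paths_def)
      then have "continuous_on {0..T} (\<lambda>t\<in>I. X z t \<omega>)"
        by (rule continuous_on_subset) (use I in auto)
      then show ?thesis by (rule continuous_on_eq) (use I in auto)
    qed
    have T0: "0 \<le> T" using T I by simp
    have "\<exists>t. 0 \<le> t \<and> t \<le> T \<and> X x t \<omega> - X y t \<omega> = 0"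
    proof (rule IVT')
      show "X x 0 \<omega> - X y 0 \<omega> \<le> 0" using start_at[OF xy(1) \<omega>] start_at[OF xy(2) \<omega>] xy(3) by simp
      show "0 \<le> X x T \<omega> - X y T \<omega>" using gt by simp
      show "continuous_on {0..T} (\<lambda>t. X x t \<omega> - X y t \<omega>)" by (intro continuous_on_diff cont)
    qed (rule T0)
    then obtain t where "0 \<le> t" "t \<le> T" "X x t \<omega> = X y t \<omega>" by auto
    then have "X x T \<omega> = X y T \<omega>" using I by (intro merge[OF xy(1,2) _ T _ \<omega>, of t]) auto
    then show False using gt by simp
  qed
qed

text \<open>
  Jump paths could exchange positions without meeting. That this has probability \<open>0\<close> is a property
  of the law of two particles; as there are countably many starting points, it holds for all of them
  at once.
\<close>

lemma monotone_integer:
  assumes S: "S = \<int>" and T: "T \<in> I"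
  shows "AE \<omega> in M. monotone_at T \<omega>"
proof -
  have pair: "AE \<omega> in M. X y T \<omega> \<le> X z T \<omega>" if yz: "y \<in> S" "z \<in> S" "y \<le> z" for y z
  proof -
    define x :: "nat \<Rightarrow> real" where "x i = (if i = 0 then y else z)" for i
    have ic: "independent_copies S I P x T"
      by unfold_locales (use yz T in \<open>auto simp: x_def\<close>)
    interpret independent_copies S I P x T 1 by (rule ic)
    note L = law_coalesced[OF ic, where n = 1]
    let ?X = "\<lambda>\<omega>. \<lambda>i\<in>{..<2 * (1::nat)}. \<lambda>t\<in>I. X (x i) t \<omega>"
    let ?\<Omega> = "\<Pi>\<^sub>M i\<in>{..<2 * (1::nat)}. path_space S I"
    let ?Q = "\<Pi>\<^sub>M i\<in>{..<2 * (1::nat)}. P 0 (x i)"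
    have "(\<lambda>f. f 0 T) \<in> borel_measurable ?\<Omega>"
      by (rule measurable_path_component[OF measurable_copy T]) simp
    moreover have "(\<lambda>f. f 1 T) \<in> borel_measurable ?\<Omega>"
      by (rule measurable_path_component[OF measurable_copy T]) simp
    ultimately have G: "{f \<in> space ?\<Omega>. f 0 T \<le> f 1 T} \<in> sets ?\<Omega>" by (rule borel_measurable_le)
    have "AE w in ?Q. coalesce I (2 * 1) w 0 T \<le> coalesce I (2 * 1) w 1 T"
      using AE_ordered AE_space
    proof eventually_elim
      case (elim w)
      then show ?case by (intro coalesced_ordered_pair) (simp_all only: space_Q)
    qed
    then have "AE f in distr ?Q ?\<Omega> (coalesce I (2 * 1)). f 0 T \<le> f 1 T"
      by (subst AE_distr_iff[OF L(1) G])
    then have "AE f in distr M ?\<Omega> ?X. f 0 T \<le> f 1 T" by (simp only: L(3))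
    then have "AE \<omega> in M. ?X \<omega> 0 T \<le> ?X \<omega> 1 T" by (subst (asm) AE_distr_iff[OF L(2) G])
    then show ?thesis using T by (simp add: x_def)
  qed
  have c: "countable S" using S countable_int by simp
  have "AE \<omega> in M. \<forall>x\<in>S. \<forall>y\<in>S. x \<le> y \<longrightarrow> X x T \<omega> \<le> X y T \<omega>"
  proof (subst AE_ball_countable[OF c], intro ballI, subst AE_ball_countable[OF c], intro ballI)
    fix x y assume "x \<in> S" "y \<in> S"
    then show "AE \<omega> in M. x \<le> y \<longrightarrow> X x T \<omega> \<le> X y T \<omega>" using pair by (cases "x \<le> y") auto
  qed
  then show ?thesis by (simp add: monotone_at_def)
qed

section \<open>Basins and walls\<close>

lemma basin_contains_iff:
  assumes "a \<in> S" "a \<le> b"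
  shows "(\<exists>B\<in>basins S X T \<omega>. {a..b} \<inter> S \<subseteq> B) \<longleftrightarrow> (\<forall>x\<in>{a..b} \<inter> S. X x T \<omega> = X a T \<omega>)"
proof
  assume "\<exists>B\<in>basins S X T \<omega>. {a..b} \<inter> S \<subseteq> B"
  then obtain y where y: "{a..b} \<inter> S \<subseteq> basin S X T \<omega> y" by (auto simp: basins_def)
  then have "X x T \<omega> = y" if "x \<in> {a..b} \<inter> S" for x using that by (auto simp: basin_def)
  then show "\<forall>x\<in>{a..b} \<inter> S. X x T \<omega> = X a T \<omega>" using assms by simp
next
  assume const: "\<forall>x\<in>{a..b} \<inter> S. X x T \<omega> = X a T \<omega>"
  have "basin S X T \<omega> (X a T \<omega>) \<in> basins S X T \<omega>"
    using assms(1) by (auto simp: basins_def survivors_def)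
  moreover have "{a..b} \<inter> S \<subseteq> basin S X T \<omega> (X a T \<omega>)" using const by (auto simp: basin_def)
  ultimately show "\<exists>B\<in>basins S X T \<omega>. {a..b} \<inter> S \<subseteq> B" by blast
qed

lemma monotone_constant_iff:
  assumes "monotone_at T \<omega>" "a \<in> S" "b \<in> S" "a \<le> b"
  shows "(\<forall>x\<in>{a..b} \<inter> S. X x T \<omega> = X a T \<omega>) \<longleftrightarrow> X a T \<omega> = X b T \<omega>"
proof
  assume "\<forall>x\<in>{a..b} \<inter> S. X x T \<omega> = X a T \<omega>"
  from bspec[OF this, of b] show "X a T \<omega> = X b T \<omega>" using assms(3,4) by simp
next
  assume eq: "X a T \<omega> = X b T \<omega>"
  show "\<forall>x\<in>{a..b} \<inter> S. X x T \<omega> = X a T \<omega>"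
  proof
    fix x assume "x \<in> {a..b} \<inter> S"
    then have "X a T \<omega> \<le> X x T \<omega>" "X x T \<omega> \<le> X b T \<omega>"
      using assms(1-3) unfolding monotone_at_def by simp_all
    then show "X x T \<omega> = X a T \<omega>" unfolding eq by (rule antisym[rotated])
  qed
qed

lemma basins_eq: "basins S X T \<omega> = {basin S X T \<omega> (X x T \<omega>) |x. x \<in> S}"
  by (auto simp: basins_def survivors_def)

lemma integer_walls:
  assumes S: "S = \<int>"
  shows "walls S X T \<omega> = {z + 1/2 | z. z \<in> \<int> \<and> X z T \<omega> \<noteq> X (z + 1) T \<omega>}"
proof -
  have "(\<exists>B\<in>basins S X T \<omega>. \<exists>B'\<in>basins S X T \<omega>. B \<noteq> B' \<and> z \<in> B \<and> z + 1 \<in> B') \<longleftrightarrow> X z T \<omega> \<noteq> X (z + 1) T \<omega>"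
    if z: "z \<in> \<int>" for z
  proof
    assume "\<exists>B\<in>basins S X T \<omega>. \<exists>B'\<in>basins S X T \<omega>. B \<noteq> B' \<and> z \<in> B \<and> z + 1 \<in> B'"
    then show "X z T \<omega> \<noteq> X (z + 1) T \<omega>" by (auto simp: basins_def basin_def)
  next
    assume ne: "X z T \<omega> \<noteq> X (z + 1) T \<omega>"
    have zS: "z \<in> S" "z + 1 \<in> S" using z S by auto
    have "basin S X T \<omega> (X z T \<omega>) \<in> basins S X T \<omega>" "basin S X T \<omega> (X (z + 1) T \<omega>) \<in> basins S X T \<omega>"
      using zS by (auto simp: basins_eq)
    moreover have "z \<in> basin S X T \<omega> (X z T \<omega>)" "z + 1 \<in> basin S X T \<omega> (X (z + 1) T \<omega>)"
      "z \<notin> basin S X T \<omega> (X (z + 1) T \<omega>)"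
      using zS ne by (auto simp: basin_def)
    ultimately show "\<exists>B\<in>basins S X T \<omega>. \<exists>B'\<in>basins S X T \<omega>. B \<noteq> B' \<and> z \<in> B \<and> z + 1 \<in> B'" by metis
  qed
  then show ?thesis unfolding walls_def using S by auto
qed

text \<open>
  Walls in \<open>{a<..<b}\<close> sit at the points \<open>z + 1/2\<close> with \<open>a \<le> z\<close> and \<open>z + 1 \<le> b\<close>, so a flow that is
  constant on all neighbouring pairs is constant on \<open>{a..b}\<close>.
\<close>

lemma integer_no_wall_iff:
  assumes S: "S = \<int>" and ab: "a \<in> \<int>" "b \<in> \<int>" "a < b"
  shows "walls S X T \<omega> \<inter> {a<..<b} = {} \<longleftrightarrow> (\<forall>x\<in>{a..b} \<inter> S. X x T \<omega> = X a T \<omega>)"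
proof
  obtain i where "a = of_int i" using ab(1) by (rule Ints_cases)
  moreover obtain j where "b = of_int j" using ab(2) by (rule Ints_cases)
  ultimately have ij: "a = of_int i" "b = of_int j" by auto
  {
    assume none: "walls S X T \<omega> \<inter> {a<..<b} = {}"
    have adj: "X (of_int k) T \<omega> = X (of_int k + 1) T \<omega>" if "i \<le> k" "k < j" for k
    proof (rule ccontr)
      assume "X (of_int k) T \<omega> \<noteq> X (of_int k + 1) T \<omega>"
      then have "of_int k + 1 / 2 \<in> walls S X T \<omega>" unfolding integer_walls[OF S] using Ints_of_int by blast
      moreover have "of_int k + 1 \<le> real_of_int j" using that by linarith
      then have "of_int k + 1 / 2 \<in> {a<..<b}" using that by (simp add: ij)
      ultimately show False using none by blast
    qed
    have const: "k \<le> j \<Longrightarrow> X (of_int k) T \<omega> = X a T \<omega>" if "i \<le> k" for k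
      using that
    proof (induction k rule: int_ge_induct)
      case base then show ?case by (simp add: ij)
    next
      case (step k) then show ?case using adj[of k] by simp
    qed
    show "\<forall>x\<in>{a..b} \<inter> S. X x T \<omega> = X a T \<omega>"
    proof
      fix x assume x: "x \<in> {a..b} \<inter> S"
      then have "x \<in> \<int>" using S by simp
      then obtain k where "x = of_int k" by (rule Ints_cases)
      then show "X x T \<omega> = X a T \<omega>" using const[of k] x by (simp add: ij)
    qed
  }
  {
    assume const: "\<forall>x\<in>{a..b} \<inter> S. X x T \<omega> = X a T \<omega>"
    show "walls S X T \<omega> \<inter> {a<..<b} = {}"
    proof (rule ccontr)
      assume "\<not> ?thesis"
      then obtain z where z: "z \<in> \<int>" "X z T \<omega> \<noteq> X (z + 1) T \<omega>" "a < z + 1/2" "z + 1/2 < b"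
        unfolding integer_walls[OF S] by auto
      obtain k where k: "z = of_int k" using z(1) by (rule Ints_cases)
      have "i \<le> k" "k + 1 \<le> j" using z(3,4) unfolding k ij by linarith+
      then have "z \<in> {a..b} \<inter> S" "z + 1 \<in> {a..b} \<inter> S" using S by (auto simp: k ij)
      then show False using bspec[OF const, of z] bspec[OF const, of "z + 1"] z(2) by simp
    qed
  }
qed

lemma real_walls:
  assumes S: "S = UNIV"
  shows "walls S X T \<omega> = (\<Union>x. frontier (basin S X T \<omega> (X x T \<omega>)))"
proof -
  have "S \<noteq> \<int>" using S Ints_ne_UNIV by simp
  then have "walls S X T \<omega> = (\<Union>B\<in>basins S X T \<omega>. frontier B)" by (simp add: walls_def)
  also have "basins S X T \<omega> = range (\<lambda>x. basin S X T \<omega> (X x T \<omega>))"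
    unfolding basins_eq using S by auto
  finally show ?thesis by simp
qed

text \<open>
  An interval is connected, so it lies in every basin that it intersects unless it contains a
  boundary point of it.
\<close>

lemma real_no_wall_iff:
  assumes S: "S = UNIV"
  shows "walls S X T \<omega> \<inter> {a<..<b} = {} \<longleftrightarrow> (\<forall>x\<in>{a<..<b}. \<forall>y\<in>{a<..<b}. X x T \<omega> = X y T \<omega>)"
proof
  note walls = real_walls[OF S]
  {
    assume none: "walls S X T \<omega> \<inter> {a<..<b} = {}"
    show "\<forall>x\<in>{a<..<b}. \<forall>y\<in>{a<..<b}. X x T \<omega> = X y T \<omega>"
    proof (intro ballI)
      fix x y assume xy: "x \<in> {a<..<b}" "y \<in> {a<..<b}"
      let ?B = "basin S X T \<omega> (X x T \<omega>)"
      have "{a<..<b} \<inter> frontier ?B = {}" using none unfolding walls by blast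
      moreover have "{a<..<b} \<inter> ?B \<noteq> {}" using xy S by (auto simp: basin_def)
      ultimately have "{a<..<b} - ?B = {}" using connected_Int_frontier[of "{a<..<b}" ?B] by auto
      then have "y \<in> ?B" using xy by blast
      then show "X x T \<omega> = X y T \<omega>" by (simp add: basin_def)
    qed
  }
  {
    assume const: "\<forall>x\<in>{a<..<b}. \<forall>y\<in>{a<..<b}. X x T \<omega> = X y T \<omega>"
    show "walls S X T \<omega> \<inter> {a<..<b} = {}"
    proof (rule ccontr)
      assume "\<not> ?thesis"
      then obtain z x where z: "z \<in> {a<..<b}" "z \<in> frontier (basin S X T \<omega> (X x T \<omega>))"
        unfolding walls by blast
      let ?B = "basin S X T \<omega> (X x T \<omega>)"
      show False
      proof (cases "{a<..<b} \<inter> ?B = {}")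
        case True
        then have "{a<..<b} \<inter> closure ?B = {}" by (simp add: open_Int_closure_eq_empty)
        then show False using z by (auto simp: frontier_def)
      next
        case False
        then obtain y where "y \<in> {a<..<b} \<inter> ?B" by blast
        then have y: "y \<in> {a<..<b}" "X y T \<omega> = X x T \<omega>" by (simp_all add: basin_def)
        have "{a<..<b} \<subseteq> ?B"
        proof
          fix u assume "u \<in> {a<..<b}"
          then have "X u T \<omega> = X y T \<omega>" using const y(1) by blast
          then show "u \<in> ?B" using y(2) S by (simp add: basin_def)
        qed
        then have "{a<..<b} \<subseteq> interior ?B" by (intro interior_maximal) auto
        then show False using z by (auto simp: frontier_def)
      qed
    qed
  }
qed

lemma real_not_wall_constant_near:
  assumes S: "S = UNIV" and x: "x \<notin> walls S X T \<omega>"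
  obtains \<delta> where "0 < \<delta>" "\<And>y. \<bar>y - x\<bar> < \<delta> \<Longrightarrow> X y T \<omega> = X x T \<omega>"
proof -
  let ?B = "basin S X T \<omega> (X x T \<omega>)"
  have "x \<in> ?B" using S by (simp add: basin_def)
  moreover have "x \<notin> frontier ?B" using x unfolding real_walls[OF S] by blast
  ultimately have "x \<in> interior ?B" using closure_subset[of ?B] by (auto simp: frontier_def)
  then obtain \<delta> where \<delta>: "0 < \<delta>" "ball x \<delta> \<subseteq> ?B" by (auto simp: mem_interior)
  show thesis
  proof (rule that[OF \<open>0 < \<delta>\<close>])
    fix y assume "\<bar>y - x\<bar> < \<delta>"
    then have "y \<in> ball x \<delta>" by (simp add: dist_real_def abs_minus_commute[of x])
    then have "y \<in> ?B" using \<open>ball x \<delta> \<subseteq> ?B\<close> by (rule subsetD[rotated])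
    then show "X y T \<omega> = X x T \<omega>" by (simp add: basin_def)
  qed
qed

text \<open>
  Without walls in the open interval the flow is constant there. That its values at the endpoints
  are the same needs that the endpoints are not walls: then they are interior points of their
  basins.
\<close>

lemma real_no_wall_endpoints:
  assumes S: "S = UNIV" and mono: "monotone_at T \<omega>" and ab: "a < b"
    and ends: "a \<notin> walls S X T \<omega>" "b \<notin> walls S X T \<omega>"
  shows "walls S X T \<omega> \<inter> {a<..<b} = {} \<longleftrightarrow> X a T \<omega> = X b T \<omega>"
proof
  assume "walls S X T \<omega> \<inter> {a<..<b} = {}"
  then have const: "\<forall>x\<in>{a<..<b}. \<forall>y\<in>{a<..<b}. X x T \<omega> = X y T \<omega>"
    by (simp only: real_no_wall_iff[OF S])
  obtain d where d: "0 < d" "\<And>y. \<bar>y - a\<bar> < d \<Longrightarrow> X y T \<omega> = X a T \<omega>"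
    using real_not_wall_constant_near[OF S ends(1)] by blast
  obtain d' where d': "0 < d'" "\<And>y. \<bar>y - b\<bar> < d' \<Longrightarrow> X y T \<omega> = X b T \<omega>"
    using real_not_wall_constant_near[OF S ends(2)] by blast
  define h where "h = min (min d d') (b - a) / 2"
  have h: "0 < h" "h < d" "h < d'" "h < b - a" using d(1) d'(1) ab by (auto simp: h_def)
  have "X a T \<omega> = X (a + h) T \<omega>" using d(2)[of "a + h"] h by simp
  also have "\<dots> = X (b - h) T \<omega>" using const[rule_format, of "a + h" "b - h"] h by simp
  also have "\<dots> = X b T \<omega>" using d'(2)[of "b - h"] h by simp
  finally show "X a T \<omega> = X b T \<omega>" .
next
  assume eq: "X a T \<omega> = X b T \<omega>"
  have "a \<in> S" "b \<in> S" "a \<le> b" using S ab by simp_all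
  then have const: "\<forall>x\<in>{a..b} \<inter> S. X x T \<omega> = X a T \<omega>"
    using eq by (rule monotone_constant_iff[OF mono, THEN iffD2])
  have "X x T \<omega> = X a T \<omega>" if "x \<in> {a<..<b}" for x
    by (rule bspec[OF const]) (use that S in simp)
  then show "walls S X T \<omega> \<inter> {a<..<b} = {}"
    unfolding real_no_wall_iff[OF S] by metis
qed

text \<open>
  By monotonicity the flow is constant on \<open>{a<..<b}\<close> as soon as it agrees at the endpoints of the
  intervals \<open>{a + h k..b - h k}\<close>, which exhaust it.
\<close>

lemma sets_real_no_wall:
  assumes S: "S = UNIV" and T: "T \<in> I" and ab: "a < b"
  shows "{\<omega> \<in> space M. walls S X T \<omega> \<inter> {a<..<b} = {}} \<in> sets M"
proof -
  \<comment> \<open>With \<open>k + 3\<close> in the denominator all intervals are nonempty.\<close>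
  define h where "h k = (b - a) / real (k + 3)" for k
  have h: "0 < h k" "h k < b - a" "a + h k < b - h k" for k
  proof -
    have "h k * real (k + 3) = b - a" by (simp add: h_def)
    moreover show "0 < h k" using ab by (simp add: h_def)
    moreover have "h k * 3 \<le> h k * real (k + 3)" using \<open>0 < h k\<close> by (intro mult_left_mono) auto
    ultimately show "h k < b - a" "a + h k < b - h k" by linarith+
  qed
  have "walls S X T \<omega> \<inter> {a<..<b} = {} \<longleftrightarrow> (\<forall>k. X (a + h k) T \<omega> = X (b - h k) T \<omega>)"
    if \<omega>: "\<omega> \<in> space M" for \<omega>
    unfolding real_no_wall_iff[OF S]
  proof
    assume "\<forall>x\<in>{a<..<b}. \<forall>y\<in>{a<..<b}. X x T \<omega> = X y T \<omega>"
    moreover have "a + h k \<in> {a<..<b}" "b - h k \<in> {a<..<b}" for k using h[of k] by simp_all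
    ultimately show "\<forall>k. X (a + h k) T \<omega> = X (b - h k) T \<omega>" by blast
  next
    assume eq: "\<forall>k. X (a + h k) T \<omega> = X (b - h k) T \<omega>"
    have mono: "X x T \<omega> \<le> X y T \<omega>" if "x \<le> y" for x y
      using monotone_continuous[OF S T \<omega>] that unfolding monotone_at_def by (simp add: S)
    have le: "X y T \<omega> \<le> X x T \<omega>" if xy: "x \<in> {a<..<b}" "y \<in> {a<..<b}" for x y
    proof -
      define m where "m = min (x - a) (b - y)"
      have "0 < m" using xy by (simp add: m_def)
      then obtain k where "(b - a) / m < real k" using reals_Archimedean2 by blast
      then have "(b - a) < real k * m" using \<open>0 < m\<close> by (simp add: field_simps)
      also have "\<dots> \<le> real (k + 3) * m" using \<open>0 < m\<close> by (intro mult_right_mono) auto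
      finally have "h k < m" by (simp add: h_def field_simps)
      then have "y \<le> b - h k" "a + h k \<le> x" by (auto simp: m_def)
      then have "X y T \<omega> \<le> X (b - h k) T \<omega>" "X (a + h k) T \<omega> \<le> X x T \<omega>"
        by (simp_all only: mono)
      then show ?thesis using eq by simp
    qed
    show "\<forall>x\<in>{a<..<b}. \<forall>y\<in>{a<..<b}. X x T \<omega> = X y T \<omega>" by (intro ballI antisym le)
  qed
  then have "{\<omega> \<in> space M. walls S X T \<omega> \<inter> {a<..<b} = {}} = {\<omega> \<in> space M. \<forall>k. X (a + h k) T \<omega> = X (b - h k) T \<omega>}"
    by blast
  also have "\<dots> \<in> sets M"
  proof -
    have "{\<omega> \<in> space M. X (a + h k) T \<omega> = X (b - h k) T \<omega>} \<in> sets M" for k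
      using S T by (intro borel_measurable_eq measurable_X) auto
    then show ?thesis by (intro sets.sets_Collect_countable_All)
  qed
  finally show ?thesis .
qed

end

section \<open>The probability of having no walls\<close>

theorem theorem1p1:
  fixes S I :: "real set" and P :: "real \<Rightarrow> real \<Rightarrow> (real \<Rightarrow> real) measure"
    and M :: "'w measure" and X :: "real \<Rightarrow> real \<Rightarrow> 'w \<Rightarrow> real"
    and T :: real and n :: nat and a b e :: "nat \<Rightarrow> real" and A :: "nat \<Rightarrow> nat \<Rightarrow> real"
  assumes system: "coalescing_system S I P M X"
    and time: "T \<in> I" "T > 0"
    and states: "\<And>i. i < n \<Longrightarrow> a i \<in> S" "\<And>i. i < n \<Longrightarrow> b i \<in> S"
    and intervals: "\<And>i. i < n \<Longrightarrow> a i < b i"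
    and ordered: "\<And>i. i + 1 < n \<Longrightarrow> b i \<le> a (i + 1)"
    and endpoints: "\<And>i. i < n \<Longrightarrow> e (2 * i) = a i" "\<And>i. i < n \<Longrightarrow> e (2 * i + 1) = b i"
    and antisymmetric: "\<And>k l. k < 2 * n \<Longrightarrow> l < 2 * n \<Longrightarrow> A l k = - A k l"
    and entries: "\<And>k l. k < l \<Longrightarrow> l < 2 * n \<Longrightarrow> A k l = cross_or_meet_prob I P T (e k) (e l)"
  shows
    \<comment> \<open>walls as numbers; only on the real line can a wall hit an endpoint\<close>
    "((S = UNIV \<longrightarrow> (\<forall>i<n. AE \<omega> in M. a i \<notin> walls S X T \<omega> \<and> b i \<notin> walls S X T \<omega>)) \<longrightarrow>
      measure M {\<omega> \<in> space M. \<forall>i<n. walls S X T \<omega> \<inter> {a i<..<b i} = {}} = pfaffian n A) \<and>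
     \<comment> \<open>without any condition: no boundary between basins separates points of \<open>{a i..b i}\<close>\<close>
     measure M {\<omega> \<in> space M. \<forall>i<n. \<exists>B\<in>basins S X T \<omega>. {a i..b i} \<inter> S \<subseteq> B} = pfaffian n A"
proof -
  interpret coalescing_system S I P M X by (rule system)
  \<comment> \<open>The endpoints, continued by the last one so that the sequence is nondecreasing throughout.\<close>
  define x where "x i = (if n = 0 then 0 else e (min i (2 * n - 1)))" for i
  have x_e: "x i = e i" if "i < 2 * n" for i using that by (auto simp: x_def min_def)
  have e_S: "e i \<in> S" if "i < 2 * n" for i
  proof -
    have "i div 2 < n" using that by simp
    moreover have "i = 2 * (i div 2) \<or> i = 2 * (i div 2) + 1" by presburger
    ultimately show ?thesis using endpoints[of "i div 2"] states[of "i div 2"] by metis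
  qed
  have x_S: "x i \<in> S" for i
  proof (cases "n = 0")
    case True then show ?thesis using state_time by (auto simp: x_def)
  next
    case False then show ?thesis by (auto simp: x_def intro!: e_S)
  qed
  have e_mono: "e i \<le> e (Suc i)" if "Suc i < 2 * n" for i
  proof (cases "even i")
    case True
    then obtain j where "i = 2 * j" by blast
    then show ?thesis using endpoints[of j] intervals[of j] that by simp
  next
    case False
    then obtain j where j: "i = 2 * j + 1" by (rule oddE)
    then have "Suc i = 2 * (j + 1)" by simp
    then show ?thesis using endpoints(2)[of j] endpoints(1)[of "j + 1"] ordered[of j] that j by simp
  qed
  have x_Suc: "x i \<le> x (Suc i)" for i
  proof (cases "Suc i < 2 * n")
    case True then show ?thesis using e_mono[OF True] x_e by simp
  next
    case False
    then have "min i (2 * n - 1) = min (Suc i) (2 * n - 1)" by auto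
    then show ?thesis by (simp add: x_def)
  qed
  have ic: "independent_copies S I P x T"
    by unfold_locales (use x_S time lift_Suc_mono_le[of x, OF x_Suc] in auto)
  have xa: "x (2 * i) = a i" and xb: "x (2 * i + 1) = b i" if "i < n" for i
    using x_e[of "2 * i"] x_e[of "2 * i + 1"] endpoints[OF that] that by simp_all
  define E where "E = {\<omega> \<in> space M. \<forall>i<n. X (a i) T \<omega> = X (b i) T \<omega>}"
  have E_sets: "E \<in> sets M"
  proof -
    have "{\<omega> \<in> space M. X (a i) T \<omega> = X (b i) T \<omega>} \<in> sets M" if "i \<in> {..<n}" for i
      using states[of i] that time(1) by (intro borel_measurable_eq measurable_X) simp_all
    note sets.sets_Collect_finite_All[OF this finite_lessThan]
    then show ?thesis unfolding E_def by (simp only: Ball_def lessThan_iff)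
  qed
  have "E = {\<omega> \<in> space M. \<forall>i<n. X (x (2 * i)) T \<omega> = X (x (2 * i + 1)) T \<omega>}"
    unfolding E_def by (intro Collect_cong conj_cong refl all_cong) (simp only: xa xb)
  also have "prob \<dots> = pfaffian n A"
  proof (rule prob_particles_coalesced[OF ic _ antisymmetric])
    show "A k l = cross_or_meet_prob I P T (x k) (x l)" if "k < l" "l < 2 * n" for k l
      using entries[OF that] x_e[of k] x_e[of l] that by simp
  qed
  finally have E: "prob E = pfaffian n A" .
  have const: "(\<forall>y\<in>{a i..b i} \<inter> S. X y T \<omega> = X (a i) T \<omega>) \<longleftrightarrow> X (a i) T \<omega> = X (b i) T \<omega>"
    if "monotone_at T \<omega>" "i < n" for i \<omega>
    using monotone_constant_iff[OF that(1) states(1,2)[OF that(2)]] intervals[OF that(2)] by simp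
  define C where "C = {\<omega> \<in> space M. \<forall>i<n. \<forall>y\<in>{a i..b i} \<inter> S. X y T \<omega> = X (a i) T \<omega>}"
  have basins_C: "{\<omega> \<in> space M. \<forall>i<n. \<exists>B\<in>basins S X T \<omega>. {a i..b i} \<inter> S \<subseteq> B} = C"
    unfolding C_def using basin_contains_iff states(1) intervals
    by (intro Collect_cong conj_cong refl all_cong) (simp add: less_imp_le)
  from state_time consider (real) "S = UNIV" | (int) "S = \<int>" by blast
  then show ?thesis
  proof cases
    case real
    \<comment> \<open>On the line the flow is monotone for every outcome, on the integers only almost surely.\<close>
    have "C = E"
      unfolding C_def E_def using const monotone_continuous[OF real time(1)]
      by (intro Collect_cong conj_cong refl all_cong) blast+
    moreover have "prob {\<omega> \<in> space M. \<forall>i<n. walls S X T \<omega> \<inter> {a i<..<b i} = {}} = prob E"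
      if ends: "\<forall>i<n. AE \<omega> in M. a i \<notin> walls S X T \<omega> \<and> b i \<notin> walls S X T \<omega>"
    proof (rule finite_measure_eq_AE)
      have "{\<omega> \<in> space M. walls S X T \<omega> \<inter> {a i<..<b i} = {}} \<in> sets M" if "i \<in> {..<n}" for i
        by (rule sets_real_no_wall[OF real time(1)]) (use that intervals in simp)
      note sets.sets_Collect_finite_All[OF this finite_lessThan]
      then show "{\<omega> \<in> space M. \<forall>i<n. walls S X T \<omega> \<inter> {a i<..<b i} = {}} \<in> sets M"
        by (simp only: Ball_def lessThan_iff)
      have "AE \<omega> in M. \<forall>i\<in>{..<n}. a i \<notin> walls S X T \<omega> \<and> b i \<notin> walls S X T \<omega>"
        by (rule AE_finite_allI) (use ends in simp_all)
      then show "AE \<omega> in M. \<omega> \<in> {\<omega> \<in> space M. \<forall>i<n. walls S X T \<omega> \<inter> {a i<..<b i} = {}} \<longleftrightarrow> \<omega> \<in> E"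
        using AE_space
      proof eventually_elim
        case (elim \<omega>)
        then show ?case
          using real_no_wall_endpoints[OF real monotone_continuous[OF real time(1) elim(2)] intervals]
          by (simp add: E_def)
      qed
    qed (rule E_sets)
    ultimately show ?thesis using E basins_C real by simp
  next
    case int
    have "C \<in> sets M"
    proof -
      have "countable S" using int countable_int by simp
      then have c: "countable ({a i..b i} \<inter> S)" for i by (rule countable_subset[rotated]) auto
      have "{\<omega> \<in> space M. X y T \<omega> = X (a i) T \<omega>} \<in> sets M"
        if "i \<in> {..<n}" "y \<in> {a i..b i} \<inter> S" for i y
        using states(1)[of i] that time(1) by (intro borel_measurable_eq measurable_X) simp_all
      then have "{\<omega> \<in> space M. \<forall>y\<in>{a i..b i} \<inter> S. X y T \<omega> = X (a i) T \<omega>} \<in> sets M"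
        if "i \<in> {..<n}" for i
        by (rule sets.sets_Collect_countable_All'[OF _ c]) (rule that)
      note sets.sets_Collect_finite_All[OF this finite_lessThan]
      then show ?thesis unfolding C_def by (simp only: Ball_def lessThan_iff)
    qed
    have "prob C = prob E"
    proof (rule finite_measure_eq_AE[OF _ \<open>C \<in> sets M\<close> E_sets])
      show "AE \<omega> in M. \<omega> \<in> C \<longleftrightarrow> \<omega> \<in> E"
        using monotone_integer[OF int time(1)] AE_space
      proof eventually_elim
        case (elim \<omega>)
        then show ?case using const[OF elim(1)] by (simp add: C_def E_def)
      qed
    qed
    moreover have "{\<omega> \<in> space M. \<forall>i<n. walls S X T \<omega> \<inter> {a i<..<b i} = {}} = C"
      unfolding C_def using integer_no_wall_iff[OF int] states intervals int
      by (intro Collect_cong conj_cong refl all_cong) simp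
    ultimately show ?thesis using E basins_C by simp
  qed
qed

end
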